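(* (Notation and definitions are in the context.) (I) The Gerstenhaber-Giaquinto-Schack conjecture is true for $n=5$. That is, for every Belavin-Drinfeld triple $(\tau,\Gamma_1,\Gamma_2)$ for $\mathfrak{sl}(5)$ and every $\tau$-admissible $r^0=t^0/2+\tilde r^0$, the matrix $$R=q^{\tilde r^0}\,(R_s+\hat q\,\tilde a)\,q^{\tilde r^0}$$ satisfies the quantum Yang-Baxter equation $R_{12}R_{13}R_{23}=R_{23}R_{13}R_{12}$, and $PR$ satisfies the Hecke relation $(PR-q)(PR+q^{-1})=0$. (II) Let $\mathcal T$ be the set of Belavin-Drinfeld triples for $\mathfrak{sl}(5)$, with the action of $\mathbb Z/2\mathbb Z\times\mathbb Z/2\mathbb Z$ generated by the two commuting involutions $(\tau,\Gamma_1,\Gamma_2)\mapsto(\tau^{-1},\Gamma_2,\Gamma_1)$ and $(\tau,\Gamma_1,\Gamma_2)\mapsto(\sigma\tau\sigma,\sigma\Gamma_1,\sigma\Gamma_2)$, where $\sigma(\alpha_i)=\alpha_{5-i}$. There are exactly 13 orbits, and the 13 triples below form a complete set of representatives. (III) For each triple below, the displayed $r^0$ is the generic $\tau$-admissible element: the set of $\tau$-admissible elements is exactly the set of displayed elements as the parameters ($c$, or $x,y,z$) range over $\mathbb C$. The displayed $R$ is the matrix $q^{\tilde r^0}(R_s+\hat q\,\tilde a)q^{\tilde r^0}$ for this $r^0$. Write $h_i=h_{\alpha_i}$. 1(a) $\Gamma_1=\{\alpha_2,\alpha_3,\alpha_4\}$, $\Gamma_2=\{\alpha_1,\alpha_2,\alpha_3\}$,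 $\tau(\alpha_i)=\alpha_{i-1}$. $$r^0=\tfrac{t^0}{2}+\tfrac15(-3h_1\wedge h_2-4h_1\wedge h_3-3h_1\wedge h_4-4h_2\wedge h_3-4h_2\wedge h_4-3h_3\wedge h_4),$$ $$R=R(r^0)+\hat q\,(e_{54}\wedge_{2/5}e_{34}+e_{54}\wedge_{4/5}e_{23}+e_{54}\wedge_{6/5}e_{12}+e_{43}\wedge_{2/5}e_{23}+e_{43}\wedge_{4/5}e_{12}+e_{32}\wedge_{2/5}e_{12}+e_{53}\wedge_{2/5}e_{24}+e_{53}\wedge_{4/5}e_{13}+e_{42}\wedge_{2/5}e_{13}+e_{52}\wedge_{2/5}e_{14}).$$ 1(b) $\Gamma_1=\{\alpha_1,\alpha_3,\alpha_4\}$, $\Gamma_2=\{\alpha_1,\alpha_2,\alpha_4\}$, $\tau(\alpha_i)=\alpha_j$ with $j\equiv i+3\pmod 5$. $$r^0=\tfrac{t^0}{2}+\tfrac15(h_1\wedge h_2-2h_1\wedge h_3+h_1\wedge h_4-2h_2\wedge h_3-2h_2\wedge h_4+h_3\wedge h_4),$$ $$R=R(r^0)+\hat q\,(e_{54}\wedge_{2/5}e_{23}+e_{21}\wedge_{4/5}e_{23}+e_{43}\wedge_{6/5}e_{23}+e_{21}\wedge_{2/5}e_{45}+e_{43}\wedge_{4/5}e_{45}+e_{43}\wedge_{2/5}e_{12}+e_{53}\wedge_{2/5}e_{13}).$$ 2(a) $\Gamma_1=\{\alpha_3,\alpha_4\}$, $\Gamma_2=\{\alpha_1,\alpha_2\}$,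 $\tau(\alpha_i)=\alpha_{i-2}$. $$r^0=\tfrac{t^0}{2}+c\,h_1\wedge h_2+\tfrac{c-1}{2}h_1\wedge h_3+c\,h_1\wedge h_4-\tfrac{1+3c}{4}h_2\wedge h_3+\tfrac{c-1}{2}h_2\wedge h_4+c\,h_3\wedge h_4,$$ $$R=R(r^0)+\hat q\,(e_{43}\wedge_{(3+c)/8}e_{12}+e_{54}\wedge_{(3+c)/8}e_{23}+e_{53}\wedge_{(1-c)/2}e_{13}).$$ 2(b) $\Gamma_1=\{\alpha_3,\alpha_4\}$, $\Gamma_2=\{\alpha_1,\alpha_2\}$, $\tau(\alpha_i)=\alpha_{5-i}$. $$r^0=\tfrac{t^0}{2}+\tfrac15(-c\,h_1\wedge h_2-(1+c)h_1\wedge h_3-3h_1\wedge h_4-2h_2\wedge h_3+(c-1)h_2\wedge h_4+c\,h_3\wedge h_4),$$ $$R=R(r^0)+\hat q\,(e_{54}\wedge_{3/5}e_{12}+e_{43}\wedge_{4/5}e_{23}+e_{53}\wedge_{9/5}(-e_{13})).$$ 2(c) $\Gamma_1=\{\alpha_2,\alpha_4\}$, $\Gamma_2=\{\alpha_1,\alpha_3\}$, $\tau(\alpha_i)=\alpha_{i-1}$. $$r^0=\tfrac{t^0}{2}+c\,h_1\wedge h_2+(1+3c)h_1\wedge h_3+(\tfrac{8c}{3}+1)h_1\wedge h_4+(1+3c)h_2\wedge h_3+(1+3c)h_2\wedge h_4+c\,h_3\wedge h_4,$$ $$R=R(r^0)+\hat q\,(e_{32}\wedge_{1+c}e_{12}+e_{54}\wedge_{1+c}e_{34}).$$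 2(d) $\Gamma_1=\{\alpha_2,\alpha_4\}$, $\Gamma_2=\{\alpha_1,\alpha_3\}$, $\tau(\alpha_4)=\alpha_1$, $\tau(\alpha_2)=\alpha_3$. $$r^0=\tfrac{t^0}{2}+\tfrac15((2-c)h_1\wedge h_2+(1-c)h_1\wedge h_3-3h_1\wedge h_4+2h_2\wedge h_3+(c-1)h_2\wedge h_4+c\,h_3\wedge h_4),$$ $$R=R(r^0)+\hat q\,(e_{54}\wedge_{2/5}e_{12}+e_{32}\wedge_{2/5}e_{34}).$$ 2(e) $\Gamma_1=\{\alpha_1,\alpha_3\}$, $\Gamma_2=\{\alpha_1,\alpha_4\}$, $\tau(\alpha_i)=\alpha_j$ with $j\equiv i+3\pmod 5$. $$r^0=\tfrac{t^0}{2}+\tfrac{1-3c}{2}h_1\wedge h_2+\tfrac{c-1}{2}h_1\wedge h_3+c\,h_1\wedge h_4+(3c-1)h_2\wedge h_3+(3c-1)h_2\wedge h_4+c\,h_3\wedge h_4,$$ $$R=R(r^0)+\hat q\,(e_{43}\wedge_{(1+3c)/4}e_{12}+e_{21}\wedge_{(1+3c)/4}e_{45}+e_{43}\wedge_{1-c}e_{45}).$$ 2(f) $\Gamma_1=\{\alpha_2,\alpha_3\}$, $\Gamma_2=\{\alpha_1,\alpha_2\}$, $\tau(\alpha_i)=\alpha_{i-1}$. $$r^0=\tfrac{t^0}{2}+\tfrac{c-3}{6}h_1\wedge h_2+\tfrac{c-1}{2}h_1\wedge h_3+c\,h_1\wedge h_4+\tfrac{c-1}{2}h_2\wedge h_3+\tfrac{4c}{3}h_2\wedge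 h_4+c\,h_3\wedge h_4,$$ $$R=R(r^0)+\hat q\,(e_{32}\wedge_{1/2+c/6}e_{12}+e_{43}\wedge_{1/2+c/6}e_{23}+e_{43}\wedge_{1+c/3}e_{12}+e_{42}\wedge_{1/2+c/6}e_{13}).$$ 3(a) $\Gamma_1=\{\alpha_1\}$, $\Gamma_2=\{\alpha_2\}$, $\tau(\alpha_1)=\alpha_2$. $$r^0=\tfrac{t^0}{2}+\tfrac{1+y}{3}h_1\wedge h_2+y\,h_1\wedge h_3+\tfrac{3z-x}{3}h_1\wedge h_4+y\,h_2\wedge h_3+z\,h_2\wedge h_4+x\,h_3\wedge h_4,$$ $$R=R(r^0)+\hat q\,(e_{21}\wedge_{(2-y)/3}e_{23}).$$ 3(b) $\Gamma_1=\{\alpha_1\}$, $\Gamma_2=\{\alpha_3\}$, $\tau(\alpha_1)=\alpha_3$. $$r^0=\tfrac{t^0}{2}+\tfrac{z-2y}{2}h_1\wedge h_2+\tfrac{1+x}{2}h_1\wedge h_3+x\,h_1\wedge h_4+y\,h_2\wedge h_3+z\,h_2\wedge h_4+x\,h_3\wedge h_4,$$ $$R=R(r^0)+\hat q\,(e_{21}\wedge_{(2-z)/4}e_{34}).$$ 3(c) $\Gamma_1=\{\alpha_1\}$, $\Gamma_2=\{\alpha_4\}$, $\tau(\alpha_1)=\alpha_4$. $$r^0=\tfrac{t^0}{2}+\tfrac{y-2z}{2}h_1\wedge h_2+\tfrac{y-2x}{2}h_1\wedge h_3+\tfrac{1-x+z}{2}h_1\wedge h_4+y\,h_2\wedge h_3+z\,h_2\wedge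 h_4+x\,h_3\wedge h_4,$$ $$R=R(r^0)+\hat q\,(e_{21}\wedge_{(y+2)/4}e_{45}).$$ 3(d) $\Gamma_1=\{\alpha_2\}$, $\Gamma_2=\{\alpha_3\}$, $\tau(\alpha_2)=\alpha_3$. $$r^0=\tfrac{t^0}{2}+(-1+3y-z)h_1\wedge h_2+(-1-x+3y)h_1\wedge h_3+3(z-x)h_1\wedge h_4+y\,h_2\wedge h_3+z\,h_2\wedge h_4+x\,h_3\wedge h_4,$$ $$R=R(r^0)+\hat q\,(e_{32}\wedge_{1-x-y+z}e_{34}).$$ 4. $\Gamma_1=\Gamma_2=\emptyset$ (the trivial triple): $r^0=t^0/2+\tilde r^0$ with $\tilde r^0\in\mathfrak h\wedge\mathfrak h$ arbitrary, and $R=R(r^0)$.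
   Context: Let $n=5$, $\mathfrak g=\mathfrak{sl}(n)\subset M_n(\mathbb C)$ with invariant form $(x,y)=\mathrm{Tr}(xy)$. Let $e_{ij}$ be the matrix units, $\mathfrak h$ the Cartan subalgebra of traceless diagonal matrices, and $\Gamma=\{\alpha_1,\dots,\alpha_{n-1}\}$ the simple roots, with root vectors $e_{\alpha_i}=e_{i,i+1}$, $e_{-\alpha_i}=e_{i+1,i}$, and $h_{\alpha_i}=e_{ii}-e_{i+1,i+1}$. For a positive root $\alpha=\alpha_i+\dots+\alpha_{j-1}$ ($i<j$), put $e_\alpha=e_{ij}$ and $e_{-\alpha}=e_{ji}$. Let $t\in\mathfrak g\otimes\mathfrak g$ be the Casimir element of the form and $t^0=\sum_i e_{ii}\otimes e_{ii}-\frac1n I\otimes I$ its component in $\mathfrak h\otimes\mathfrak h$. For $x,y\in M_n(\mathbb C)$, $x\wedge y=\frac12(x\otimes y-y\otimes x)$; $\mathfrak h\wedge\mathfrak h$ is the span of such elements with $x,y\in\mathfrak h$. A Belavin-Drinfeld triple $(\tau,\Gamma_1,\Gamma_2)$ consists of subsets $\Gamma_1,\Gamma_2\subseteq\Gamma$ and a bijection $\tau:\Gamma_1\to\Gamma_2$ with $(\tau\alpha,\tau\beta)=(\alpha,\beta)$ for all $\alpha,\beta\in\Gamma_1$, such that for every $\alpha\in\Gamma_1$ there is $k\ge0$ with $\tau^k\alpha\in\Gamma_1$ but $\tau^{k+1}\alpha\notin\Gamma_1$. An element $r^0\in\mathfrak h\otimes\mathfrak h$ is $\tau$-admissible if $r^0_{12}+r^0_{21}=t^0$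 and $(\tau\alpha\otimes1)r^0+(1\otimes\alpha)r^0=0$ for all $\alpha\in\Gamma_1$. Such an $r^0$ has the form $t^0/2+\tilde r^0$ with $\tilde r^0\in\mathfrak h\wedge\mathfrak h$. Let $\mathfrak g_i$ be the Lie subalgebra of $\mathfrak g$ generated by $e_{\pm\alpha}$, $\alpha\in\Gamma_i$. Extend $\tau$ to the Lie algebra isomorphism $\tau:\mathfrak g_1\to\mathfrak g_2$ with $\tau(e_{\pm\alpha})=e_{\pm\tau\alpha}$ for $\alpha\in\Gamma_1$, and extend $\tau$ linearly to roots in the span of $\Gamma_1$. For positive roots write $\alpha\prec\beta$ if $\tau^k\alpha$ is defined and equals $\beta$ for some integer $k\ge1$. Let $q$ be the quantum parameter (e.g. $q=e^{h}$ with $h$ formal, with $q^X=e^{hX}$ for a scalar or matrix $X$), and $\hat q=q-q^{-1}$. All products are taken in $M_n\otimes M_n$. Define $$a=2\sum_{\alpha\prec\beta}e_{-\alpha}\wedge\tau^k(e_\alpha)=\sum_{\alpha\prec\beta}\bigl(e_{-\alpha}\otimes\tau^k(e_\alpha)-\tau^k(e_\alpha)\otimes e_{-\alpha}\bigr),$$ where $\tau^k\alpha=\beta$ (so that $\tau^k(e_\alpha)=\pm e_\beta$ is the root vector for $\beta$ obtained by transporting $e_\alpha$ along $\tau$); $$c_+=\sum_{\alpha>0}e_{-\alpha}\otimes e_\alpha,\qquad c=\sum_{\alpha>0}e_{-\alpha}\wedge e_\alpha,\qquad \epsilon=ac+ca+a^2.$$ (In this definition $c$ is a matrix; elsewhere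 $c$ is a scalar parameter.) Writing $a=\sum a^{ik}_{jl}\,e_{ij}\otimes e_{kl}$ and $\epsilon=\sum\epsilon^{ik}_{jl}\,e_{ij}\otimes e_{kl}$, set $$\tilde a=\sum a^{ik}_{jl}\,q^{a^{ik}_{jl}\epsilon^{ik}_{jl}}\,e_{ij}\otimes e_{kl}.$$ The standard $R$-matrix is $$R_s=q^{t^0+1/n}+\hat q\,c_+=q\sum_i e_{ii}\otimes e_{ii}+\sum_{i\ne j}e_{ii}\otimes e_{jj}+\hat q\sum_{i>j}e_{ij}\otimes e_{ji}.$$ Here $P$ is the permutation (flip) matrix on $\mathbb C^n\otimes\mathbb C^n$, and $R_{12},R_{13},R_{23}$ denote $R$ acting on the indicated factors of $(\mathbb C^n)^{\otimes3}$. For $r^0=t^0/2+\tilde r^0$ put $R(r^0)=q^{\tilde r^0}R_s\,q^{\tilde r^0}$ (the standard multiparameter $R$-matrix). Explicitly, if $\tilde r^0=\sum_{i<j}c_{ij}\,e_{ii}\wedge e_{jj}$, then $$R(r^0)=q\sum_i e_{ii}\otimes e_{ii}+\sum_{i<j}(q^{c_{ij}}e_{ii}\otimes e_{jj}+q^{-c_{ij}}e_{jj}\otimes e_{ii})+\hat q\sum_{i>j}e_{ij}\otimes e_{ji}.$$ For matrices $u,v$ and a scalar $s$, the quantized wedge is $u\wedge_s v=q^{-s}\,u\otimes v-q^{s}\,v\otimes u$. *)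

theory Defs
  imports "HOL-Analysis.Analysis" "HOL-Computational_Algebra.Formal_Power_Series"
begin

section \<open>Matrices and tensors\<close>

text \<open>
  \<open>M\<^sub>5(\<complex>)\<close> is the type \<open>complex^5^5\<close>, and \<open>M\<^sub>n \<otimes> M\<^sub>n\<close> consists of the matrices indexed by pairs.
  Matrix indices and simple roots are written as natural numbers \<open>1, \<dots>, 5\<close> resp. \<open>1, \<dots>, 4\<close> and
  are mapped into the index type by \<^const>\<open>of_nat\<close>, which is a bijection from \<open>{1..5}\<close> onto the
  type \<open>5\<close>.  The order of the type \<open>5\<close> is never used (there \<open>5 = 0\<close> is the least element).
\<close>

type_synonym 'k mat1 = "'k^5^5"
type_synonym 'k mat2 = "'k^(5 \<times> 5)^(5 \<times> 5)"
type_synonym 'k mat3 = "'k^(5 \<times> 5 \<times> 5)^(5 \<times> 5 \<times> 5)"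

definition smult_mat :: "'k::times \<Rightarrow> 'k^'m^'n \<Rightarrow> 'k^'m^'n"  (infixr \<open>\<odot>\<close> 75)
  where "c \<odot> A = map_matrix ((*) c) A"

interpretation cmat: vector_space "(\<odot>) :: complex \<Rightarrow> complex^'m::finite^'n::finite \<Rightarrow> _"
  by unfold_locales (simp_all add: smult_mat_def vec_eq_iff algebra_simps)

definition E :: "nat \<Rightarrow> nat \<Rightarrow> 'k::zero_neq_one mat1"
  where "E i j = (\<chi> r s. if r = of_nat i \<and> s = of_nat j then 1 else 0)"

text \<open>The coefficient of \<open>e\<^sub>i\<^sub>j \<otimes> e\<^sub>k\<^sub>l\<close> in \<open>A\<close> is the entry \<open>A $ (i, k) $ (j, l)\<close>.\<close>

definition tensor :: "'k::times mat1 \<Rightarrow> 'k mat1 \<Rightarrow> 'k mat2"  (infixl \<open>\<otimes>\<close> 80)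
  where "A \<otimes> B = (\<chi> x y. A $ fst x $ fst y * B $ snd x $ snd y)"

definition wedge :: "complex mat1 \<Rightarrow> complex mat1 \<Rightarrow> complex mat2"  (infixl \<open>\<^bold>\<and>\<close> 80)
  where "x \<^bold>\<and> y = (1/2) \<odot> (x \<otimes> y - y \<otimes> x)"

definition flip :: "'k mat2 \<Rightarrow> 'k mat2"
  where "flip r = (\<chi> x y. r $ prod.swap x $ prod.swap y)"

definition leg12 :: "'k::zero mat2 \<Rightarrow> 'k mat3"
  where "leg12 R = (\<chi> x y. case (x, y) of ((i, j, k), (i', j', k')) \<Rightarrow>
           if k = k' then R $ (i, j) $ (i', j') else 0)"

definition leg13 :: "'k::zero mat2 \<Rightarrow> 'k mat3"
  where "leg13 R = (\<chi> x y. case (x, y) of ((i, j, k), (i', j', k')) \<Rightarrow>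
           if j = j' then R $ (i, k) $ (i', k') else 0)"

definition leg23 :: "'k::zero mat2 \<Rightarrow> 'k mat3"
  where "leg23 R = (\<chi> x y. case (x, y) of ((i, j, k), (i', j', k')) \<Rightarrow>
           if i = i' then R $ (j, k) $ (j', k') else 0)"

definition flip_mat :: "'k::zero_neq_one mat2"
  where "flip_mat = (\<chi> x y. if x = prod.swap y then 1 else 0)"


section \<open>The quantum parameter\<close>

text \<open>
  \<open>q = e\<^sup>h\<close> with \<open>h\<close> the indeterminate of \<open>\<complex>[[h]]\<close>; for a scalar \<open>s\<close>, \<open>q\<^sup>s = e\<^sup>h\<^sup>s\<close> is
  \<^term>\<open>fps_exp s\<close>, and for a matrix \<open>X\<close>, \<open>q\<^sup>X = \<Sum>\<^sub>k X\<^sup>k h\<^sup>k / k!\<close>.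
\<close>

definition qpow :: "complex \<Rightarrow> complex fps"
  where "qpow s = fps_exp s"

primrec mat_pow :: "'k::semiring_1^'n^'n \<Rightarrow> nat \<Rightarrow> 'k^'n^'n"
  where
    "mat_pow X 0 = mat 1"
  | "mat_pow X (Suc k) = X ** mat_pow X k"

definition qmat :: "complex^'n^'n \<Rightarrow> complex fps^'n^'n"
  where "qmat X = (\<chi> i j. Abs_fps (\<lambda>k. mat_pow X k $ i $ j / fact k))"

definition qhat :: "complex fps"
  where "qhat = qpow 1 - qpow (- 1)"

definition qwedge :: "complex fps mat1 \<Rightarrow> complex \<Rightarrow> complex fps mat1 \<Rightarrow> complex fps mat2"
    (\<open>(_ \<^bold>\<and>[_] _)\<close> [81, 0, 81] 80)
  where "u \<^bold>\<and>[s] v = qpow (- s) \<odot> (u \<otimes> v) - qpow s \<odot> (v \<otimes> u)"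

definition QYBE :: "complex fps mat2 \<Rightarrow> bool"
  where "QYBE R \<longleftrightarrow> leg12 R ** leg13 R ** leg23 R = leg23 R ** leg13 R ** leg12 R"

definition Hecke :: "complex fps mat2 \<Rightarrow> bool"
  where "Hecke R \<longleftrightarrow> (flip_mat ** R - qpow 1 \<odot> mat 1) ** (flip_mat ** R + qpow (- 1) \<odot> mat 1) = 0"


section \<open>The Cartan subalgebra and the simple roots\<close>

definition cartan :: "complex mat1 set"
  where "cartan = {x. (\<forall>i j. i \<noteq> j \<longrightarrow> x $ i $ j = 0) \<and> trace x = 0}"

definition cartan_tensor :: "complex mat2 set"
  where "cartan_tensor = cmat.span {x \<otimes> y | x y. x \<in> cartan \<and> y \<in> cartan}"

definition cartan_wedge :: "complex mat2 set"
  where "cartan_wedge = cmat.span {x \<^bold>\<and> y | x y. x \<in> cartan \<and> y \<in> cartan}"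

definition H :: "nat \<Rightarrow> complex mat1"
  where "H i = E i i - E (Suc i) (Suc i)"

definition t0 :: "complex mat2"
  where "t0 = (\<Sum>i = 1..5. E i i \<otimes> E i i) - (1/5) \<odot> (mat 1 \<otimes> mat 1)"

text \<open>The simple root \<open>\<alpha>\<^sub>i\<close> is represented by its index; as a functional it is the following one.\<close>

definition simple_root :: "nat \<Rightarrow> complex mat1 \<Rightarrow> complex"
  where "simple_root i x = x $ of_nat i $ of_nat i - x $ of_nat (Suc i) $ of_nat (Suc i)"

text \<open>
  The form on the dual of the Cartan subalgebra is transported along the trace form, under which
  \<open>\<alpha>\<^sub>i\<close> corresponds to \<open>h\<^sub>i\<close>.
\<close>

definition root_form :: "nat \<Rightarrow> nat \<Rightarrow> complex"
  where "root_form i j = trace (H i ** H j)"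

text \<open>\<open>(f \<otimes> 1) r\<close> and \<open>(1 \<otimes> f) r\<close> for a linear functional \<open>f\<close>.\<close>

definition apply_left :: "(complex mat1 \<Rightarrow> complex) \<Rightarrow> complex mat2 \<Rightarrow> complex mat1"
  where "apply_left f r = (\<chi> k l. f (\<chi> i j. r $ (i, k) $ (j, l)))"

definition apply_right :: "(complex mat1 \<Rightarrow> complex) \<Rightarrow> complex mat2 \<Rightarrow> complex mat1"
  where "apply_right f r = (\<chi> i j. f (\<chi> k l. r $ (i, k) $ (j, l)))"


section \<open>Belavin-Drinfeld triples\<close>

text \<open>
  The bijection \<open>\<tau>\<close> is a partial map with domain \<open>\<Gamma>\<^sub>1\<close>, so that equality of triples is equality
  of the values.  The partial map \<open>pmap_pow f k\<close> is the \<open>k\<close>-th iterate, defined where all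
  intermediate values are.
\<close>

type_synonym triple = "(nat \<rightharpoonup> nat) \<times> nat set \<times> nat set"

primrec pmap_pow :: "('a \<rightharpoonup> 'a) \<Rightarrow> nat \<Rightarrow> 'a \<rightharpoonup> 'a"
  where
    "pmap_pow f 0 = Some"
  | "pmap_pow f (Suc k) = f \<circ>\<^sub>m pmap_pow f k"

fun bd_triple :: "triple \<Rightarrow> bool"
  where "bd_triple (\<tau>, \<Gamma>1, \<Gamma>2) \<longleftrightarrow>
    \<Gamma>1 \<subseteq> {1..4} \<and> \<Gamma>2 \<subseteq> {1..4} \<and>
    dom \<tau> = \<Gamma>1 \<and> bij_betw (\<lambda>i. the (\<tau> i)) \<Gamma>1 \<Gamma>2 \<and>
    (\<forall>\<alpha>\<in>\<Gamma>1. \<forall>\<beta>\<in>\<Gamma>1. root_form (the (\<tau> \<alpha>)) (the (\<tau> \<beta>)) = root_form \<alpha> \<beta>) \<and>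
    (\<forall>\<alpha>\<in>\<Gamma>1. \<exists>k \<beta> \<gamma>. pmap_pow \<tau> k \<alpha> = Some \<beta> \<and> \<beta> \<in> \<Gamma>1 \<and>
                      pmap_pow \<tau> (Suc k) \<alpha> = Some \<gamma> \<and> \<gamma> \<notin> \<Gamma>1)"

fun admissible :: "triple \<Rightarrow> complex mat2 \<Rightarrow> bool"
  where "admissible (\<tau>, \<Gamma>1, \<Gamma>2) r0 \<longleftrightarrow>
    r0 \<in> cartan_tensor \<and> r0 + flip r0 = t0 \<and>
    (\<forall>\<alpha>\<in>\<Gamma>1. apply_left (simple_root (the (\<tau> \<alpha>))) r0 + apply_right (simple_root \<alpha>) r0 = 0)"


subsection \<open>Extension of \<open>\<tau>\<close> to roots and to Lie algebras\<close>

text \<open>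
  The pair \<open>(i, j)\<close> with \<open>i < j\<close> stands for the positive root \<open>\<alpha>\<^sub>i + \<dots> + \<alpha>\<^bsub>j-1\<^esub>\<close>.
  Elements of the root lattice are given by their coefficients on the simple roots.
\<close>

definition pos_roots :: "(nat \<times> nat) set"
  where "pos_roots = {(i, j). 1 \<le> i \<and> i < j \<and> j \<le> 5}"

definition root_coeffs :: "nat \<times> nat \<Rightarrow> nat \<Rightarrow> int"
  where "root_coeffs = (\<lambda>(i, j) k. if i \<le> k \<and> k < j then 1 else 0)"

definition pos_vec :: "nat \<times> nat \<Rightarrow> complex mat1"
  where "pos_vec = (\<lambda>(i, j). E i j)"

definition neg_vec :: "nat \<times> nat \<Rightarrow> complex mat1"
  where "neg_vec = (\<lambda>(i, j). E j i)"

definition tau_root :: "(nat \<rightharpoonup> nat) \<Rightarrow> (nat \<Rightarrow> int) \<rightharpoonup> (nat \<Rightarrow> int)"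
  where "tau_root \<tau> m =
    (if {k. m k \<noteq> 0} \<subseteq> dom \<tau>
     then Some (\<lambda>l. \<Sum>k\<in>dom \<tau>. if \<tau> k = Some l then m k else 0)
     else None)"

definition root_maps :: "(nat \<rightharpoonup> nat) \<Rightarrow> nat \<Rightarrow> nat \<times> nat \<Rightarrow> nat \<times> nat \<Rightarrow> bool"
  where "root_maps \<tau> k \<alpha> \<beta> \<longleftrightarrow> pmap_pow (tau_root \<tau>) k (root_coeffs \<alpha>) = Some (root_coeffs \<beta>)"

definition root_less :: "(nat \<rightharpoonup> nat) \<Rightarrow> nat \<times> nat \<Rightarrow> nat \<times> nat \<Rightarrow> bool"
  where "root_less \<tau> \<alpha> \<beta> \<longleftrightarrow> (\<exists>k\<ge>1. root_maps \<tau> k \<alpha> \<beta>)"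

text \<open>For a Belavin-Drinfeld triple, the exponent \<open>k\<close> with \<open>\<tau>\<^sup>k \<alpha> = \<beta>\<close> is unique if it exists.\<close>

definition root_exponent :: "(nat \<rightharpoonup> nat) \<Rightarrow> nat \<times> nat \<Rightarrow> nat \<times> nat \<Rightarrow> nat"
  where "root_exponent \<tau> \<alpha> \<beta> = (LEAST k. 1 \<le> k \<and> root_maps \<tau> k \<alpha> \<beta>)"

definition lie_bracket :: "complex mat1 \<Rightarrow> complex mat1 \<Rightarrow> complex mat1"
  where "lie_bracket x y = x ** y - y ** x"

definition lie_subalgebra :: "complex mat1 set \<Rightarrow> bool"
  where "lie_subalgebra L \<longleftrightarrow> cmat.subspace L \<and> (\<forall>x\<in>L. \<forall>y\<in>L. lie_bracket x y \<in> L)"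

definition gen_subalgebra :: "nat set \<Rightarrow> complex mat1 set"
  where "gen_subalgebra \<Gamma> = lie_subalgebra hull ((\<lambda>i. E i (Suc i)) ` \<Gamma> \<union> (\<lambda>i. E (Suc i) i) ` \<Gamma>)"

definition lie_iso ::
    "(complex mat1 \<Rightarrow> complex mat1) \<Rightarrow> complex mat1 set \<Rightarrow> complex mat1 set \<Rightarrow> bool"
  where "lie_iso \<phi> L M \<longleftrightarrow> bij_betw \<phi> L M \<and>
    (\<forall>x\<in>L. \<forall>y\<in>L. \<phi> (x + y) = \<phi> x + \<phi> y) \<and>
    (\<forall>c. \<forall>x\<in>L. \<phi> (c \<odot> x) = c \<odot> \<phi> x) \<and>
    (\<forall>x\<in>L. \<forall>y\<in>L. \<phi> (lie_bracket x y) = lie_bracket (\<phi> x) (\<phi> y))"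

text \<open>
  The values of \<open>tau_lie\<close> on \<open>gen_subalgebra \<Gamma>1\<close> are determined by the values on the generators; outside
  \<open>gen_subalgebra \<Gamma>1\<close> it is arbitrary.
\<close>

fun tau_lie :: "triple \<Rightarrow> complex mat1 \<Rightarrow> complex mat1"
  where "tau_lie (\<tau>, \<Gamma>1, \<Gamma>2) = (SOME \<phi>. lie_iso \<phi> (gen_subalgebra \<Gamma>1) (gen_subalgebra \<Gamma>2) \<and>
    (\<forall>i\<in>\<Gamma>1. \<phi> (E i (Suc i)) = E (the (\<tau> i)) (Suc (the (\<tau> i))) \<and>
             \<phi> (E (Suc i) i) = E (Suc (the (\<tau> i))) (the (\<tau> i))))"


section \<open>The Gerstenhaber-Giaquinto-Schack matrix\<close>

definition a_mat :: "triple \<Rightarrow> complex mat2"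
  where "a_mat T = 2 \<odot> (\<Sum>(\<alpha>, \<beta>) \<in> {(\<alpha>, \<beta>) \<in> pos_roots \<times> pos_roots. root_less (fst T) \<alpha> \<beta>}.
    neg_vec \<alpha> \<^bold>\<and> (tau_lie T ^^ root_exponent (fst T) \<alpha> \<beta>) (pos_vec \<alpha>))"

definition c_plus :: "complex mat2"
  where "c_plus = (\<Sum>\<alpha>\<in>pos_roots. neg_vec \<alpha> \<otimes> pos_vec \<alpha>)"

definition c_mat :: "complex mat2"
  where "c_mat = (\<Sum>\<alpha>\<in>pos_roots. neg_vec \<alpha> \<^bold>\<and> pos_vec \<alpha>)"

definition eps_mat :: "triple \<Rightarrow> complex mat2"
  where "eps_mat T = a_mat T ** c_mat + c_mat ** a_mat T + a_mat T ** a_mat T"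

definition a_tilde :: "triple \<Rightarrow> complex fps mat2"
  where "a_tilde T = (\<chi> x y. fps_const (a_mat T $ x $ y) * qpow (a_mat T $ x $ y * eps_mat T $ x $ y))"

definition R_s :: "complex fps mat2"
  where "R_s = qmat (t0 + (1/5) \<odot> mat 1) + qhat \<odot> map_matrix fps_const c_plus"

definition r_tilde :: "complex mat2 \<Rightarrow> complex mat2"
  where "r_tilde r0 = r0 - (1/2) \<odot> t0"

definition R_std :: "complex mat2 \<Rightarrow> complex fps mat2"
  where "R_std r0 = qmat (r_tilde r0) ** R_s ** qmat (r_tilde r0)"

definition R_GGS :: "triple \<Rightarrow> complex mat2 \<Rightarrow> complex fps mat2"
  where "R_GGS T r0 = qmat (r_tilde r0) ** (R_s + qhat \<odot> a_tilde T) ** qmat (r_tilde r0)"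

text \<open>
  \<open>generic_solution T U \<rho> W\<close>: the admissible elements for \<open>T\<close> are exactly the \<open>t\<^sup>0/2 + \<rho> u\<close> with
  \<open>u \<in> U\<close>, and for these \<open>R = R(r\<^sup>0) + (q - q\<^sup>-\<^sup>1) W u\<close>.
\<close>

definition generic_solution ::
    "triple \<Rightarrow> 'p set \<Rightarrow> ('p \<Rightarrow> complex mat2) \<Rightarrow> ('p \<Rightarrow> complex fps mat2) \<Rightarrow> bool"
  where "generic_solution T U \<rho> W \<longleftrightarrow>
    {r0. admissible T r0} = (\<lambda>u. (1/2) \<odot> t0 + \<rho> u) ` U \<and>
    (\<forall>u\<in>U. R_GGS T ((1/2) \<odot> t0 + \<rho> u) = R_std ((1/2) \<odot> t0 + \<rho> u) + qhat \<odot> W u)"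


section \<open>The action on triples\<close>

fun bd_inv :: "triple \<Rightarrow> triple"
  where "bd_inv (\<tau>, \<Gamma>1, \<Gamma>2) =
    ((\<lambda>j. if j \<in> \<Gamma>2 then Some (THE i. \<tau> i = Some j) else None), \<Gamma>2, \<Gamma>1)"

definition sigma :: "nat \<Rightarrow> nat"
  where "sigma i = 5 - i"

fun bd_sigma :: "triple \<Rightarrow> triple"
  where "bd_sigma (\<tau>, \<Gamma>1, \<Gamma>2) =
    ((\<lambda>i. if i \<in> sigma ` \<Gamma>1 then map_option sigma (\<tau> (sigma i)) else None),
     sigma ` \<Gamma>1, sigma ` \<Gamma>2)"

text \<open>\<open>bool \<times> bool\<close> plays the role of \<open>\<int>/2 \<times> \<int>/2\<close>.\<close>

definition bd_act :: "bool \<times> bool \<Rightarrow> triple \<Rightarrow> triple"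
  where "bd_act = (\<lambda>(u, v). (if u then bd_inv else id) \<circ> (if v then bd_sigma else id))"

definition bd_orbit :: "triple \<Rightarrow> triple set"
  where "bd_orbit T = range (\<lambda>g. bd_act g T)"


section \<open>The thirteen triples\<close>

definition triple_of :: "nat set \<Rightarrow> nat set \<Rightarrow> (nat \<Rightarrow> nat) \<Rightarrow> triple"
  where "triple_of \<Gamma>1 \<Gamma>2 f = ((Some \<circ> f) |` \<Gamma>1, \<Gamma>1, \<Gamma>2)"

definition "T1a = triple_of {2, 3, 4} {1, 2, 3} (\<lambda>i. i - 1)"
definition "T1b = triple_of {1, 3, 4} {1, 2, 4} (\<lambda>i. (i + 3) mod 5)"
definition "T2a = triple_of {3, 4} {1, 2} (\<lambda>i. i - 2)"
definition "T2b = triple_of {3, 4} {1, 2} (\<lambda>i. 5 - i)"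
definition "T2c = triple_of {2, 4} {1, 3} (\<lambda>i. i - 1)"
definition "T2d = triple_of {2, 4} {1, 3} (\<lambda>i. if i = 4 then 1 else 3)"
definition "T2e = triple_of {1, 3} {1, 4} (\<lambda>i. (i + 3) mod 5)"
definition "T2f = triple_of {2, 3} {1, 2} (\<lambda>i. i - 1)"
definition "T3a = triple_of {1} {2} (\<lambda>_. 2)"
definition "T3b = triple_of {1} {3} (\<lambda>_. 3)"
definition "T3c = triple_of {1} {4} (\<lambda>_. 4)"
definition "T3d = triple_of {2} {3} (\<lambda>_. 3)"
definition "T4 = triple_of {} {} id"

definition bd_reps :: "triple set"
  where "bd_reps = {T1a, T1b, T2a, T2b, T2c, T2d, T2e, T2f, T3a, T3b, T3c, T3d, T4}"

end

theory Submission
  imports Defs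
begin

text \<open>
  Two diagonal parts that are admissible for the same triple differ by an antisymmetric \<open>s\<close> which is
  compatible with the weights of all nonzero entries of \<open>R\<^sub>s + (q - q\<^sup>-\<^sup>1) a\<close>.  Along every path that
  contributes to the Yang-Baxter equation, such an \<open>s\<close> produces the same power of \<open>q\<close>, depending on
  the end points only, so the equation for one admissible \<open>r\<^sup>0\<close> implies it for all of them; for the
  Hecke relation antisymmetry alone suffices.  Allowing diagonal parts in \<open>\<gg>\<ll>(5)\<close> instead of
  \<open>\<ss>\<ll>(5)\<close>, one can choose one for which all entries lie in \<open>\<int>[q, q\<^sup>-\<^sup>1]\<close>; the equations are then
  finite identities between signed sums of monomials, checked for each of the 33 triples.
\<close>

text \<open>The admissibility equations see a diagonal part only through differences along roots,
  and the constant -1/5 of t^0 cancels from them. This is why diagonal parts outside sl(5) may be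
  used: within sl(5) a triple such as 1(a) forces exponents with denominator 5, while over gl(5)
  half-integral solutions exist. The difference of two such solutions satisfies the homogeneous
  equations on simple roots, and these propagate along strings of simple roots and along iterates of
  \<tau> to every root that occurs in a. A second obstacle is that \<open>tau_lie\<close> is an
  arbitrary choice among isomorphisms, so the values \<tau>^k(e_\<alpha>), and above all their
  signs, have to be derived. Uniqueness follows from the generators; existence is obtained by
  restricting an automorphism of the whole matrix Lie algebra, on which the signs can be read off.
  The entrywise power in the definition of the modified a stays manageable because distinct links
  occupy distinct matrix positions: every nonzero entry of a is +-1, and the exponent is a sign
  times an entry of \<epsilon>.\<close>

text \<open>
  The datatype \<open>ix\<close> replaces the index type \<open>5\<close> because its equality is decided by one rewrite
  step; the finite checks below are evaluated by the simplifier.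
\<close>

datatype ix = I1 | I2 | I3 | I4 | I5

section \<open>The five-element index type and its bijection with the type \<open>5\<close>\<close>

lemma UNIV_ix: "UNIV = {I1, I2, I3, I4, I5}"
  using ix.exhaust by auto

instance ix :: finite
  by standard (simp add: UNIV_ix)

lemma sum_ix: "(\<Sum>i\<in>UNIV. f i) = f I1 + f I2 + f I3 + f I4 + f I5"
  by (simp add: UNIV_ix add.assoc)

lemma all_ix: "(\<forall>i. P i) \<longleftrightarrow> P I1 \<and> P I2 \<and> P I3 \<and> P I4 \<and> P I5"
  by (metis ix.exhaust)

fun nat_ix :: "ix \<Rightarrow> nat"
  where "nat_ix I1 = 1" | "nat_ix I2 = 2" | "nat_ix I3 = 3" | "nat_ix I4 = 4" | "nat_ix I5 = 5"

definition el :: "ix \<Rightarrow> 5"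
  where "el i = of_nat (nat_ix i)"

lemma of_nat_inj_5: "i \<in> {1..5} \<Longrightarrow> j \<in> {1..5} \<Longrightarrow> (of_nat i :: 5) = of_nat j \<longleftrightarrow> i = j"
proof -
  assume "i \<in> {1..5}" "j \<in> {1..5}"
  hence "i = 1 \<or> i = 2 \<or> i = 3 \<or> i = 4 \<or> i = 5" "j = 1 \<or> j = 2 \<or> j = 3 \<or> j = 4 \<or> j = 5" by auto
  thus ?thesis by (elim disjE) simp_all
qed

lemma nat_ix_range: "nat_ix i \<in> {1..5}"
  by (cases i) auto

lemma nat_ix_image: "range nat_ix = {1..5}"
proof -
  have "{1..5::nat} = {1, 2, 3, 4, 5}" by auto
  thus ?thesis by (auto simp: UNIV_ix)
qed

lemma nat_ix_inj [simp]: "nat_ix i = nat_ix j \<longleftrightarrow> i = j"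
  by (cases i; cases j) auto

lemma el_inj [simp]: "el i = el j \<longleftrightarrow> i = j"
  using of_nat_inj_5 nat_ix_range by (simp add: el_def)

lemma bij_el: "bij el"
proof -
  have "inj el" by (simp add: inj_def)
  moreover have "card (range el) = CARD(5)"
    using card_image[OF \<open>inj el\<close>] by (simp add: UNIV_ix)
  ultimately show ?thesis
    by (metis bij_def card_subset_eq finite top_greatest)
qed

lemma el_surj: "\<exists>i. x = el i"
  using bij_el by (metis bij_pointE)

lemma sum_el: "(\<Sum>x\<in>UNIV. f x) = (\<Sum>i\<in>UNIV. f (el i))"
  by (rule sum.reindex_bij_betw[symmetric]) (rule bij_el)

lemma all_el: "(\<forall>x. P x) \<longleftrightarrow> (\<forall>i. P (el i))"
  by (metis el_surj)

abbreviation ent :: "'k mat2 \<Rightarrow> ix \<Rightarrow> ix \<Rightarrow> ix \<Rightarrow> ix \<Rightarrow> 'k"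
  where "ent A i k j l \<equiv> A $ (el i, el k) $ (el j, el l)"

lemma mat2_eqI: "(\<And>i k j l. ent A i k j l = ent B i k j l) \<Longrightarrow> A = B"
  unfolding vec_eq_iff split_paired_All all_el by blast

lemma sum_pair: "(\<Sum>x\<in>(UNIV::('a::finite\<times>'b::finite) set). f x) = (\<Sum>i\<in>UNIV. \<Sum>j\<in>UNIV. f (i, j))"
  by (simp add: sum.cartesian_product UNIV_Times_UNIV[symmetric] del: UNIV_Times_UNIV)

lemma ent_mult: "ent (A ** B) i k j l = (\<Sum>u\<in>UNIV. \<Sum>v\<in>UNIV. ent A i k u v * ent B u v j l)"
  by (simp add: matrix_matrix_mult_def sum_pair sum_el)

lemma ent_tensor: "ent (A \<otimes> B) i k j l = A $ el i $ el j * B $ el k $ el l"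
  by (simp add: tensor_def)

lemma E_entry: "E m n $ el r $ el s = (if nat_ix r = m \<and> nat_ix s = n then 1 else 0)"
  if "m \<in> {1..5}" "n \<in> {1..5}"
  using that of_nat_inj_5 nat_ix_range by (simp add: E_def el_def)

lemma E_entry': "E (nat_ix m) (nat_ix n) $ el r $ el s = (if r = m \<and> s = n then 1 else 0)"
  unfolding E_entry[OF nat_ix_range nat_ix_range] nat_ix_inj by (rule refl)

lemma ent_smult [simp]: "(c \<odot> A) $ x $ y = c * A $ x $ y"
  by (simp add: smult_mat_def)

section \<open>Yang-Baxter and Hecke in coordinates\<close>

type_synonym 'a tens = "ix \<Rightarrow> ix \<Rightarrow> ix \<Rightarrow> ix \<Rightarrow> 'a"

text \<open>Entry of R_12 R_13 R_23 in row (x1, x2, x3) and column (y1, y2, y3). Each factor leaves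
  one leg alone, so three intermediate indices remain; a summand is a path through three
  crossings.\<close>

definition ybe_left :: "'a::comm_ring_1 tens \<Rightarrow> ix \<Rightarrow> ix \<Rightarrow> ix \<Rightarrow> ix \<Rightarrow> ix \<Rightarrow> ix \<Rightarrow> 'a"
  where "ybe_left R x1 x2 x3 y1 y2 y3 =
    (\<Sum>u1\<in>UNIV. \<Sum>u2\<in>UNIV. \<Sum>u3\<in>UNIV. R x1 x2 u1 u2 * R u1 x3 y1 u3 * R u2 u3 y2 y3)"

text \<open>Entry of R_23 R_13 R_12. With this order of summation, reversing the three legs gives
  \<open>ybe_left\<close> up to one exchange of sums.\<close>

definition ybe_right :: "'a::comm_ring_1 tens \<Rightarrow> ix \<Rightarrow> ix \<Rightarrow> ix \<Rightarrow> ix \<Rightarrow> ix \<Rightarrow> ix \<Rightarrow> 'a"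
  where "ybe_right R x1 x2 x3 y1 y2 y3 =
    (\<Sum>u2\<in>UNIV. \<Sum>u3\<in>UNIV. \<Sum>u1\<in>UNIV. R x2 x3 u2 u3 * R x1 u3 u1 y3 * R u1 u2 y1 y2)"

text \<open>Entry of (P R)^2 in row (k, i) and column (m, n): the flip between the two factors turns
  the column (j, l) into the row (l, j).\<close>

definition hecke_left :: "'a::comm_ring_1 tens \<Rightarrow> ix \<Rightarrow> ix \<Rightarrow> ix \<Rightarrow> ix \<Rightarrow> 'a"
  where "hecke_left R i k m n = (\<Sum>j\<in>UNIV. \<Sum>l\<in>UNIV. R i k j l * R l j m n)"

lemma qpow_add: "qpow (a + b) = qpow a * qpow b"
  by (simp add: qpow_def fps_exp_add_mult)

lemma qpow_0 [simp]: "qpow 0 = 1"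
  by (simp add: qpow_def)

lemma sum_delta_mult:
  fixes f g :: "'i::finite \<Rightarrow> 'a::semiring_1"
  shows "(\<Sum>u\<in>UNIV. (if u = x then f u else 0) * g u) = f x * g x"
  by (simp add: if_distrib[of "\<lambda>z. z * _"] cong: if_cong)

lemma leg_entries:
  "leg12 R $ (i, j, k) $ (i', j', k') = (if k = k' then R $ (i, j) $ (i', j') else 0)"
  "leg13 R $ (i, j, k) $ (i', j', k') = (if j = j' then R $ (i, k) $ (i', k') else 0)"
  "leg23 R $ (i, j, k) $ (i', j', k') = (if i = i' then R $ (j, k) $ (j', k') else 0)"
  by (simp_all add: leg12_def leg13_def leg23_def)

lemma if_mult: "(if P then a else 0) * (b::'a::semiring_1) = (if P then a * b else 0)"
  "b * (if P then a else 0) = (if P then b * a else 0)"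
  by simp_all

lemma sum_if_const: "(\<Sum>u\<in>A. if P then f u else 0) = (if P then (\<Sum>u\<in>A. f u) else (0::'a::comm_monoid_add))"
  by simp

lemma QYBE_iff:
  "QYBE A \<longleftrightarrow> (\<forall>x1 x2 x3 y1 y2 y3. ybe_left (ent A) x1 x2 x3 y1 y2 y3 = ybe_right (ent A) x1 x2 x3 y1 y2 y3)"
proof -
  have 1: "(leg12 A ** leg13 A ** leg23 A) $ (el x1, el x2, el x3) $ (el y1, el y2, el y3) =
      ybe_left (ent A) x1 x2 x3 y1 y2 y3" for x1 x2 x3 y1 y2 y3
  proof -
    have "(leg12 A ** leg13 A ** leg23 A) $ (el x1, el x2, el x3) $ (el y1, el y2, el y3) =
      (\<Sum>u2\<in>UNIV. \<Sum>u3\<in>UNIV. (\<Sum>u1\<in>UNIV. ent A x1 x2 u1 u2 * ent A u1 x3 y1 u3) * ent A u2 u3 y2 y3)"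
      unfolding matrix_matrix_mult_def
      by (simp add: leg_entries sum_pair sum_el if_mult sum_if_const cong: if_cong)
    also have "\<dots> = (\<Sum>u2\<in>UNIV. \<Sum>u1\<in>UNIV. \<Sum>u3\<in>UNIV. ent A x1 x2 u1 u2 * ent A u1 x3 y1 u3 * ent A u2 u3 y2 y3)"
      unfolding sum_distrib_right by (rule sum.cong[OF refl], rule sum.swap)
    also have "\<dots> = ybe_left (ent A) x1 x2 x3 y1 y2 y3"
      unfolding ybe_left_def by (rule sum.swap)
    finally show ?thesis .
  qed
  have 2: "(leg23 A ** leg13 A ** leg12 A) $ (el x1, el x2, el x3) $ (el y1, el y2, el y3) =
      ybe_right (ent A) x1 x2 x3 y1 y2 y3" for x1 x2 x3 y1 y2 y3
  proof -
    have "(leg23 A ** leg13 A ** leg12 A) $ (el x1, el x2, el x3) $ (el y1, el y2, el y3) =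
      (\<Sum>u1\<in>UNIV. \<Sum>u2\<in>UNIV. (\<Sum>u3\<in>UNIV. ent A x2 x3 u2 u3 * ent A x1 u3 u1 y3) * ent A u1 u2 y1 y2)"
      unfolding matrix_matrix_mult_def
      by (simp add: leg_entries sum_pair sum_el if_mult sum_if_const cong: if_cong)
    also have "\<dots> = (\<Sum>u2\<in>UNIV. \<Sum>u1\<in>UNIV. \<Sum>u3\<in>UNIV. ent A x2 x3 u2 u3 * ent A x1 u3 u1 y3 * ent A u1 u2 y1 y2)"
      unfolding sum_distrib_right by (rule sum.swap)
    also have "\<dots> = ybe_right (ent A) x1 x2 x3 y1 y2 y3"
      unfolding ybe_right_def by (rule sum.cong[OF refl], rule sum.swap)
    finally show ?thesis .
  qed
  show ?thesis
    unfolding QYBE_def vec_eq_iff split_paired_All all_el 1 2 by blast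
qed

text \<open>Since q q^-1 = 1, the relation reads (P R)^2 = (q - q^-1) P R + 1. Row (k, i) of P R is
  row (i, k) of R, which turns the identity matrix into the condition
  \<open>i = n \<and> k = m\<close>.\<close>

lemma Hecke_iff:
  "Hecke A \<longleftrightarrow> (\<forall>i k m n. hecke_left (ent A) i k m n =
     qhat * ent A i k m n + (if i = n \<and> k = m then 1 else 0))"
proof -
  let ?P = "flip_mat ** A"
  have P: "?P $ (el k, el i) $ y = A $ (el i, el k) $ y" for i k y
  proof -
    have "x = prod.swap z \<longleftrightarrow> z = prod.swap x" for x z :: "5 \<times> 5"
      by auto
    hence "(flip_mat :: complex fps mat2) $ x $ z = (if z = prod.swap x then 1 else 0)" for x z
      by (simp add: flip_mat_def)
    thus ?thesis
      by (simp add: matrix_matrix_mult_def if_mult cong: if_cong)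
  qed
  have q: "qpow 1 * qpow (- 1) = 1"
    by (simp add: qpow_add[symmetric])
  have "(?P - qpow 1 \<odot> mat 1) ** (?P + qpow (- 1) \<odot> mat 1) = ?P ** ?P - qhat \<odot> ?P - mat 1"
    (is "?L = ?R")
  proof -
    have "?L $ x $ y = ?R $ x $ y" for x y
    proof -
      have "?L $ x $ y = (\<Sum>z\<in>UNIV. (?P $ x $ z - (if x = z then qpow 1 else 0)) * (?P $ z $ y + (if z = y then qpow (-1) else 0)))"
        by (simp add: matrix_matrix_mult_def mat_def if_mult cong: if_cong)
      also have "\<dots> = (\<Sum>z\<in>UNIV. ?P $ x $ z * ?P $ z $ y) + (\<Sum>z\<in>UNIV. ?P $ x $ z * (if z = y then qpow (-1) else 0))
          - (\<Sum>z\<in>UNIV. (if x = z then qpow 1 else 0) * ?P $ z $ y) - (\<Sum>z\<in>UNIV. (if x = z then qpow 1 else 0) * (if z = y then qpow (-1) else 0))"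
        by (simp add: algebra_simps sum.distrib sum_subtractf)
      also have "\<dots> = (\<Sum>z\<in>UNIV. ?P $ x $ z * ?P $ z $ y) + ?P $ x $ y * qpow (-1) - qpow 1 * ?P $ x $ y - (if x = y then 1 else 0)"
        by (simp add: if_mult q cong: if_cong)
      also have "\<dots> = ?R $ x $ y"
        by (simp add: matrix_matrix_mult_def[of ?P ?P] qhat_def mat_def algebra_simps)
      finally show ?thesis .
    qed
    thus ?thesis by (simp add: vec_eq_iff)
  qed
  hence "Hecke A \<longleftrightarrow> (\<forall>x y. (?P ** ?P) $ x $ y = qhat * ?P $ x $ y + (if x = y then 1 else 0))"
    unfolding Hecke_def by (simp only: vec_eq_iff) (simp add: mat_def vec_eq_iff algebra_simps)
  also have "\<dots> \<longleftrightarrow> (\<forall>k i m n. (?P ** ?P) $ (el k, el i) $ (el m, el n) = qhat * ent A i k m n + (if i = n \<and> k = m then 1 else 0))"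
    unfolding split_paired_All all_el by (simp add: P conj_commute)
  also have "\<dots> \<longleftrightarrow> (\<forall>k i m n. hecke_left (ent A) i k m n = qhat * ent A i k m n + (if i = n \<and> k = m then 1 else 0))"
  proof -
    have "(?P ** ?P) $ (el k, el i) $ (el m, el n) = hecke_left (ent A) i k m n" for k i m n
      unfolding matrix_matrix_mult_def[of ?P ?P] hecke_left_def
      by (simp add: sum_pair sum_el P)
    thus ?thesis by simp
  qed
  finally show ?thesis by blast
qed

section \<open>Twisting by a diagonal matrix: the entries of q^s R q^s\<close>

definition twist :: "(ix \<Rightarrow> ix \<Rightarrow> complex) \<Rightarrow> complex fps tens \<Rightarrow> complex fps tens"
  where "twist s R = (\<lambda>i k j l. qpow (s i k + s j l) * R i k j l)"

definition ybe :: "'a::comm_ring_1 tens \<Rightarrow> bool"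
  where "ybe R \<longleftrightarrow> (\<forall>x1 x2 x3 y1 y2 y3. ybe_left R x1 x2 x3 y1 y2 y3 = ybe_right R x1 x2 x3 y1 y2 y3)"

definition hecke :: "complex fps tens \<Rightarrow> bool"
  where "hecke R \<longleftrightarrow> (\<forall>i k m n. hecke_left R i k m n = qhat * R i k m n + (if i = n \<and> k = m then 1 else 0))"

text \<open>Exponents are thus compared only along paths whose product is nonzero.\<close>

lemma qpow_cong_mult: "(x \<noteq> 0 \<Longrightarrow> a = b) \<Longrightarrow> qpow a * x = qpow b * x"
  by (cases "x = 0") auto

text \<open>By \<open>cons\<close>, a nonzero entry conserves the total weight s(_, m) of its two
  legs, for every m. Applied at the three crossings, this eliminates the intermediate indices from
  the exponent and leaves the pairwise sums over the two end triples.\<close>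

lemma ybe_left_twist:
  assumes anti: "\<And>i j. s i j = - s j i"
    and cons: "\<And>i k j l m. R i k j l \<noteq> 0 \<Longrightarrow> s i m + s k m = s j m + s l m"
  shows "ybe_left (twist s R) x1 x2 x3 y1 y2 y3 =
    qpow (s x1 x2 + s x1 x3 + s x2 x3 + s y1 y2 + s y1 y3 + s y2 y3) * ybe_left R x1 x2 x3 y1 y2 y3"
  unfolding ybe_left_def sum_distrib_left
proof (intro sum.cong refl)
  fix u1 u2 u3
  have "twist s R x1 x2 u1 u2 * twist s R u1 x3 y1 u3 * twist s R u2 u3 y2 y3 =
      qpow ((s x1 x2 + s u1 u2) + (s u1 x3 + s y1 u3) + (s u2 u3 + s y2 y3)) *
      (R x1 x2 u1 u2 * R u1 x3 y1 u3 * R u2 u3 y2 y3)"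
    by (simp add: twist_def qpow_add mult_ac)
  also have "\<dots> = qpow (s x1 x2 + s x1 x3 + s x2 x3 + s y1 y2 + s y1 y3 + s y2 y3) *
      (R x1 x2 u1 u2 * R u1 x3 y1 u3 * R u2 u3 y2 y3)"
  proof (rule qpow_cong_mult)
    assume "R x1 x2 u1 u2 * R u1 x3 y1 u3 * R u2 u3 y2 y3 \<noteq> 0"
    hence nz: "R x1 x2 u1 u2 \<noteq> 0" "R u1 x3 y1 u3 \<noteq> 0" "R u2 u3 y2 y3 \<noteq> 0" by auto
    \<comment> \<open>At each crossing, conservation is tested against the leg that does not take
      part in it: \<open>x3\<close> for the factor 12, \<open>u2\<close> for 13, \<open>y1\<close>
      for 23.\<close>
    show "(s x1 x2 + s u1 u2) + (s u1 x3 + s y1 u3) + (s u2 u3 + s y2 y3) =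
        s x1 x2 + s x1 x3 + s x2 x3 + s y1 y2 + s y1 y3 + s y2 y3"
      using cons[OF nz(1), of x3] cons[OF nz(2), of u2] cons[OF nz(3), of y1]
        anti[of u2 u1] anti[of u2 x3] anti[of u2 y1] anti[of u3 u2] anti[of u3 y1] anti[of y2 y1] anti[of y3 y1]
      by algebra
  qed
  finally show "twist s R x1 x2 u1 u2 * twist s R u1 x3 y1 u3 * twist s R u2 u3 y2 y3 = \<dots>" .
qed

definition opposite_tens :: "'a tens \<Rightarrow> 'a tens"
  where "opposite_tens R = (\<lambda>i k j l. R k i l j)"

text \<open>Reversing the order of the three factors exchanges the two sides of the Yang-Baxter equation.\<close>

lemma ybe_right_opposite: "ybe_right R x1 x2 x3 y1 y2 y3 = ybe_left (opposite_tens R) x3 x2 x1 y3 y2 y1"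
  unfolding ybe_right_def ybe_left_def opposite_tens_def by (rule sum.swap)

text \<open>The right-hand side is the left-hand side for the opposite tensor, twisted by the
  transpose of s, which is again antisymmetric and conserved. Both sides acquire the same
  prefactor.\<close>

lemma ybe_twist:
  assumes anti: "\<And>i j. s i j = - s j i"
    and cons: "\<And>i k j l m. R i k j l \<noteq> 0 \<Longrightarrow> s i m + s k m = s j m + s l m"
    and R: "ybe R"
  shows "ybe (twist s R)"
proof -
  let ?s = "\<lambda>i j. s j i"
  have op: "opposite_tens (twist s R) = twist ?s (opposite_tens R)"
    by (simp add: opposite_tens_def twist_def)
  have "?s i m + ?s k m = ?s j m + ?s l m" if "opposite_tens R i k j l \<noteq> 0" for i k j l m
    using cons[of k i l j m] that anti[of m i] anti[of m k] anti[of m j] anti[of m l]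
    by (simp add: opposite_tens_def algebra_simps)
  from ybe_left_twist[of ?s, OF anti this]
  have right: "ybe_right (twist s R) x1 x2 x3 y1 y2 y3 =
      qpow (s x2 x3 + s x1 x3 + s x1 x2 + s y2 y3 + s y1 y3 + s y1 y2) * ybe_right R x1 x2 x3 y1 y2 y3"
    for x1 x2 x3 y1 y2 y3
    unfolding ybe_right_opposite op by simp
  have left: "ybe_left (twist s R) x1 x2 x3 y1 y2 y3 =
      qpow (s x1 x2 + s x1 x3 + s x2 x3 + s y1 y2 + s y1 y3 + s y2 y3) * ybe_left R x1 x2 x3 y1 y2 y3"
    for x1 x2 x3 y1 y2 y3
    by (rule ybe_left_twist[OF anti cons])
  show ?thesis
    using R unfolding ybe_def left right by (simp add: add_ac)
qed

text \<open>The contributions s(j, l) and s(l, j) of the two factors cancel, so (P R)^2 scales like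
  the entry of R itself. In the identity term the exponent is s(i, k) + s(k, i) = 0.\<close>

lemma hecke_twist:
  assumes anti: "\<And>i j. s i j = - s j i" and R: "hecke R"
  shows "hecke (twist s R)"
  unfolding hecke_def
proof (intro allI)
  fix i k m n
  have "hecke_left (twist s R) i k m n = qpow (s i k + s m n) * hecke_left R i k m n"
    unfolding hecke_left_def sum_distrib_left
  proof (intro sum.cong refl)
    fix j l
    have "s i k + s j l + (s l j + s m n) = s i k + s m n"
      using anti[of j l] by simp
    moreover have "twist s R i k j l * twist s R l j m n =
        qpow (s i k + s j l + (s l j + s m n)) * (R i k j l * R l j m n)"
      by (simp add: twist_def qpow_add mult_ac)
    ultimately show "twist s R i k j l * twist s R l j m n = qpow (s i k + s m n) * (R i k j l * R l j m n)"
      by (simp only:)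
  qed
  also have "\<dots> = qhat * twist s R i k m n + qpow (s i k + s m n) * (if i = n \<and> k = m then 1 else 0)"
    using R by (simp add: hecke_def twist_def algebra_simps)
  also have "qpow (s i k + s m n) * (if i = n \<and> k = m then 1 else 0) = (if i = n \<and> k = m then 1 else 0)"
    using anti[of i k] by auto
  finally show "hecke_left (twist s R) i k m n = qhat * twist s R i k m n + (if i = n \<and> k = m then 1 else 0)" .
qed

section \<open>Sparse tensors with monomial entries\<close>

text \<open>
  The entry \<open>(j, l, e, m, s)\<close> of row \<open>(i, k)\<close> stands for \<open>\<plusminus> q\<^sup>e (q - q\<^sup>-\<^sup>1)\<^sup>m\<close> in column \<open>(j, l)\<close>, with
  sign \<open>+\<close> iff \<open>s\<close> holds; similarly for products of three entries along a path.
\<close>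

type_synonym entry = "ix \<times> ix \<times> int \<times> nat \<times> bool"
type_synonym path = "(ix \<times> ix \<times> ix \<times> nat \<times> int) \<times> bool"

definition qmonom :: "int \<Rightarrow> nat \<Rightarrow> bool \<Rightarrow> complex fps"
  where "qmonom e m s = (if s then 1 else - 1) * qpow (of_int e) * qhat ^ m"

text \<open>Signs are truth values, and equality of truth values is multiplication of signs.\<close>

lemma qmonom_mult: "qmonom e m s * qmonom e' m' s' = qmonom (e + e') (m + m') (s = s')"
  by (auto simp: qmonom_def qpow_add power_add)

lemma qmonom_neg: "qmonom e m (\<not> s) = - qmonom e m s"
  by (simp add: qmonom_def)

lemma qmonom_Suc: "qmonom e (Suc m) s = qmonom (e + 1) m s + qmonom (e - 1) m (\<not> s)"
proof -
  have "qpow (of_int (e - 1)) = qpow (of_int e) * qpow (- 1)"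
    by (simp flip: qpow_add)
  thus ?thesis
    by (auto simp: qmonom_def qhat_def qpow_add algebra_simps)
qed

definition lent :: "entry list \<Rightarrow> ix \<Rightarrow> ix \<Rightarrow> complex fps"
  where "lent L j l = (\<Sum>(j', l', e, m, s)\<leftarrow>L. if j' = j \<and> l' = l then qmonom e m s else 0)"

text \<open>The starting triple is implicit: one list of paths represents a whole row of a triple
  product, and \<open>pval\<close> reads off one column of it.\<close>

definition pval :: "ix \<Rightarrow> ix \<Rightarrow> ix \<Rightarrow> path list \<Rightarrow> complex fps"
  where "pval y1 y2 y3 L =
    (\<Sum>((z1, z2, z3, m, e), s)\<leftarrow>L. if z1 = y1 \<and> z2 = y2 \<and> z3 = y3 then qmonom e m s else 0)"

lemma lent_simps [simp]:
  "lent [] j l = 0"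
  "lent ((j', l', e, m, s) # L) j l = (if j' = j \<and> l' = l then qmonom e m s else 0) + lent L j l"
  by (simp_all add: lent_def)

lemma pval_simps [simp]:
  "pval y1 y2 y3 [] = 0"
  "pval y1 y2 y3 (((z1, z2, z3, m, e), s) # L) =
    (if z1 = y1 \<and> z2 = y2 \<and> z3 = y3 then qmonom e m s else 0) + pval y1 y2 y3 L"
  "pval y1 y2 y3 (L @ L') = pval y1 y2 y3 L + pval y1 y2 y3 L'"
  by (simp_all add: pval_def)

lemma sum_double_delta:
  "(\<Sum>j\<in>UNIV. \<Sum>l\<in>UNIV. if a = j \<and> b = l then f j l else 0) = (f a b :: 'a::comm_monoid_add)"
  for a :: "'i::finite" and b :: "'j::finite"
proof -
  have "(if a = j \<and> b = l then f j l else 0) = (if a = j then (if b = l then f j l else 0) else 0)" for j l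
    by simp
  thus ?thesis by (simp add: sum_if_const cong: if_cong)
qed

lemma sum_lent:
  "(\<Sum>j\<in>UNIV. \<Sum>l\<in>UNIV. lent L j l * f j l) = (\<Sum>(j, l, e, m, s)\<leftarrow>L. qmonom e m s * f j l)"
  by (induction L) (auto simp: distrib_right sum.distrib if_mult sum_double_delta split: prod.splits)

lemma sum_lent_left:
  "(\<Sum>l\<in>UNIV. lent L j l * f l) = (\<Sum>(j', l, e, m, s)\<leftarrow>L. if j' = j then qmonom e m s * f l else 0)"
proof (induction L)
  case (Cons x L)
  obtain j' l' e m s where x: "x = (j', l', e, m, s)" by (cases x)
  have "(\<Sum>l\<in>UNIV. (if j' = j \<and> l' = l then qmonom e m s else 0) * f l) = (if j' = j then qmonom e m s * f l' else 0)"
    by (simp add: if_mult cong: if_cong)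
  thus ?case using Cons by (simp add: x distrib_right sum.distrib)
qed simp

text \<open>Only stored entries are followed, so products with a zero factor are never formed. The
  loops run through the crossings 12, 13 and 23 in this order.\<close>

definition left_paths :: "(ix \<Rightarrow> ix \<Rightarrow> entry list) \<Rightarrow> ix \<Rightarrow> ix \<Rightarrow> ix \<Rightarrow> path list"
  where "left_paths \<rho> x1 x2 x3 =
    concat (map (\<lambda>(u1, u2, e, m, s).
      concat (map (\<lambda>(y1, u3, e', m', s').
        map (\<lambda>(y2, y3, e'', m'', s''). ((y1, y2, y3, m + m' + m'', e + e' + e''), s = (s' = s'')))
          (\<rho> u2 u3)) (\<rho> u1 x3))) (\<rho> x1 x2))"

text \<open>The third index is the dummy \<open>I1\<close>, so that the same paths and the same
  cancellation procedure serve both equations.\<close>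

definition hecke_paths :: "(ix \<Rightarrow> ix \<Rightarrow> entry list) \<Rightarrow> ix \<Rightarrow> ix \<Rightarrow> path list"
  where "hecke_paths \<rho> i k =
    concat (map (\<lambda>(j, l, e, m, s).
      map (\<lambda>(y1, y2, e', m', s'). ((y1, y2, I1, m + m', e + e'), s = s')) (\<rho> l j)) (\<rho> i k))"

abbreviation ten :: "(ix \<Rightarrow> ix \<Rightarrow> entry list) \<Rightarrow> complex fps tens"
  where "ten \<rho> \<equiv> (\<lambda>i k. lent (\<rho> i k))"

lemma pval_concat: "pval y1 y2 y3 (concat (map f L)) = (\<Sum>x\<leftarrow>L. pval y1 y2 y3 (f x))"
  by (induction L) auto

lemma sum_list_cong: "(\<And>x. x \<in> set L \<Longrightarrow> f x = g x) \<Longrightarrow> (\<Sum>x\<leftarrow>L. f x) = (\<Sum>x\<leftarrow>L. g x)"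
  by (induction L) auto

lemma ybe_left_paths: "ybe_left (ten \<rho>) x1 x2 x3 y1 y2 y3 = pval y1 y2 y3 (left_paths \<rho> x1 x2 x3)"
proof -
  \<comment> \<open>The loops are peeled from the inside: this evaluates the last crossing, and the
    next fact sums over the middle one.\<close>
  have 3: "pval y1 y2 y3 (map (\<lambda>(z2, z3, e'', m'', s''). ((z1, z2, z3, m + m' + m'', e + e' + e''), s = (s' = s''))) L)
      = (if z1 = y1 then qmonom e m s * (qmonom e' m' s' * lent L y2 y3) else 0)" for z1 m m' e e' s s' L
    by (induction L) (auto simp: distrib_left qmonom_mult add.assoc split: prod.splits)
  have 2: "pval y1 y2 y3 (concat (map (\<lambda>(y1, u3, e', m', s').
        map (\<lambda>(y2, y3, e'', m'', s''). ((y1, y2, y3, m + m' + m'', e + e' + e''), s = (s' = s'')))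
          (\<rho> u2 u3)) L)) = qmonom e m s * (\<Sum>u3\<in>UNIV. lent L y1 u3 * lent (\<rho> u2 u3) y2 y3)" for m e s L u2
    unfolding pval_concat sum_lent_left
    by (induction L) (auto simp: 3 distrib_left split: prod.splits)
  have "ybe_left (ten \<rho>) x1 x2 x3 y1 y2 y3 =
     (\<Sum>u1\<in>UNIV. \<Sum>u2\<in>UNIV. lent (\<rho> x1 x2) u1 u2 * (\<Sum>u3\<in>UNIV. lent (\<rho> u1 x3) y1 u3 * lent (\<rho> u2 u3) y2 y3))"
    by (simp add: ybe_left_def sum_distrib_left mult.assoc)
  also have "\<dots> = (\<Sum>(u1, u2, e, m, s)\<leftarrow>\<rho> x1 x2. qmonom e m s * (\<Sum>u3\<in>UNIV. lent (\<rho> u1 x3) y1 u3 * lent (\<rho> u2 u3) y2 y3))"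
    by (rule sum_lent)
  also have "\<dots> = pval y1 y2 y3 (left_paths \<rho> x1 x2 x3)"
    unfolding left_paths_def pval_concat by (intro sum_list_cong) (auto simp: 2)
  finally show ?thesis .
qed

text \<open>The opposite tensor on the level of stored rows; it lets \<open>left_paths\<close>
  enumerate the right-hand side of the Yang-Baxter equation as well.\<close>

definition opposite_rows :: "(ix \<Rightarrow> ix \<Rightarrow> entry list) \<Rightarrow> ix \<Rightarrow> ix \<Rightarrow> entry list"
  where "opposite_rows \<rho> i k = map (\<lambda>(j, l, w). (l, j, w)) (\<rho> k i)"

lemma opposite_ten: "opposite_tens (ten \<rho>) = ten (opposite_rows \<rho>)"
proof (intro ext)
  fix i k j l
  have "lent L l j = lent (map (\<lambda>(j, l, w). (l, j, w)) L) j l" for L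
    by (induction L) auto
  thus "opposite_tens (ten \<rho>) i k j l = ten (opposite_rows \<rho>) i k j l"
    by (simp add: opposite_tens_def opposite_rows_def)
qed

lemma hecke_left_paths: "hecke_left (ten \<rho>) i k y1 y2 = pval y1 y2 I1 (hecke_paths \<rho> i k)"
proof -
  have 2: "pval y1 y2 I1 (map (\<lambda>(z1, z2, e', m', s'). ((z1, z2, I1, m + m', e + e'), s = s')) L)
      = qmonom e m s * lent L y1 y2" for m e s L
    by (induction L) (auto simp: distrib_left qmonom_mult add.assoc split: prod.splits)
  have "hecke_left (ten \<rho>) i k y1 y2 = (\<Sum>(j, l, e, m, s)\<leftarrow>\<rho> i k. qmonom e m s * lent (\<rho> l j) y1 y2)"
    unfolding hecke_left_def by (rule sum_lent)
  also have "\<dots> = pval y1 y2 I1 (hecke_paths \<rho> i k)"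
    unfolding hecke_paths_def pval_concat by (intro sum_list_cong) (auto simp: 2)
  finally show ?thesis .
qed

text \<open>Carries a path of the opposite tensor to the other side of the equation: its end triple
  returns to the original order of legs, and its sign changes.\<close>

fun neg_reverse :: "path \<Rightarrow> path"
  where "neg_reverse ((y1, y2, y3, m, e), s) = ((y3, y2, y1, m, e), \<not> s)"

fun opposite :: "path \<Rightarrow> path \<Rightarrow> bool"
  where "opposite ((y1, y2, y3, m, e), s) ((z1, z2, z3, n, f), t) \<longleftrightarrow>
    y1 = z1 \<and> y2 = z2 \<and> y3 = z3 \<and> s \<noteq> t \<and> m = n \<and> e = f"

fun cancel :: "path \<Rightarrow> path list \<Rightarrow> path list"
  where
    "cancel x [] = [x]"
  | "cancel x (y # ys) = (if opposite x y then ys else y # cancel x ys)"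

text \<open>Expands (q - q^-1)^m into 2^m signed powers of q.\<close>

fun expand :: "path \<Rightarrow> path list"
  where
    "expand ((y1, y2, y3, 0, e), s) = [((y1, y2, y3, 0, e), s)]"
  | "expand ((y1, y2, y3, Suc m, e), s) =
      expand ((y1, y2, y3, m, e + 1), s) @ expand ((y1, y2, y3, m, e - 1), \<not> s)"

text \<open>Cancellation is first attempted with the powers of q - q^-1 kept as formal symbols. Only
  what survives is expanded, since expansion multiplies the number of terms.\<close>

definition vanishes :: "path list \<Rightarrow> bool"
  where "vanishes L \<longleftrightarrow> (case fold cancel L [] of [] \<Rightarrow> True | L' \<Rightarrow> fold cancel (concat (map expand L')) [] = [])"

lemma pval_neg_reverse: "pval y1 y2 y3 (map neg_reverse L) = - pval y3 y2 y1 L"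
  by (induction L) (auto simp: qmonom_neg)

lemma pval_Cons: "pval y1 y2 y3 (x # L) = pval y1 y2 y3 [x] + pval y1 y2 y3 L"
  using pval_simps(3)[of y1 y2 y3 "[x]" L] by simp

lemma pval_opposite: "opposite x y \<Longrightarrow> pval y1 y2 y3 [x] + pval y1 y2 y3 [y] = 0"
  by (induction x y rule: opposite.induct) (auto simp: qmonom_def)

lemma pval_cancel: "pval y1 y2 y3 (cancel x L) = pval y1 y2 y3 (x # L)"
proof (induction L)
  case (Cons y L)
  show ?case
  proof (cases "opposite x y")
    case True
    thus ?thesis
      using pval_opposite[OF True, of y1 y2 y3] pval_Cons[of y1 y2 y3 x "y # L"] pval_Cons[of y1 y2 y3 y L]
      by (simp add: add.assoc[symmetric])
  next
    case False
    thus ?thesis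
      using Cons pval_Cons[of y1 y2 y3 x L] pval_Cons[of y1 y2 y3 x "y # L"]
        pval_Cons[of y1 y2 y3 y L] pval_Cons[of y1 y2 y3 y "cancel x L"]
      by (simp add: add.left_commute)
  qed
qed simp

lemma pval_fold_cancel: "pval y1 y2 y3 (fold cancel L L') = pval y1 y2 y3 L + pval y1 y2 y3 L'"
proof (induction L arbitrary: L')
  case (Cons x L)
  show ?case
    using Cons[of "cancel x L'"] pval_Cons[of y1 y2 y3 x L] pval_Cons[of y1 y2 y3 x L']
    by (simp add: pval_cancel add.assoc add.left_commute)
qed simp

lemma pval_expand: "pval y1 y2 y3 (expand x) = pval y1 y2 y3 [x]"
  by (induction x rule: expand.induct) (auto simp: qmonom_Suc)

lemma pval_concat_expand: "pval y1 y2 y3 (concat (map expand L)) = pval y1 y2 y3 L"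
proof (induction L)
  case (Cons x L)
  thus ?case using pval_Cons[of y1 y2 y3 x L] by (simp add: pval_expand)
qed simp

lemma vanishes_sound: "vanishes L \<Longrightarrow> pval y1 y2 y3 L = 0"
  using pval_fold_cancel[of y1 y2 y3 L "[]"]
    pval_fold_cancel[of y1 y2 y3 "concat (map expand (fold cancel L []))" "[]"]
  by (auto simp: vanishes_def pval_concat_expand split: list.splits)

definition all_ix_list :: "ix list"
  where "all_ix_list = [I1, I2, I3, I4, I5]"

lemma all_ix_list: "list_all P all_ix_list \<longleftrightarrow> (\<forall>i. P i)"
  by (simp add: all_ix_list_def all_ix)

text \<open>One list per row, made of the left paths and the negated right paths, so that all
  columns are compared in one cancellation.\<close>

definition ybe_check :: "(ix \<Rightarrow> ix \<Rightarrow> entry list) \<Rightarrow> bool"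
  where "ybe_check \<rho> \<longleftrightarrow> list_all (\<lambda>x1. list_all (\<lambda>x2. list_all (\<lambda>x3.
     vanishes (left_paths \<rho> x1 x2 x3 @ map neg_reverse (left_paths (opposite_rows \<rho>) x3 x2 x1))) all_ix_list) all_ix_list) all_ix_list"

text \<open>The list stands for row (k, i) of (P R)^2 - (q - q^-1) P R - 1. \<open>Suc m\<close>
  together with the negated sign is the factor -(q - q^-1), and the head is the -1, placed in column
  (k, i) because of the flip.\<close>

definition hecke_check :: "(ix \<Rightarrow> ix \<Rightarrow> entry list) \<Rightarrow> bool"
  where "hecke_check \<rho> \<longleftrightarrow> list_all (\<lambda>i. list_all (\<lambda>k.
     vanishes (((k, i, I1, 0, 0), False) #
       map (\<lambda>(j, l, e, m, s). ((j, l, I1, Suc m, e), \<not> s)) (\<rho> i k) @ hecke_paths \<rho> i k)) all_ix_list) all_ix_list"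

lemma ybe_check_sound:
  assumes "ybe_check \<rho>" shows "ybe (ten \<rho>)"
  unfolding ybe_def
proof (intro allI)
  fix x1 x2 x3 y1 y2 y3
  have "vanishes (left_paths \<rho> x1 x2 x3 @ map neg_reverse (left_paths (opposite_rows \<rho>) x3 x2 x1))"
    using assms by (simp add: ybe_check_def all_ix_list)
  from vanishes_sound[OF this, of y1 y2 y3]
  show "ybe_left (ten \<rho>) x1 x2 x3 y1 y2 y3 = ybe_right (ten \<rho>) x1 x2 x3 y1 y2 y3"
    by (simp add: ybe_left_paths ybe_right_opposite opposite_ten pval_neg_reverse)
qed

lemma hecke_check_sound:
  assumes "hecke_check \<rho>" shows "hecke (ten \<rho>)"
  unfolding hecke_def
proof (intro allI)
  fix i k y1 y2
  have 1: "pval y1 y2 I1 (map (\<lambda>(j, l, e, m, s). ((j, l, I1, Suc m, e), \<not> s)) L) = - (qhat * lent L y1 y2)" for L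
    by (induction L) (auto simp: qmonom_def algebra_simps)
  have "pval y1 y2 I1 (((k, i, I1, 0, 0), False) #
       map (\<lambda>(j, l, e, m, s). ((j, l, I1, Suc m, e), \<not> s)) (\<rho> i k) @ hecke_paths \<rho> i k) = 0"
    using assms by (intro vanishes_sound) (simp add: hecke_check_def all_ix_list)
  moreover have "qmonom 0 0 False = - 1"
    by (simp add: qmonom_def)
  ultimately show "hecke_left (ten \<rho>) i k y1 y2 = qhat * ten \<rho> i k y1 y2 + (if i = y2 \<and> k = y1 then 1 else 0)"
    by (cases "k = y1 \<and> i = y2") (auto simp: hecke_left_paths 1 diff_eq_eq add.commute)
qed

section \<open>Diagonal matrices and the standard part\<close>

lemma mat_pow_diag:
  assumes "\<And>x y. x \<noteq> y \<Longrightarrow> X $ x $ y = 0"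
  shows "mat_pow X k $ x $ y = (if x = y then (X $ x $ x) ^ k else 0)"
proof (induction k arbitrary: x y)
  case (Suc k)
  have "mat_pow X (Suc k) $ x $ y = (\<Sum>z\<in>UNIV. (if x = z then X $ x $ z else 0) * (mat_pow X k $ z $ y))"
    using assms by (auto simp: matrix_matrix_mult_def intro!: sum.cong)
  thus ?case by (simp add: Suc if_mult)
qed (simp add: mat_def)

lemma qmat_diag:
  assumes "\<And>x y. x \<noteq> y \<Longrightarrow> X $ x $ y = 0"
  shows "qmat X $ x $ y = (if x = y then qpow (X $ x $ x) else 0)"
  using mat_pow_diag[OF assms]
  by (simp add: qmat_def qpow_def fps_eq_iff)

lemma diag_mult:
  assumes "\<And>x y. x \<noteq> y \<Longrightarrow> A $ x $ y = 0" "\<And>x y. x \<noteq> y \<Longrightarrow> B $ x $ y = 0"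
  shows "(A ** M ** B) $ x $ y = A $ x $ x * M $ x $ y * B $ y $ y"
proof -
  have "(A ** M ** B) $ x $ y =
      (\<Sum>v\<in>UNIV. (\<Sum>u\<in>UNIV. (if x = u then A $ x $ u else 0) * M $ u $ v) * (if v = y then B $ v $ y else 0))"
    using assms by (auto simp: matrix_matrix_mult_def intro!: sum.cong arg_cong2[of _ _ _ _ "(*)"])
  thus ?thesis by (simp add: if_mult cong: if_cong)
qed

section \<open>Positive roots and the entries of c_+, c, t^0 and the standard R-matrix\<close>

definition roots :: "(ix \<times> ix) list"
  where "roots = [(I1, I2), (I2, I3), (I3, I4), (I4, I5), (I1, I3), (I2, I4), (I3, I5), (I1, I4), (I2, I5), (I1, I5)]"

definition nat_root :: "ix \<times> ix \<Rightarrow> nat \<times> nat"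
  where "nat_root = (\<lambda>(i, j). (nat_ix i, nat_ix j))"

lemma nat_root_simp [simp]: "nat_root (i, j) = (nat_ix i, nat_ix j)"
  by (simp add: nat_root_def)

lemma set_roots: "set roots = {(i, j). nat_ix i < nat_ix j}"
proof -
  have "(i, j) \<in> set roots \<longleftrightarrow> nat_ix i < nat_ix j" for i j
    by (cases i; cases j) (simp_all add: roots_def)
  thus ?thesis by auto
qed

lemma distinct_roots: "distinct roots"
  by (simp add: roots_def)

lemma inj_nat_root: "inj nat_root"
  by (auto simp: inj_def nat_root_def)

lemma pos_roots_eq: "pos_roots = nat_root ` set roots"
proof -
  have "(i, j) \<in> nat_root ` set roots" if "1 \<le> i" "i < j" "j \<le> 5" for i j
  proof -
    have "i \<in> range nat_ix" "j \<in> range nat_ix"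
      unfolding nat_ix_image using that by auto
    then obtain a b where "i = nat_ix a" "j = nat_ix b" by blast
    thus ?thesis using that by (force simp: set_roots)
  qed
  moreover have "1 \<le> nat_ix i \<and> nat_ix j \<le> 5" for i j
    using nat_ix_range by auto
  ultimately show ?thesis
    unfolding pos_roots_def set_roots by auto
qed

lemma sum_pos_roots: "(\<Sum>\<alpha>\<in>pos_roots. f \<alpha>) = (\<Sum>\<alpha>\<leftarrow>roots. f (nat_root \<alpha>))"
  unfolding pos_roots_eq
  by (subst sum.reindex) (use inj_nat_root distinct_roots in \<open>auto simp: inj_on_def inj_def sum_list_distinct_conv_sum_set\<close>)

lemma ent_sum_list: "ent (\<Sum>x\<leftarrow>L. f x) i k j l = (\<Sum>x\<leftarrow>L. ent (f x) i k j l)"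
  by (induction L) auto

lemma ent_tensor_E:
  "ent (E (nat_ix a) (nat_ix b) \<otimes> E (nat_ix c) (nat_ix d)) i k j l =
    (if i = a \<and> k = c \<and> j = b \<and> l = d then 1 else (0 :: 'a::semiring_1))"
  by (simp add: ent_tensor E_entry')

lemma ent_c_plus:
  "ent c_plus i k j l = (if j = k \<and> l = i \<and> nat_ix k < nat_ix i then 1 else 0)"
proof -
  have "ent c_plus i k j l = (\<Sum>(a, b)\<leftarrow>roots. if i = b \<and> k = a \<and> j = a \<and> l = b then 1 else 0)"
    unfolding c_plus_def sum_pos_roots ent_sum_list
    by (intro sum_list_cong) (auto simp: neg_vec_def pos_vec_def ent_tensor_E)
  also have "\<dots> = (\<Sum>x\<in>set roots. if x = (k, i) then (if j = k \<and> l = i then 1 else 0) else 0)"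
    unfolding sum_list_distinct_conv_sum_set[OF distinct_roots]
    by (rule sum.cong) (auto split: prod.split)
  also have "\<dots> = (if j = k \<and> l = i \<and> nat_ix k < nat_ix i then 1 else 0)"
    by (simp add: set_roots)
  finally show ?thesis .
qed

text \<open>Twice the matrix c: clearing the 1/2 of the wedge keeps the finite computations in the
  integers.\<close>

definition c2 :: "ix \<times> ix \<Rightarrow> ix \<times> ix \<Rightarrow> int"
  where "c2 = (\<lambda>(i, k) (j, l). if j = k \<and> l = i then
     (if (k, i) \<in> set roots then 1 else if (i, k) \<in> set roots then - 1 else 0) else 0)"

lemma flip_c_plus: "ent c_mat i k j l = (1/2) * (ent c_plus i k j l - ent c_plus k i l j)"
proof -
  have "ent c_mat i k j l = (\<Sum>x\<leftarrow>roots. (1/2) * (ent (neg_vec (nat_root x) \<otimes> pos_vec (nat_root x)) i k j l -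
      ent (pos_vec (nat_root x) \<otimes> neg_vec (nat_root x)) i k j l))"
    unfolding c_mat_def sum_pos_roots ent_sum_list by (simp add: wedge_def)
  also have "\<dots> = (1/2) * (ent c_plus i k j l - ent c_plus k i l j)"
    unfolding c_plus_def sum_pos_roots ent_sum_list sum_list_const_mult sum_list_subtractf
    by (simp add: ent_tensor mult.commute)
  finally show ?thesis .
qed

lemma ent_c_mat: "ent c_mat i k j l = of_int (c2 (i, k) (j, l)) / 2"
  by (auto simp: flip_c_plus ent_c_plus c2_def set_roots)

lemma ent_t0: "ent t0 i k j l = (if i = j \<and> k = l then (if i = k then 1 else 0) - 1/5 else 0)"
proof -
  have "(\<Sum>n = 1..5. E n n \<otimes> E n n) = (\<Sum>a\<in>UNIV. E (nat_ix a) (nat_ix a) \<otimes> E (nat_ix a) (nat_ix a) :: complex mat2)"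
    unfolding nat_ix_image[symmetric] by (subst sum.reindex) (auto simp: inj_def)
  moreover have "ent (\<Sum>a\<in>UNIV. E (nat_ix a) (nat_ix a) \<otimes> E (nat_ix a) (nat_ix a) :: complex mat2) i k j l
      = (\<Sum>a\<in>UNIV. if a = i then (if i = j \<and> k = l \<and> i = k then 1 else 0) else 0)"
    unfolding sum_component ent_tensor_E by (rule sum.cong) auto
  ultimately show ?thesis
    unfolding t0_def by (simp add: ent_tensor mat_def)
qed

definition std_tens :: "complex fps tens"
  where "std_tens i k j l =
    (if i = j \<and> k = l then (if i = k then qpow 1 else 1) else 0) +
    qhat * (if j = k \<and> l = i \<and> nat_ix k < nat_ix i then 1 else 0)"

lemma all_pair_el: "(\<forall>x. P x) \<longleftrightarrow> (\<forall>i k. P (el i, el k))"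
  unfolding split_paired_All all_el by blast

lemma mat2_diagI:
  assumes "\<And>i k j l. (i, k) \<noteq> (j, l) \<Longrightarrow> ent X i k j l = 0"
  shows "x \<noteq> y \<Longrightarrow> X $ x $ y = 0"
proof -
  have "\<forall>x y. x \<noteq> y \<longrightarrow> X $ x $ y = 0"
    unfolding all_pair_el using assms by simp
  thus "x \<noteq> y \<Longrightarrow> X $ x $ y = 0" by blast
qed

text \<open>Adding 1/5 cancels the trace correction in t^0: the exponent is the diagonal matrix with
  entry 1 at e_ii (x) e_ii and 0 at e_ii (x) e_kk for i different from k, whence the entries q and
  1.\<close>

lemma ent_R_s: "ent R_s i k j l = std_tens i k j l"
proof -
  have X: "ent (t0 + (1/5) \<odot> mat 1) i k j l = (if (i, k) = (j, l) then (if i = k then 1 else 0) else 0)" for i k j l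
    by (simp add: ent_t0 mat_def)
  have "ent (qmat (t0 + (1/5) \<odot> mat 1)) i k j l =
      (if (el i, el k) = (el j, el l) then qpow (ent (t0 + (1/5) \<odot> mat 1) i k i k) else 0)"
    by (rule qmat_diag, rule mat2_diagI, simp only: X if_False)
  hence "ent (qmat (t0 + (1/5) \<odot> mat 1)) i k j l =
      (if i = j \<and> k = l then (if i = k then qpow 1 else 1) else 0)"
    unfolding X by auto
  thus ?thesis
    by (simp add: R_s_def std_tens_def ent_c_plus)
qed

definition is_diag :: "complex mat2 \<Rightarrow> (ix \<Rightarrow> ix \<Rightarrow> complex) \<Rightarrow> bool"
  where "is_diag X d \<longleftrightarrow> (\<forall>i k j l. ent X i k j l = (if i = j \<and> k = l then d i k else 0))"

lemma ent_qmat_conj: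
  assumes "is_diag X d"
  shows "ent (qmat X ** M ** qmat X) i k j l = qpow (d i k + d j l) * ent M i k j l"
proof -
  have X: "\<And>x y. x \<noteq> y \<Longrightarrow> X $ x $ y = 0"
    by (rule mat2_diagI) (use assms in \<open>auto simp: is_diag_def\<close>)
  have "ent (qmat X ** M ** qmat X) i k j l = qpow (ent X i k i k) * ent M i k j l * qpow (ent X j l j l)"
    by (subst diag_mult) (simp_all add: qmat_diag[OF X])
  thus ?thesis
    using assms by (simp add: is_diag_def qpow_add mult_ac)
qed

definition core_tens :: "triple \<Rightarrow> complex fps tens"
  where "core_tens T i k j l = std_tens i k j l + qhat * ent (a_tilde T) i k j l"

lemma ent_R_GGS:
  assumes "is_diag (r_tilde r0) d"
  shows "ent (R_GGS T r0) = twist d (core_tens T)"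
  by (intro ext) (simp add: R_GGS_def ent_qmat_conj[OF assms] twist_def core_tens_def ent_R_s)

section \<open>The Lie algebra isomorphisms\<close>

lemma E_mult:
  assumes "i \<in> {1..5}" "j \<in> {1..5}" "k \<in> {1..5}" "l \<in> {1..5}"
  shows "(E i j ** E k l :: complex mat1) = (if j = k then E i l else 0)"
proof -
  have "(E i j ** E k l :: complex mat1) $ r $ s =
     (\<Sum>u\<in>(UNIV :: 5 set). (if u = of_nat j then (if r = of_nat i then 1 else 0) else 0) *
        (if u = of_nat k \<and> s = of_nat l then 1 else 0))" for r s
    unfolding matrix_matrix_mult_def E_def by (auto intro!: sum.cong)
  hence "(E i j ** E k l :: complex mat1) $ r $ s =
     (if r = of_nat i then 1 else 0) * (if (of_nat j :: 5) = of_nat k \<and> s = of_nat l then 1 else 0)" for r s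
    by (simp only: sum_delta_mult)
  thus ?thesis
    using of_nat_inj_5[OF assms(2,3)] by (auto simp: vec_eq_iff E_def)
qed

lemma lie_subalgebra_Inter: "(\<And>L. L \<in> \<L> \<Longrightarrow> lie_subalgebra L) \<Longrightarrow> lie_subalgebra (\<Inter>\<L>)"
  unfolding lie_subalgebra_def by (auto intro!: cmat.subspace_Inter)

lemma lie_subalgebra_gen: "lie_subalgebra (gen_subalgebra \<Gamma>)"
  unfolding gen_subalgebra_def by (rule hull_in) (auto intro: lie_subalgebra_Inter)

lemma gen_subalgebra_minimal:
  assumes "lie_subalgebra L" "\<And>i. i \<in> \<Gamma> \<Longrightarrow> E i (Suc i) \<in> L" "\<And>i. i \<in> \<Gamma> \<Longrightarrow> E (Suc i) i \<in> L"
  shows "gen_subalgebra \<Gamma> \<subseteq> L"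
  unfolding gen_subalgebra_def by (rule hull_minimal) (use assms in auto)

lemma gen_subalgebra_gens:
  assumes "i \<in> \<Gamma>" shows "E i (Suc i) \<in> gen_subalgebra \<Gamma>" "E (Suc i) i \<in> gen_subalgebra \<Gamma>"
  using hull_subset[of "(\<lambda>i. E i (Suc i)) ` \<Gamma> \<union> (\<lambda>i. E (Suc i) i) ` \<Gamma>" lie_subalgebra] assms
  unfolding gen_subalgebra_def by auto

lemma lie_subalgebraD:
  assumes "lie_subalgebra L"
  shows "0 \<in> L" "x \<in> L \<Longrightarrow> y \<in> L \<Longrightarrow> x + y \<in> L" "x \<in> L \<Longrightarrow> c \<odot> x \<in> L"
    "x \<in> L \<Longrightarrow> y \<in> L \<Longrightarrow> lie_bracket x y \<in> L"
  using assms by (auto simp: lie_subalgebra_def cmat.subspace_def)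

lemma lie_subalgebraI:
  assumes "0 \<in> L" "\<And>x y. x \<in> L \<Longrightarrow> y \<in> L \<Longrightarrow> x + y \<in> L" "\<And>c x. x \<in> L \<Longrightarrow> c \<odot> x \<in> L"
    "\<And>x y. x \<in> L \<Longrightarrow> y \<in> L \<Longrightarrow> lie_bracket x y \<in> L"
  shows "lie_subalgebra L"
  using assms by (auto simp: lie_subalgebra_def cmat.subspace_def)

lemma smult_algebra:
  fixes x y :: "complex^'m::finite^'n::finite"
  shows "c \<odot> (x + y) = c \<odot> x + c \<odot> y" "c \<odot> (x - y) = c \<odot> x - c \<odot> y" "(c + d) \<odot> x = c \<odot> x + d \<odot> x"
    "c \<odot> d \<odot> x = (c * d) \<odot> x" "1 \<odot> x = x" "c \<odot> (- x) = (- c) \<odot> x" "0 \<odot> x = 0" "c \<odot> (0 :: complex^'m^'n) = 0"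
  by (simp_all add: vec_eq_iff algebra_simps)

lemma lie_iso_zero:
  assumes "lie_iso \<phi> L M" "lie_subalgebra L" shows "\<phi> 0 = 0"
proof -
  have "\<phi> (0 \<odot> 0) = 0 \<odot> \<phi> 0"
    using assms lie_subalgebraD(1)[OF assms(2)] unfolding lie_iso_def by blast
  thus ?thesis by (simp add: smult_algebra)
qed

text \<open>The image of the first subalgebra is a subalgebra containing the generators of the
  second, and the preimage of the second is one containing the generators of the first; minimality
  gives both inclusions.\<close>

lemma lie_iso_gen:
  assumes \<phi>: "lie_iso \<phi> UNIV UNIV" and \<Gamma>2: "\<Gamma>2 = f ` \<Gamma>1"
    and gens: "\<And>i. i \<in> \<Gamma>1 \<Longrightarrow> \<phi> (E i (Suc i)) = E (f i) (Suc (f i))"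
      "\<And>i. i \<in> \<Gamma>1 \<Longrightarrow> \<phi> (E (Suc i) i) = E (Suc (f i)) (f i)"
  shows "lie_iso \<phi> (gen_subalgebra \<Gamma>1) (gen_subalgebra \<Gamma>2)"
proof -
  have lin: "\<phi> (x + y) = \<phi> x + \<phi> y" "\<phi> (c \<odot> x) = c \<odot> \<phi> x"
    "\<phi> (lie_bracket x y) = lie_bracket (\<phi> x) (\<phi> y)" for x y c
    using \<phi> by (auto simp: lie_iso_def)
  have zero: "\<phi> 0 = 0"
    using lie_iso_zero[OF \<phi>] by (simp add: lie_subalgebra_def)
  have "lie_subalgebra (\<phi> ` gen_subalgebra \<Gamma>1)"
    using lie_subalgebraD[OF lie_subalgebra_gen[of \<Gamma>1]] zero
    by (intro lie_subalgebraI) (auto simp: lin[symmetric] image_iff intro: zero[symmetric])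
  moreover have "E i (Suc i) \<in> \<phi> ` gen_subalgebra \<Gamma>1" "E (Suc i) i \<in> \<phi> ` gen_subalgebra \<Gamma>1" if "i \<in> \<Gamma>2" for i
    using that unfolding \<Gamma>2 by (auto simp: gens[symmetric] gen_subalgebra_gens)
  ultimately have "gen_subalgebra \<Gamma>2 \<subseteq> \<phi> ` gen_subalgebra \<Gamma>1"
    by (rule gen_subalgebra_minimal)
  moreover have "lie_subalgebra (\<phi> -` gen_subalgebra \<Gamma>2)"
    using lie_subalgebraD[OF lie_subalgebra_gen[of \<Gamma>2]] zero
    by (intro lie_subalgebraI) (auto simp: lin)
  hence "gen_subalgebra \<Gamma>1 \<subseteq> \<phi> -` gen_subalgebra \<Gamma>2"
    by (rule gen_subalgebra_minimal) (use gens gen_subalgebra_gens[of _ \<Gamma>2] in \<open>auto simp: \<Gamma>2\<close>)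
  ultimately have "\<phi> ` gen_subalgebra \<Gamma>1 = gen_subalgebra \<Gamma>2"
    by auto
  moreover have "inj \<phi>"
    using \<phi> by (simp add: lie_iso_def bij_betw_def)
  ultimately show ?thesis
    using lin by (auto simp: lie_iso_def bij_betw_def intro: inj_on_subset)
qed

text \<open>The map \<phi> witnesses that the choice is meaningful. Uniqueness holds because the set
  where two homomorphisms agree is a subalgebra, and here it contains the generators.\<close>

lemma tau_lie_eq:
  assumes iso: "lie_iso \<phi> (gen_subalgebra \<Gamma>1) (gen_subalgebra \<Gamma>2)"
    and gens: "\<And>i. i \<in> \<Gamma>1 \<Longrightarrow> \<phi> (E i (Suc i)) = E (the (\<tau> i)) (Suc (the (\<tau> i)))"
      "\<And>i. i \<in> \<Gamma>1 \<Longrightarrow> \<phi> (E (Suc i) i) = E (Suc (the (\<tau> i))) (the (\<tau> i))"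
    and x: "x \<in> gen_subalgebra \<Gamma>1"
  shows "tau_lie (\<tau>, \<Gamma>1, \<Gamma>2) x = \<phi> x"
proof -
  let ?L = "gen_subalgebra \<Gamma>1" and ?M = "gen_subalgebra \<Gamma>2"
  define \<psi> where "\<psi> = tau_lie (\<tau>, \<Gamma>1, \<Gamma>2)"
  have "lie_iso \<psi> ?L ?M \<and> (\<forall>i\<in>\<Gamma>1. \<psi> (E i (Suc i)) = E (the (\<tau> i)) (Suc (the (\<tau> i))) \<and>
             \<psi> (E (Suc i) i) = E (Suc (the (\<tau> i))) (the (\<tau> i)))"
    unfolding \<psi>_def tau_lie.simps by (rule someI[of _ \<phi>]) (use iso gens in auto)
  hence \<psi>: "lie_iso \<psi> ?L ?M" and \<psi>gens: "i \<in> \<Gamma>1 \<Longrightarrow> \<psi> (E i (Suc i)) = \<phi> (E i (Suc i))"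
      "i \<in> \<Gamma>1 \<Longrightarrow> \<psi> (E (Suc i) i) = \<phi> (E (Suc i) i)" for i
    using gens by auto
  note L = lie_subalgebra_gen[of \<Gamma>1]
  have "lie_subalgebra {x \<in> ?L. \<psi> x = \<phi> x}"
  proof (rule lie_subalgebraI)
    show "0 \<in> {x \<in> ?L. \<psi> x = \<phi> x}"
      using lie_iso_zero[OF \<psi> L] lie_iso_zero[OF iso L] lie_subalgebraD(1)[OF L] by simp
  qed (use \<psi> iso lie_subalgebraD[OF L] in \<open>auto simp: lie_iso_def\<close>)
  hence "?L \<subseteq> {x \<in> ?L. \<psi> x = \<phi> x}"
    by (rule gen_subalgebra_minimal) (auto simp: \<psi>gens gen_subalgebra_gens)
  thus ?thesis using x \<psi>_def by blast
qed

text \<open>One simple root vector is bracketed on at a time: [E i j, E j (j+1)] = E i (j+1), the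
  opposite product being zero for i < j.\<close>

lemma gen_subalgebra_root:
  assumes "1 \<le> i" "i < j" "j \<le> 5" "{i..<j} \<subseteq> \<Gamma>"
  shows "E i j \<in> gen_subalgebra \<Gamma>"
  using assms(2-)
proof (induction j)
  case (Suc j)
  show ?case
  proof (cases "i = j")
    case True
    thus ?thesis using Suc.prems gen_subalgebra_gens by simp
  next
    case False
    hence "i < j" "j \<le> 5" "{i..<j} \<subseteq> \<Gamma>" "j \<in> \<Gamma>"
      using Suc.prems by auto
    hence "E i j \<in> gen_subalgebra \<Gamma>" "E j (Suc j) \<in> gen_subalgebra \<Gamma>"
      using Suc.IH gen_subalgebra_gens(1) by auto
    moreover have "lie_bracket (E i j) (E j (Suc j)) = E i (Suc j)"
      using Suc.prems False assms(1) by (simp add: lie_bracket_def E_mult)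
    ultimately show ?thesis
      using lie_subalgebraD(4)[OF lie_subalgebra_gen] by metis
  qed
qed simp

section \<open>Automorphisms of the Lie algebra of all 5 x 5 matrices\<close>

definition conj_map :: "(5 \<Rightarrow> 5) \<Rightarrow> complex mat1 \<Rightarrow> complex mat1"
  where "conj_map f x = (\<chi> r s. x $ f r $ f s)"

definition sign_ix :: "5 \<Rightarrow> complex"
  where "sign_ix x = (- 1) ^ nat_ix (the_inv el x)"

text \<open>The map x -> - D x^T D with D = diag((-1)^i). The signs make e_{i,i+1} go to e_{i+1,i}
  with coefficient +1, as the prescribed values on generators demand; e_ij acquires -1 when j - i is
  even.\<close>

definition anti_map :: "complex mat1 \<Rightarrow> complex mat1"
  where "anti_map x = (\<chi> r s. - (sign_ix r * sign_ix s * x $ s $ r))"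

lemma sign_ix_square: "sign_ix x * sign_ix x = 1"
  by (simp add: sign_ix_def power_add[symmetric] mult_2[symmetric] power_mult_distrib[symmetric])

lemma sign_ix_el [simp]: "sign_ix (el i) = (- 1) ^ nat_ix i"
  by (simp add: sign_ix_def the_inv_f_f bij_is_inj[OF bij_el])

lemma conj_map_iso:
  assumes "bij f" shows "lie_iso (conj_map f) UNIV UNIV"
proof -
  have "conj_map f (x ** y) = conj_map f x ** conj_map f y" for x y
    by (simp add: conj_map_def matrix_matrix_mult_def vec_eq_iff
        sum.reindex_bij_betw[OF assms, of "\<lambda>k. x $ f _ $ k * y $ k $ f _", symmetric])
  moreover have "conj_map f (x + y) = conj_map f x + conj_map f y"
    "conj_map f (x - y) = conj_map f x - conj_map f y"
    "conj_map f (c \<odot> x) = c \<odot> conj_map f x" for x y c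
    by (simp_all add: conj_map_def vec_eq_iff)
  moreover have "conj_map f (conj_map (inv f) x) = x" "conj_map (inv f) (conj_map f x) = x" for x
    using assms by (simp_all add: conj_map_def vec_eq_iff bij_is_inj bij_is_surj surj_f_inv_f)
  hence "bij (conj_map f)" by (metis bijI')
  ultimately show ?thesis
    by (simp add: lie_iso_def lie_bracket_def)
qed

text \<open>Transposition reverses products, and the overall minus sign turns the reversed
  commutator back.\<close>

lemma anti_map_iso: "lie_iso anti_map UNIV UNIV"
proof -
  have "anti_map (x ** y) = - (anti_map y ** anti_map x)" for x y
  proof -
    have eq: "sign_ix r * sign_ix k * y $ k $ r * (sign_ix k * sign_ix s * x $ s $ k) =
        sign_ix r * sign_ix s * (x $ s $ k * y $ k $ r)" for r s k
      using sign_ix_square[of k] by algebra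
    show ?thesis
      by (simp add: anti_map_def matrix_matrix_mult_def vec_eq_iff sum_distrib_left eq)
  qed
  moreover have "anti_map (x + y) = anti_map x + anti_map y"
    "anti_map (x - y) = anti_map x - anti_map y"
    "anti_map (c \<odot> x) = c \<odot> anti_map x" for x y c
    by (simp_all add: anti_map_def vec_eq_iff algebra_simps)
  moreover have "anti_map (anti_map x) = x" for x
  proof -
    have "sign_ix r * sign_ix s * (sign_ix s * sign_ix r * x $ r $ s) = x $ r $ s" for r s
      using sign_ix_square[of r] sign_ix_square[of s] by algebra
    thus ?thesis by (simp add: anti_map_def vec_eq_iff)
  qed
  hence "bij anti_map" by (metis bijI')
  ultimately show ?thesis
    by (simp add: lie_iso_def lie_bracket_def)
qed

lemma lie_iso_comp:
  "lie_iso \<phi> UNIV UNIV \<Longrightarrow> lie_iso \<psi> UNIV UNIV \<Longrightarrow> lie_iso (\<psi> \<circ> \<phi>) UNIV UNIV"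
  by (auto simp: lie_iso_def intro: bij_comp)

section \<open>Encoded triples\<close>

text \<open>
  A partial map is encoded by the list of its values at \<open>1, \<dots>, 4\<close>, with \<open>0\<close> for undefined.
\<close>

definition tau :: "nat list \<Rightarrow> nat \<rightharpoonup> nat"
  where "tau t i = (if 1 \<le> i \<and> i \<le> 4 \<and> t ! (i - 1) \<noteq> 0 then Some (t ! (i - 1)) else None)"

definition mk :: "nat list \<Rightarrow> triple"
  where "mk t = (tau t, dom (tau t), ran (tau t))"

datatype 'a five = Five 'a 'a 'a 'a 'a

fun sel :: "'a five \<Rightarrow> ix \<Rightarrow> 'a"
  where
    "sel (Five a b c d e) I1 = a" | "sel (Five a b c d e) I2 = b" | "sel (Five a b c d e) I3 = c"
  | "sel (Five a b c d e) I4 = d" | "sel (Five a b c d e) I5 = e"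

type_synonym root = "ix \<times> ix"

definition supported :: "nat list \<Rightarrow> root \<Rightarrow> bool"
  where "supported t = (\<lambda>(i, j). list_all (\<lambda>k. nat_ix i \<le> k \<and> k < nat_ix j \<longrightarrow> t ! (k - 1) \<noteq> 0) [1, 2, 3, 4])"

text \<open>
  On \<open>\<gg>\<^sub>1\<close>, \<open>\<tau>\<close> is the restriction of an automorphism of the whole algebra: conjugation by a
  permutation \<open>p\<close> of the basis, preceded by a negative twisted transposition if \<open>\<tau>\<close> reverses the
  order of the simple roots (the flag \<open>rv\<close>).
\<close>

definition step :: "nat list \<Rightarrow> bool \<Rightarrow> ix five \<Rightarrow> root \<Rightarrow> root option"
  where "step t rv p = (\<lambda>(i, j). if supported t (i, j)
     then Some (if rv then (sel p j, sel p i) else (sel p i, sel p j)) else None)"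

text \<open>\<open>False\<close> is the factor -1 that the twisted transposition puts on the root
  vectors of even height.\<close>

definition step_sign :: "bool \<Rightarrow> root \<Rightarrow> bool"
  where "step_sign rv = (\<lambda>(i, j). \<not> rv \<or> odd (nat_ix i + nat_ix j))"

fun iter :: "nat list \<Rightarrow> bool \<Rightarrow> ix five \<Rightarrow> nat \<Rightarrow> root \<Rightarrow> (root \<times> bool) option"
  where
    "iter t rv p 0 \<alpha> = Some (\<alpha>, True)"
  | "iter t rv p (Suc k) \<alpha> = (case iter t rv p k \<alpha> of None \<Rightarrow> None
      | Some (\<beta>, s) \<Rightarrow> (case step t rv p \<beta> of None \<Rightarrow> None | Some \<gamma> \<Rightarrow> Some (\<gamma>, s = step_sign rv \<beta>)))"

text \<open>The exponents 1, 2, 3 exhaust all positive iterates, because \<open>triple_ok\<close>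
  demands that the fourth iterate be undefined on every root.\<close>

definition links :: "nat list \<Rightarrow> bool \<Rightarrow> ix five \<Rightarrow> (root \<times> root \<times> bool) list"
  where "links t rv p = concat (map (\<lambda>\<alpha>. concat (map (\<lambda>k.
     case iter t rv p k \<alpha> of None \<Rightarrow> [] | Some (\<beta>, s) \<Rightarrow> [(\<alpha>, \<beta>, s)]) [1, 2, 3])) roots)"

type_synonym sparse = "((ix \<times> ix) \<times> (ix \<times> ix) \<times> bool) list"

text \<open>Each link gives the two entries of e_{-\<alpha>} (x) \<tau>^k(e_\<alpha>) -
  \<tau>^k(e_\<alpha>) (x) e_{-\<alpha>}. The factor 2 in a absorbs the 1/2 of the wedge, so each of
  them is +-1.\<close>

definition a_list :: "nat list \<Rightarrow> bool \<Rightarrow> ix five \<Rightarrow> sparse"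
  where "a_list t rv p = concat (map (\<lambda>((i, j), (b, e), s).
     [((j, b), (i, e), s), ((b, j), (e, i), \<not> s)]) (links t rv p))"

definition simple_ok :: "nat list \<Rightarrow> bool \<Rightarrow> ix five \<Rightarrow> root \<Rightarrow> bool"
  where "simple_ok t rv p = (\<lambda>(i, j). nat_ix j = Suc (nat_ix i) \<longrightarrow>
     (case step t rv p (i, j) of None \<Rightarrow> t ! (nat_ix i - 1) = 0
      | Some (b, e) \<Rightarrow> t ! (nat_ix i - 1) = nat_ix b \<and> nat_ix e = Suc (nat_ix b)))"

text \<open>The simple constituents of a root, pushed forward by t, add up to the root given by the
  permutation. This ties the action on matrix indices to the linear extension
  \<open>tau_root\<close>.\<close>

definition step_ok :: "nat list \<Rightarrow> bool \<Rightarrow> ix five \<Rightarrow> root \<Rightarrow> bool"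
  where "step_ok t rv p = (\<lambda>(i, j). case step t rv p (i, j) of None \<Rightarrow> True
     | Some (b, e) \<Rightarrow> (b, e) \<in> set roots \<and> list_all (\<lambda>l.
        sum_list (map (\<lambda>k. if t ! (k - 1) = l \<and> nat_ix i \<le> k \<and> k < nat_ix j then 1 else 0) [1, 2, 3, 4]) =
        (if nat_ix b \<le> l \<and> l < nat_ix e then 1 else (0 :: int))) [1, 2, 3, 4])"

text \<open>The last two conditions control a: a pair \<alpha>, \<beta> is linked at most once,
  which fixes the sign of \<tau>^k(e_\<alpha>), and different links never share a matrix
  position.\<close>

definition triple_ok :: "nat list \<Rightarrow> bool \<Rightarrow> ix five \<Rightarrow> bool"
  where "triple_ok t rv p \<longleftrightarrow> length t = 4 \<and> list_all (\<lambda>x. x \<le> 4) t \<and>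
    list_all (\<lambda>i. list_all (\<lambda>j. sel p i = sel p j \<longrightarrow> i = j) all_ix_list) all_ix_list \<and>
    list_all (simple_ok t rv p) roots \<and> list_all (step_ok t rv p) roots \<and>
    list_all (\<lambda>\<alpha>. iter t rv p 4 \<alpha> = None) roots \<and>
    distinct (map (\<lambda>(\<alpha>, \<beta>, s). (\<alpha>, \<beta>)) (links t rv p)) \<and>
    distinct (map (\<lambda>(x, y, s). (x, y)) (a_list t rv p))"

definition sg :: "bool \<Rightarrow> 'a::ring_1"
  where "sg s = (if s then 1 else - 1)"

lemma sg_simps [simp]: "sg True = 1" "sg False = - 1"
  by (simp_all add: sg_def)

lemma sg_eq: "sg (s = s') = sg s * sg s'"
  by (cases s; cases s') auto

lemma sg_not: "sg (\<not> s) = - sg s"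
  by (cases s) auto

text \<open>\<open>conj_map\<close> pulls indices back, so the inverse permutation is inserted in
  order that E a b goes to E (p a) (p b).\<close>

definition tau_map :: "bool \<Rightarrow> ix five \<Rightarrow> complex mat1 \<Rightarrow> complex mat1"
  where "tau_map rv p = conj_map (inv (\<lambda>x. el (sel p (the_inv el x)))) \<circ> (if rv then anti_map else id)"

lemma nat_ix_cases:
  assumes "1 \<le> n" "n \<le> 5" obtains i where "n = nat_ix i"
  using assms nat_ix_image by (metis atLeastAtMost_iff image_iff)

context
  fixes t :: "nat list" and rv :: bool and p :: "ix five"
  assumes ok: "triple_ok t rv p"
begin

section \<open>The encoded iteration agrees with the action of \<tau> on roots and on root
  vectors\<close>

lemma ok_simple: "(i, j) \<in> set roots \<Longrightarrow> nat_ix j = Suc (nat_ix i) \<Longrightarrow>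
    (case step t rv p (i, j) of None \<Rightarrow> t ! (nat_ix i - 1) = 0
      | Some (b, e) \<Rightarrow> t ! (nat_ix i - 1) = nat_ix b \<and> nat_ix e = Suc (nat_ix b))"
  using ok by (force simp: triple_ok_def simple_ok_def list_all_iff)

lemma ok_step:
  assumes "(i, j) \<in> set roots" "step t rv p (i, j) = Some (b, e)"
  shows "(b, e) \<in> set roots"
    "l \<in> {1..4} \<Longrightarrow> (\<Sum>k\<in>{1..4}. if t ! (k - 1) = l \<and> nat_ix i \<le> k \<and> k < nat_ix j then 1 else 0) =
        (if nat_ix b \<le> l \<and> l < nat_ix e then 1 else (0 :: int))"
proof -
  have *: "step_ok t rv p (i, j)"
    using ok assms(1) by (simp add: triple_ok_def list_all_iff)
  thus "(b, e) \<in> set roots"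
    using assms(2) by (simp add: step_ok_def)
  have 14: "{1..4::nat} = set [1, 2, 3, 4]" by auto
  show "(\<Sum>k\<in>{1..4}. if t ! (k - 1) = l \<and> nat_ix i \<le> k \<and> k < nat_ix j then 1 else 0) =
        (if nat_ix b \<le> l \<and> l < nat_ix e then 1 else (0 :: int))" if "l \<in> {1..4}"
  proof -
    have "sum_list (map (\<lambda>k. if t ! (k - 1) = l \<and> nat_ix i \<le> k \<and> k < nat_ix j then 1 else 0) [1, 2, 3, 4]) =
        (if nat_ix b \<le> l \<and> l < nat_ix e then 1 else (0 :: int))"
      using * assms(2) that unfolding step_ok_def 14 list_all_iff by (simp del: list.map sum_list.Cons set_simps)
    thus ?thesis
      unfolding 14 by (subst sum.distinct_set_conv_list) auto
  qed
qed

lemma ok_length: "length t = 4" "x \<in> set t \<Longrightarrow> x \<le> 4"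
  using ok by (auto simp: triple_ok_def list_all_iff)

lemma ok_nth: "k \<in> {1..4} \<Longrightarrow> t ! (k - 1) \<le> 4"
  using ok_length by auto

lemma tau_Some: "tau t k = Some l \<longleftrightarrow> k \<in> {1..4} \<and> l \<in> {1..4} \<and> t ! (k - 1) = l"
  using ok_nth[of k] by (auto simp: tau_def)

lemma dom_tau: "dom (tau t) = {k \<in> {1..4}. t ! (k - 1) \<noteq> 0}"
  by (auto simp: tau_def dom_def)

lemma supported_iff: "supported t (i, j) \<longleftrightarrow> {nat_ix i..<nat_ix j} \<subseteq> dom (tau t)"
proof -
  have "1 \<le> nat_ix i" "nat_ix j \<le> 5" using nat_ix_range by auto
  moreover have "supported t (i, j) \<longleftrightarrow> (\<forall>k\<in>{1..4}. nat_ix i \<le> k \<and> k < nat_ix j \<longrightarrow> t ! (k - 1) \<noteq> 0)"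
  proof -
    have 14: "{1..4::nat} = set [1, 2, 3, 4]" by auto
    show ?thesis unfolding supported_def 14 list_all_iff by (simp only: prod.case)
  qed
  ultimately show ?thesis
    unfolding dom_tau by (auto simp: subset_eq)
qed

text \<open>At the simple roots 1, ..., 4 the coefficients agree by \<open>step_ok\<close>; at other
  indices both sides vanish, since the values of \<open>tau t\<close> and the supports of roots lie
  in this range.\<close>

lemma tau_root_step:
  assumes "\<alpha> \<in> set roots"
  shows "tau_root (tau t) (root_coeffs (nat_root \<alpha>)) = map_option (\<lambda>\<beta>. root_coeffs (nat_root \<beta>)) (step t rv p \<alpha>)"
proof -
  obtain i j where \<alpha>: "\<alpha> = (i, j)" by force
  have supp: "{k. root_coeffs (nat_root \<alpha>) k \<noteq> 0} = {nat_ix i..<nat_ix j}"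
    by (auto simp: root_coeffs_def \<alpha>)
  show ?thesis
  proof (cases "step t rv p \<alpha>")
    case None
    thus ?thesis
      using supported_iff[of i j] unfolding tau_root_def supp by (auto simp: step_def \<alpha> split: if_splits)
  next
    case (Some \<beta>)
    obtain b e where \<beta>: "\<beta> = (b, e)" by force
    have sub: "{nat_ix i..<nat_ix j} \<subseteq> dom (tau t)"
      using Some supported_iff[of i j] by (auto simp: step_def \<alpha> split: if_splits)
    have "(\<Sum>k\<in>dom (tau t). if tau t k = Some l then root_coeffs (nat_root \<alpha>) k else 0) =
        root_coeffs (nat_root \<beta>) l" for l
    proof (cases "l \<in> {1..4}")
      case True
      have "(\<Sum>k\<in>dom (tau t). if tau t k = Some l then root_coeffs (nat_root \<alpha>) k else 0) =
          (\<Sum>k\<in>{1..4}. if tau t k = Some l then root_coeffs (nat_root \<alpha>) k else 0)"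
        by (rule sum.mono_neutral_left) (auto simp: dom_tau tau_def)
      also have "\<dots> = (\<Sum>k\<in>{1..4}. if t ! (k - 1) = l \<and> nat_ix i \<le> k \<and> k < nat_ix j then 1 else 0)"
        using True by (intro sum.cong) (auto simp: tau_Some root_coeffs_def \<alpha>)
      also have "\<dots> = root_coeffs (nat_root \<beta>) l"
        using ok_step(2)[of i j b e l] assms Some True by (simp add: \<alpha> \<beta> root_coeffs_def)
      finally show ?thesis .
    next
      case False
      hence "(\<Sum>k\<in>dom (tau t). if tau t k = Some l then root_coeffs (nat_root \<alpha>) k else 0) = 0"
        by (intro sum.neutral) (auto simp: tau_Some)
      moreover have "1 \<le> nat_ix b" "nat_ix e \<le> 5" using nat_ix_range by auto
      ultimately show ?thesis
        using False by (auto simp: root_coeffs_def \<beta>)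
    qed
    thus ?thesis
      using sub Some unfolding tau_root_def supp by auto
  qed
qed

lemma iter_root: "\<alpha> \<in> set roots \<Longrightarrow> iter t rv p k \<alpha> = Some (\<beta>, s) \<Longrightarrow> \<beta> \<in> set roots"
proof (induction k arbitrary: \<beta> s)
  case (Suc k)
  then obtain \<gamma> s' where "iter t rv p k \<alpha> = Some (\<gamma>, s')" "step t rv p \<gamma> = Some \<beta>"
    by (auto split: option.splits)
  thus ?case
    using Suc ok_step(1)[of "fst \<gamma>" "snd \<gamma>" "fst \<beta>" "snd \<beta>"] by simp
qed simp

lemma pmap_pow_iter:
  assumes "\<alpha> \<in> set roots"
  shows "pmap_pow (tau_root (tau t)) k (root_coeffs (nat_root \<alpha>)) =
    map_option (\<lambda>(\<beta>, s). root_coeffs (nat_root \<beta>)) (iter t rv p k \<alpha>)"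
proof (induction k)
  case (Suc k)
  show ?case
    using Suc iter_root[OF assms, of k] tau_root_step
    by (auto simp: map_comp_def split: option.splits)
qed simp

text \<open>A root is recovered from its support, a nonempty interval.\<close>

lemma root_coeffs_inj:
  assumes "\<alpha> \<in> set roots" "\<beta> \<in> set roots" "root_coeffs (nat_root \<alpha>) = root_coeffs (nat_root \<beta>)"
  shows "\<alpha> = \<beta>"
proof -
  obtain i j b e where *: "\<alpha> = (i, j)" "\<beta> = (b, e)" by (cases \<alpha>; cases \<beta>) auto
  have "{k. root_coeffs (nat_root \<alpha>) k \<noteq> 0} = {nat_ix i..<nat_ix j}"
    "{k. root_coeffs (nat_root \<beta>) k \<noteq> 0} = {nat_ix b..<nat_ix e}"
    by (auto simp: root_coeffs_def *)
  thus ?thesis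
    using assms atLeastLessThan_inj[of "nat_ix i" "nat_ix j" "nat_ix b" "nat_ix e"]
    by (simp add: * set_roots)
qed

lemma root_maps_iff:
  assumes "\<alpha> \<in> set roots" "\<beta> \<in> set roots"
  shows "root_maps (tau t) k (nat_root \<alpha>) (nat_root \<beta>) \<longleftrightarrow> (\<exists>s. iter t rv p k \<alpha> = Some (\<beta>, s))"
proof (cases "iter t rv p k \<alpha>")
  case None
  thus ?thesis by (simp add: root_maps_def pmap_pow_iter[OF assms(1)])
next
  case (Some x)
  obtain \<gamma> s where x: "x = (\<gamma>, s)" by (cases x)
  have "root_coeffs (nat_root \<gamma>) = root_coeffs (nat_root \<beta>) \<longleftrightarrow> \<gamma> = \<beta>"
    using root_coeffs_inj[OF iter_root[OF assms(1) Some[unfolded x]] assms(2)] by blast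
  thus ?thesis
    by (simp add: root_maps_def pmap_pow_iter[OF assms(1)] Some x)
qed

text \<open>An undefined iterate stays undefined, so the single check at exponent 4 bounds all
  exponents.\<close>

lemma iter_bound:
  assumes "\<alpha> \<in> set roots" "iter t rv p k \<alpha> = Some x"
  shows "k < 4"
proof (rule ccontr)
  assume "\<not> k < 4"
  hence "4 \<le> k" by simp
  hence "iter t rv p k \<alpha> = None"
  proof (induction k rule: dec_induct)
    case base
    show ?case using ok assms(1) by (auto simp: triple_ok_def list_all_iff)
  qed simp
  thus False using assms(2) by simp
qed

lemma set_links:
  "(\<alpha>, \<beta>, s) \<in> set (links t rv p) \<longleftrightarrow> \<alpha> \<in> set roots \<and> (\<exists>k\<ge>1. iter t rv p k \<alpha> = Some (\<beta>, s))"
proof -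
  have "(\<alpha>, \<beta>, s) \<in> set (links t rv p) \<longleftrightarrow> \<alpha> \<in> set roots \<and> (\<exists>k\<in>{1, 2, 3}. iter t rv p k \<alpha> = Some (\<beta>, s))"
  proof -
    have *: "x \<in> set (case o' of None \<Rightarrow> [] | Some (\<beta>, s) \<Rightarrow> [(\<alpha>, \<beta>, s)]) \<longleftrightarrow>
        (\<exists>\<beta> s. o' = Some (\<beta>, s) \<and> x = (\<alpha>, \<beta>, s))" for x :: "root \<times> root \<times> bool" and o' \<alpha>
      by (auto split: option.splits)
    show ?thesis
      unfolding links_def set_concat set_map image_image UN_iff * list.set(1,2) by blast
  qed
  moreover have "k \<ge> 1 \<and> k < 4 \<longleftrightarrow> k \<in> {1, 2, 3}" for k :: nat
    by auto
  ultimately show ?thesis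
    using iter_bound by metis
qed

lemma bij_perm: "bij (\<lambda>x. el (sel p (the_inv el x)))"
proof -
  have "inj (sel p)"
    using ok unfolding triple_ok_def all_ix_list inj_def by blast
  hence "bij (sel p)"
    by (simp add: finite_UNIV_inj_surj bij_def)
  hence "bij (el \<circ> (sel p \<circ> the_inv el))"
    using bij_el by (intro bij_comp) (auto intro: bij_betw_the_inv_into)
  thus ?thesis by (simp add: o_def)
qed

lemma tau_map_iso: "lie_iso (tau_map rv p) UNIV UNIV"
proof -
  have "lie_iso id UNIV UNIV" by (simp add: lie_iso_def)
  thus ?thesis
    unfolding tau_map_def using conj_map_iso[OF bij_imp_bij_inv[OF bij_perm]] anti_map_iso
    by (auto intro: lie_iso_comp)
qed

lemma conj_map_E:
  "conj_map (inv (\<lambda>x. el (sel p (the_inv el x)))) (E (nat_ix a) (nat_ix b)) = E (nat_ix (sel p a)) (nat_ix (sel p b))"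
proof -
  let ?f = "\<lambda>x. el (sel p (the_inv el x))"
  have "inv ?f x = el a \<longleftrightarrow> x = el (sel p a)" for x a
    using bij_inv_eq_iff[OF bij_perm, of "el a" x] by (auto simp: the_inv_f_f bij_is_inj[OF bij_el])
  thus ?thesis
    by (simp add: conj_map_def E_def vec_eq_iff el_def[symmetric])
qed

lemma anti_map_E:
  "anti_map (E (nat_ix a) (nat_ix b)) = sg (odd (nat_ix a + nat_ix b)) \<odot> E (nat_ix b) (nat_ix a)"
proof -
  have "anti_map (E (nat_ix a) (nat_ix b)) $ el r $ el s = (sg (odd (nat_ix a + nat_ix b)) \<odot> E (nat_ix b) (nat_ix a)) $ el r $ el s" for r s
    by (auto simp: anti_map_def E_entry' sg_def power_add[symmetric] add.commute)
  thus ?thesis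
    unfolding vec_eq_iff all_el by blast
qed

lemma tau_map_E:
  "tau_map rv p (E (nat_ix a) (nat_ix b)) = (if rv then sg (odd (nat_ix a + nat_ix b)) \<odot> E (nat_ix (sel p b)) (nat_ix (sel p a))
     else E (nat_ix (sel p a)) (nat_ix (sel p b)))"
  using conj_map_iso[OF bij_imp_bij_inv[OF bij_perm]]
  by (simp add: tau_map_def conj_map_E anti_map_E lie_iso_def)

text \<open>\<open>tau_map\<close> restricts to an isomorphism between the generated subalgebras
  with the prescribed values on generators, and there is only one such map.\<close>

lemma tau_lie_mk:
  assumes "x \<in> gen_subalgebra (dom (tau t))"
  shows "tau_lie (mk t) x = tau_map rv p x"
proof -
  have gens: "tau_map rv p (E i (Suc i)) = E (the (tau t i)) (Suc (the (tau t i))) \<and>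
      tau_map rv p (E (Suc i) i) = E (Suc (the (tau t i))) (the (tau t i))" if "i \<in> dom (tau t)" for i
  proof -
    have i: "1 \<le> i" "i \<le> 4" "t ! (i - 1) \<noteq> 0"
      using that by (auto simp: dom_tau)
    obtain a where a: "i = nat_ix a"
      by (rule nat_ix_cases[of i]) (use i in auto)
    obtain b where "Suc i = nat_ix b"
      by (rule nat_ix_cases[of "Suc i"]) (use i in auto)
    note ab = a this
    hence "(a, b) \<in> set roots" by (simp add: set_roots)
    moreover have "supported t (a, b)"
      using supported_iff[of a b] that ab by (auto simp flip: ab(2)) 
    ultimately have *: "(if rv then nat_ix (sel p b) else nat_ix (sel p a)) = t ! (i - 1)"
      "(if rv then nat_ix (sel p a) else nat_ix (sel p b)) = Suc (t ! (i - 1))"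
      using ok_simple[of a b] ab by (auto simp: step_def split: if_splits)
    \<comment> \<open>Adjacent indices have odd sum, so even an order-reversing \<tau> puts no sign
      on the generators.\<close>
    have odd: "odd (nat_ix a + nat_ix b)" "odd (nat_ix b + nat_ix a)"
      using ab(2) unfolding ab(1) by presburger+
    have "tau_map rv p (E (nat_ix a) (nat_ix b)) =
        E (if rv then nat_ix (sel p b) else nat_ix (sel p a)) (if rv then nat_ix (sel p a) else nat_ix (sel p b))"
      "tau_map rv p (E (nat_ix b) (nat_ix a)) =
        E (if rv then nat_ix (sel p a) else nat_ix (sel p b)) (if rv then nat_ix (sel p b) else nat_ix (sel p a))"
      unfolding tau_map_E by (simp_all only: odd) (simp_all add: smult_algebra(4,5))
    hence "tau_map rv p (E (nat_ix a) (nat_ix b)) = E (t ! (i - 1)) (Suc (t ! (i - 1)))"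
      "tau_map rv p (E (nat_ix b) (nat_ix a)) = E (Suc (t ! (i - 1))) (t ! (i - 1))"
      by (simp_all only: *)
    moreover have "the (tau t i) = t ! (i - 1)"
      using i by (simp add: tau_def)
    ultimately show ?thesis
      using ab by (simp only:)
  qed
  have "ran (tau t) = (\<lambda>i. the (tau t i)) ` dom (tau t)"
    by (force simp: ran_def dom_def image_iff)
  from lie_iso_gen[OF tau_map_iso this] gens
  have "lie_iso (tau_map rv p) (gen_subalgebra (dom (tau t))) (gen_subalgebra (ran (tau t)))"
    by blast
  thus ?thesis
    unfolding mk_def using tau_lie_eq gens assms by blast
qed

text \<open>Each root to which \<tau> is applied is supported in the domain, so its root vector lies
  in the subalgebra where \<open>tau_lie\<close> is determined.\<close>

lemma tau_lie_iter:
  assumes "\<alpha> \<in> set roots" "iter t rv p k \<alpha> = Some (\<beta>, s)"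
  shows "(tau_lie (mk t) ^^ k) (pos_vec (nat_root \<alpha>)) = sg s \<odot> pos_vec (nat_root \<beta>)"
  using assms(2)
proof (induction k arbitrary: \<beta> s)
  case 0
  thus ?case by (simp add: smult_algebra(4,5))
next
  case (Suc k)
  then obtain \<gamma> s' where \<gamma>: "iter t rv p k \<alpha> = Some (\<gamma>, s')" "step t rv p \<gamma> = Some \<beta>"
    and s: "s = (s' = step_sign rv \<gamma>)"
    by (auto split: option.splits)
  obtain i j where ij: "\<gamma> = (i, j)" by force
  have "{nat_ix i..<nat_ix j} \<subseteq> dom (tau t)"
    using \<gamma>(2) supported_iff[of i j] by (auto simp: step_def ij split: if_splits)
  moreover have "nat_ix i < nat_ix j"
    using iter_root[OF assms(1) \<gamma>(1)] by (simp add: ij set_roots)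
  moreover have "1 \<le> nat_ix i" "nat_ix j \<le> 5" using nat_ix_range by auto
  ultimately have gen: "E (nat_ix i) (nat_ix j) \<in> gen_subalgebra (dom (tau t))"
    by (intro gen_subalgebra_root)
  have "(tau_lie (mk t) ^^ Suc k) (pos_vec (nat_root \<alpha>)) = tau_lie (mk t) (sg s' \<odot> E (nat_ix i) (nat_ix j))"
    using Suc.IH[OF \<gamma>(1)] by (simp add: pos_vec_def ij)
  also have "\<dots> = tau_map rv p (sg s' \<odot> E (nat_ix i) (nat_ix j))"
    by (rule tau_lie_mk) (rule lie_subalgebraD(3)[OF lie_subalgebra_gen gen])
  also have "\<dots> = sg s' \<odot> tau_map rv p (E (nat_ix i) (nat_ix j))"
    using tau_map_iso by (simp add: lie_iso_def)
  also have "\<dots> = sg s \<odot> pos_vec (nat_root \<beta>)"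
    using \<gamma>(2) unfolding tau_map_E s sg_eq
    by (auto simp: ij step_def step_sign_def pos_vec_def smult_algebra(4,5) split: if_splits)
  finally show ?case .
qed

text \<open>Pairs of related roots correspond bijectively to links. The sign at the least exponent
  \<open>root_exponent\<close> is the one stored in the link, because a pair occurs in only one
  link.\<close>

lemma a_mat_links:
  "a_mat (mk t) = 2 \<odot> (\<Sum>(\<alpha>, \<beta>, s)\<leftarrow>links t rv p. neg_vec (nat_root \<alpha>) \<^bold>\<and> (sg s \<odot> pos_vec (nat_root \<beta>)))"
proof -
  let ?h = "\<lambda>(\<alpha>, \<beta>, s :: bool). (nat_root \<alpha>, nat_root \<beta>)"
  let ?P = "{(\<alpha>, \<beta>) \<in> pos_roots \<times> pos_roots. root_less (tau t) \<alpha> \<beta>}"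
  have dist: "distinct (map (\<lambda>(\<alpha>, \<beta>, s). (\<alpha>, \<beta>)) (links t rv p))"
    using ok by (simp add: triple_ok_def)
  hence inj0: "inj_on (\<lambda>(\<alpha>, \<beta>, s). (\<alpha>, \<beta>)) (set (links t rv p))" and dl: "distinct (links t rv p)"
    by (auto simp: distinct_map)
  have unique: "s = s'" if "(\<alpha>, \<beta>, s) \<in> set (links t rv p)" "(\<alpha>, \<beta>, s') \<in> set (links t rv p)" for \<alpha> \<beta> s s'
    using inj_onD[OF inj0 _ that] by simp
  have inj: "inj_on ?h (set (links t rv p))"
  proof (rule inj_onI)
    fix x y assume xy: "x \<in> set (links t rv p)" "y \<in> set (links t rv p)" "?h x = ?h y"
    obtain \<alpha> \<beta> s where x: "x = (\<alpha>, \<beta>, s)" by (rule prod_cases3)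
    obtain \<alpha>' \<beta>' s' where y: "y = (\<alpha>', \<beta>', s')" by (rule prod_cases3)
    show "x = y"
      using xy unique unfolding x y by (simp add: inj_eq[OF inj_nat_root])
  qed
  have less: "root_less (tau t) (nat_root \<alpha>) (nat_root \<beta>) \<longleftrightarrow> (\<exists>s. (\<alpha>, \<beta>, s) \<in> set (links t rv p))"
    if "\<alpha> \<in> set roots" "\<beta> \<in> set roots" for \<alpha> \<beta>
    unfolding root_less_def set_links using root_maps_iff[OF that] that(1) by blast
  have P: "?P = ?h ` set (links t rv p)"
  proof (intro equalityI subsetI)
    fix x assume "x \<in> ?P"
    then obtain \<alpha> \<beta> where x: "x = (nat_root \<alpha>, nat_root \<beta>)" "\<alpha> \<in> set roots" "\<beta> \<in> set roots"
      "root_less (tau t) (nat_root \<alpha>) (nat_root \<beta>)"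
      unfolding pos_roots_eq by auto
    then obtain s where "(\<alpha>, \<beta>, s) \<in> set (links t rv p)" using less by blast
    thus "x \<in> ?h ` set (links t rv p)" using x(1) by force
  next
    fix x assume "x \<in> ?h ` set (links t rv p)"
    then obtain \<alpha> \<beta> s where l: "(\<alpha>, \<beta>, s) \<in> set (links t rv p)" and x: "x = (nat_root \<alpha>, nat_root \<beta>)"
      by auto
    hence "\<alpha> \<in> set roots" "\<beta> \<in> set roots"
      unfolding set_links using iter_root by blast+
    thus "x \<in> ?P" using less l by (auto simp: x pos_roots_eq)
  qed
  have "(\<Sum>(\<alpha>, \<beta>)\<in>?P. neg_vec \<alpha> \<^bold>\<and> (tau_lie (mk t) ^^ root_exponent (tau t) \<alpha> \<beta>) (pos_vec \<alpha>)) =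
     (\<Sum>(\<alpha>, \<beta>, s)\<in>set (links t rv p). neg_vec (nat_root \<alpha>) \<^bold>\<and>
        (tau_lie (mk t) ^^ root_exponent (tau t) (nat_root \<alpha>) (nat_root \<beta>)) (pos_vec (nat_root \<alpha>)))"
    unfolding P by (subst sum.reindex[OF inj]) (simp add: case_prod_unfold o_def)
  also have "\<dots> = (\<Sum>(\<alpha>, \<beta>, s)\<in>set (links t rv p). neg_vec (nat_root \<alpha>) \<^bold>\<and> (sg s \<odot> pos_vec (nat_root \<beta>)))"
  proof (intro sum.cong refl, clarify)
    fix \<alpha> \<beta> s assume l: "(\<alpha>, \<beta>, s) \<in> set (links t rv p)"
    let ?k = "root_exponent (tau t) (nat_root \<alpha>) (nat_root \<beta>)"
    have r: "\<alpha> \<in> set roots" "\<beta> \<in> set roots"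
      using l iter_root unfolding set_links by blast+
    have "1 \<le> ?k \<and> root_maps (tau t) ?k (nat_root \<alpha>) (nat_root \<beta>)"
      unfolding root_exponent_def
      by (rule LeastI_ex) (use less[OF r] l in \<open>auto simp: root_less_def\<close>)
    then obtain s' where k: "?k \<ge> 1" "iter t rv p ?k \<alpha> = Some (\<beta>, s')"
      using root_maps_iff[OF r] by blast
    hence "(\<alpha>, \<beta>, s') \<in> set (links t rv p)"
      using r unfolding set_links by blast
    hence "s' = s" using unique l by blast
    thus "neg_vec (nat_root \<alpha>) \<^bold>\<and> (tau_lie (mk t) ^^ ?k) (pos_vec (nat_root \<alpha>)) =
        neg_vec (nat_root \<alpha>) \<^bold>\<and> (sg s \<odot> pos_vec (nat_root \<beta>))"
      using tau_lie_iter[OF r(1) k(2)] by simp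
  qed
  finally show ?thesis
    unfolding a_mat_def by (simp add: mk_def[of t] sum_list_distinct_conv_sum_set[OF dl])
qed

end

section \<open>Integer forms of a and \<epsilon>, and the tables of entries\<close>

lemma QYBE_ybe: "QYBE A \<longleftrightarrow> ybe (ent A)"
  unfolding QYBE_iff ybe_def ..

lemma Hecke_hecke: "Hecke A \<longleftrightarrow> hecke (ent A)"
  unfolding Hecke_iff hecke_def ..

abbreviation entp :: "'k mat2 \<Rightarrow> ix \<times> ix \<Rightarrow> ix \<times> ix \<Rightarrow> 'k"
  where "entp A x y \<equiv> ent A (fst x) (snd x) (fst y) (snd y)"

lemma entp_mult: "entp (A ** B) x y = (\<Sum>u\<in>UNIV. entp A x u * entp B u y)"
  by (simp add: ent_mult sum_pair)

definition av :: "sparse \<Rightarrow> ix \<times> ix \<Rightarrow> ix \<times> ix \<Rightarrow> int"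
  where "av L x y = sum_list (map (\<lambda>(x', y', s). if x' = x \<and> y' = y then sg s else 0) L)"

text \<open>Twice \<epsilon>, grouped as a (2c + 2a) + (2c) a, so that each product runs only over
  the sparse list of entries of a.\<close>

definition eps2 :: "sparse \<Rightarrow> ix \<times> ix \<Rightarrow> ix \<times> ix \<Rightarrow> int"
  where "eps2 L x y =
    sum_list (map (\<lambda>(x', u, s). if x' = x then sg s * (c2 u y + 2 * av L u y) else 0) L) +
    sum_list (map (\<lambda>(u, y', s). if y' = y then c2 x u * sg s else 0) L)"

lemma of_int_sg [simp]: "of_int (sg s) = (sg s :: 'a::ring_1)"
  by (cases s) auto

lemma sum_av_left: "(\<Sum>u\<in>UNIV. of_int (av L x u) * f u) =
    (\<Sum>(x', u, s)\<leftarrow>L. if x' = x then sg s * f u else (0 :: 'a::comm_ring_1))"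
proof (induction L)
  case (Cons z L)
  obtain x' u s where z: "z = (x', u, s)" by (rule prod_cases3)
  have "av (z # L) x v = (if u = v then (if x' = x then sg s else 0) else 0) + av L x v" for v
    by (simp add: av_def z)
  thus ?case
    using Cons by (simp add: z distrib_right sum.distrib if_distrib[of of_int] if_mult cong: if_cong)
qed (simp add: av_def)

lemma sum_av_right: "(\<Sum>u\<in>UNIV. f u * of_int (av L u y)) =
    (\<Sum>(u, y', s)\<leftarrow>L. if y' = y then f u * sg s else (0 :: 'a::comm_ring_1))"
proof (induction L)
  case (Cons z L)
  obtain u y' s where z: "z = (u, y', s)" by (rule prod_cases3)
  have "av (z # L) v y = (if u = v then (if y' = y then sg s else 0) else 0) + av L v y" for v
    by (simp add: av_def z)
  thus ?case
    using Cons by (simp add: z distrib_left sum.distrib if_distrib[of of_int] if_mult cong: if_cong)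
qed (simp add: av_def)

lemma sum_list_lookup:
  assumes "distinct (map (\<lambda>(x, y, s). (x, y)) L)"
  shows "(x, y, s) \<in> set L \<Longrightarrow> (\<Sum>(x', y', s)\<leftarrow>L. if x' = x \<and> y' = y then g s else 0) = (g s :: 'a::comm_monoid_add)"
    "\<nexists>s. (x, y, s) \<in> set L \<Longrightarrow> (\<Sum>(x', y', s)\<leftarrow>L. if x' = x \<and> y' = y then g s else 0) = (0 :: 'a)"
proof -
  show *: "\<nexists>s. (x, y, s) \<in> set L \<Longrightarrow> (\<Sum>(x', y', s)\<leftarrow>L. if x' = x \<and> y' = y then g s else 0) = (0 :: 'a)" for L
    by (induction L) auto
  show "(x, y, s) \<in> set L \<Longrightarrow> (\<Sum>(x', y', s)\<leftarrow>L. if x' = x \<and> y' = y then g s else 0) = (g s :: 'a)"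
    using assms
  proof (induction L)
    case (Cons z L)
    show ?case
    proof (cases "z = (x, y, s)")
      case True
      hence "\<nexists>s. (x, y, s) \<in> set L"
        using Cons.prems(2) by force
      from *[OF this] show ?thesis by (simp add: True)
    next
      case False
      hence 1: "(x, y, s) \<in> set L" using Cons.prems(1) by auto
      hence "(x, y) \<in> (\<lambda>(x, y, s). (x, y)) ` set L" by force
      hence "\<not> (fst z = x \<and> fst (snd z) = y)"
        using Cons.prems(2) by (auto simp: case_prod_unfold)
      thus ?thesis
        using Cons.IH[OF 1] Cons.prems(2) by (auto simp: case_prod_unfold)
    qed
  qed simp
qed

lemma of_int_sum_list: "of_int (\<Sum>x\<leftarrow>L. f x) = (\<Sum>x\<leftarrow>L. of_int (f x) :: 'a::ring_1)"
  by (induction L) auto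

lemma sum_list_map_concat: "(\<Sum>x\<leftarrow>concat Ls. f x) = (\<Sum>L\<leftarrow>Ls. \<Sum>x\<leftarrow>L. f x :: 'a::comm_monoid_add)"
  by (induction Ls) auto

lemma qpow_diff: "qpow (a - b) = qpow a * qpow (- b)"
  by (simp add: qpow_add[symmetric])

type_synonym int_mat = "int five five"

definition look :: "'a five five \<Rightarrow> ix \<Rightarrow> ix \<Rightarrow> 'a"
  where "look T i k = sel (sel T i) k"

definition tabulate :: "(ix \<Rightarrow> 'a) \<Rightarrow> 'a five"
  where "tabulate f = Five (f I1) (f I2) (f I3) (f I4) (f I5)"

lemma sel_tabulate [simp]: "sel (tabulate f) i = f i"
  by (cases i) (simp_all add: tabulate_def)

text \<open>Rows of the matrix twisted by d/2. On the diagonal the two halves of d add up to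
  \<open>look d i k\<close>, at the flipped position they cancel by antisymmetry, and for an entry
  of a the total exponent is half of an integer which \<open>parity_ok\<close> shows to be even, so
  that \<open>div\<close> is exact.\<close>

definition coeffs :: "sparse \<Rightarrow> int_mat \<Rightarrow> ix \<Rightarrow> ix \<Rightarrow> entry list"
  where "coeffs L d i k =
    (i, k, (if i = k then 1 else look d i k), 0, True) #
    (if (k, i) \<in> set roots then [(k, i, 0, 1, True)] else []) @
    concat (map (\<lambda>(x, (j, l), s). if x = (i, k)
      then [(j, l, (sg s * eps2 L (i, k) (j, l) + look d i k + look d j l) div 2, 1, s)] else []) L)"

definition coeff_table :: "sparse \<Rightarrow> int_mat \<Rightarrow> entry list five five"
  where "coeff_table L d = tabulate (\<lambda>i. tabulate (coeffs L d i))"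

text \<open>The admissibility equations over gl(5) for the diagonal part d/2, cleared of
  denominators; m runs over all five diagonal positions.\<close>

definition twist_eq :: "nat list \<Rightarrow> bool \<Rightarrow> ix five \<Rightarrow> int_mat \<Rightarrow> root \<Rightarrow> bool"
  where "twist_eq t rv p d = (\<lambda>(i, j). nat_ix j = Suc (nat_ix i) \<longrightarrow>
     (case step t rv p (i, j) of None \<Rightarrow> True
      | Some (b, e) \<Rightarrow> list_all (\<lambda>m. look d b m - look d e m - look d i m + look d j m =
          (if m = e then 1 else 0) + (if m = j then 1 else 0) - (if m = b then 1 else 0) - (if m = i then 1 else 0))
        all_ix_list))"

definition twist_ok :: "nat list \<Rightarrow> bool \<Rightarrow> ix five \<Rightarrow> int_mat \<Rightarrow> bool"
  where "twist_ok t rv p d \<longleftrightarrow>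
    list_all (\<lambda>i. list_all (\<lambda>j. look d i j = - look d j i) all_ix_list) all_ix_list \<and>
    list_all (twist_eq t rv p d) roots"

definition parity_ok :: "sparse \<Rightarrow> int_mat \<Rightarrow> bool"
  where "parity_ok L d \<longleftrightarrow> list_all (\<lambda>((i, k), (j, l), s).
     even (sg s * eps2 L (i, k) (j, l) + look d i k + look d j l)) L"

definition table_ok :: "entry list five five \<Rightarrow> bool"
  where "table_ok T \<longleftrightarrow> ybe_check (look T) \<and> hecke_check (look T)"

lemma smult_wedge: "x \<^bold>\<and> (c \<odot> y) = c \<odot> (x \<^bold>\<and> y)"
  by (simp add: wedge_def tensor_def vec_eq_iff algebra_simps)

context
  fixes t :: "nat list" and rv :: bool and p :: "ix five"
  assumes ok: "triple_ok t rv p"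
begin

lemma distinct_a_list: "distinct (map (\<lambda>(x, y, s). (x, y)) (a_list t rv p))"
  using ok by (simp add: triple_ok_def)

lemma entp_a_mat: "entp (a_mat (mk t)) x y = of_int (av (a_list t rv p) x y)"
proof -
  obtain i k j l where xy: "x = (i, k)" "y = (j, l)" by (cases x; cases y) auto
  let ?f = "\<lambda>(x', y', s). if x' = x \<and> y' = y then sg s else (0 :: int)"
  let ?a = "\<lambda>((i, j), (b, e), s). [((j, b), (i, e), s), ((b, j), (e, i), \<not> s)]"
  have *: "2 * ent (neg_vec (nat_root \<alpha>) \<^bold>\<and> (sg s \<odot> pos_vec (nat_root \<beta>))) i k j l =
      of_int (\<Sum>z\<leftarrow>?a (\<alpha>, \<beta>, s). ?f z)" for \<alpha> \<beta> s
  proof -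
    obtain a b c d where ab: "\<alpha> = (a, b)" "\<beta> = (c, d)" by (cases \<alpha>; cases \<beta>) auto
    define P where "P \<longleftrightarrow> (b, c) = x \<and> (a, d) = y"
    define Q where "Q \<longleftrightarrow> (c, b) = x \<and> (d, a) = y"
    have T: "ent (E (nat_ix b) (nat_ix a) \<otimes> E (nat_ix c) (nat_ix d)) i k j l = (if P then 1 else (0 :: complex))"
      "ent (E (nat_ix c) (nat_ix d) \<otimes> E (nat_ix b) (nat_ix a)) i k j l = (if Q then 1 else (0 :: complex))"
      by (auto simp: ent_tensor_E xy P_def Q_def)
    have "2 * ent (neg_vec (nat_root \<alpha>) \<^bold>\<and> (sg s \<odot> pos_vec (nat_root \<beta>))) i k j l =
        sg s * ((if P then 1 else 0) - (if Q then 1 else 0))"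
      by (simp only: smult_wedge) (simp add: wedge_def neg_vec_def pos_vec_def T ab)
    moreover have "(\<Sum>z\<leftarrow>?a (\<alpha>, \<beta>, s). ?f z) = (if P then sg s else 0) + (if Q then sg (\<not> s) else 0)"
      unfolding P_def Q_def ab by (simp only: list.map sum_list.Cons sum_list.Nil prod.case add_0_right)
    ultimately show ?thesis
      by (simp only: sg_not) (cases P; cases Q; simp)
  qed
  have "entp (a_mat (mk t)) x y = (\<Sum>(\<alpha>, \<beta>, s)\<leftarrow>links t rv p. of_int (\<Sum>z\<leftarrow>?a (\<alpha>, \<beta>, s). ?f z))"
  proof -
    have "entp (a_mat (mk t)) x y =
        (\<Sum>z\<leftarrow>links t rv p. 2 * ent (case z of (\<alpha>, \<beta>, s) \<Rightarrow> neg_vec (nat_root \<alpha>) \<^bold>\<and> (sg s \<odot> pos_vec (nat_root \<beta>))) i k j l)"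
      unfolding a_mat_links[OF ok] xy fst_conv snd_conv ent_smult ent_sum_list sum_list_const_mult by (rule refl)
    also have "\<dots> = (\<Sum>(\<alpha>, \<beta>, s)\<leftarrow>links t rv p. of_int (\<Sum>z\<leftarrow>?a (\<alpha>, \<beta>, s). ?f z))"
    proof (rule sum_list_cong)
      fix z :: "root \<times> root \<times> bool"
      obtain \<alpha> \<beta> s where z: "z = (\<alpha>, \<beta>, s)" by (rule prod_cases3)
      show "2 * ent (case z of (\<alpha>, \<beta>, s) \<Rightarrow> neg_vec (nat_root \<alpha>) \<^bold>\<and> (sg s \<odot> pos_vec (nat_root \<beta>))) i k j l =
          (case z of (\<alpha>, \<beta>, s) \<Rightarrow> of_int (\<Sum>z\<leftarrow>?a (\<alpha>, \<beta>, s). ?f z))"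
        unfolding z prod.case by (rule *[unfolded prod.case])
    qed
    finally show ?thesis .
  qed
  also have "\<dots> = of_int (\<Sum>w\<leftarrow>links t rv p. \<Sum>z\<leftarrow>?a w. ?f z)"
    by (simp only: of_int_sum_list case_prod_unfold prod.collapse)
  also have "(\<Sum>w\<leftarrow>links t rv p. \<Sum>z\<leftarrow>?a w. ?f z) = av (a_list t rv p) x y"
    unfolding av_def a_list_def by (simp only: sum_list_map_concat map_map o_def)
  finally show ?thesis .
qed

lemma entp_eps_mat: "entp (eps_mat (mk t)) x y = of_int (eps2 (a_list t rv p) x y) / 2"
proof -
  let ?L = "a_list t rv p"
  have "entp (eps_mat (mk t)) x y =
      (\<Sum>u\<in>UNIV. of_int (av ?L x u) * (of_int (c2 u y) / 2)) +
      (\<Sum>u\<in>UNIV. (of_int (c2 x u) / 2) * of_int (av ?L u y)) +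
      (\<Sum>u\<in>UNIV. of_int (av ?L x u) * of_int (av ?L u y))"
    unfolding eps_mat_def vector_add_component entp_mult entp_a_mat ent_c_mat by simp
  also have "\<dots> = (\<Sum>u\<in>UNIV. of_int (av ?L x u) * (of_int (c2 u y + 2 * av ?L u y) / 2)) +
      (\<Sum>u\<in>UNIV. (of_int (c2 x u) / 2) * of_int (av ?L u y))"
    by (simp add: sum.distrib[symmetric] algebra_simps add_divide_distrib)
  also have "\<dots> = of_int (eps2 ?L x y) / 2"
  proof -
    have A: "of_int (\<Sum>(x', u, s)\<leftarrow>L. if x' = x then sg s * f u else 0) / 2 =
      (\<Sum>(x', u, s)\<leftarrow>L. if x' = x then sg s * (of_int (f u) / 2) else (0 :: complex))" for f and L :: sparse
      by (induction L) (auto simp: add_divide_distrib)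
    have B: "of_int (\<Sum>(u, y', s)\<leftarrow>L. if y' = y then f u * sg s else 0) / 2 =
      (\<Sum>(u, y', s)\<leftarrow>L. if y' = y then (of_int (f u) / 2) * sg s else (0 :: complex))" for f and L :: sparse
      by (induction L) (auto simp: add_divide_distrib)
    define X Y where "X = (\<Sum>(x', u, s)\<leftarrow>?L. if x' = x then sg s * (c2 u y + 2 * av ?L u y) else 0)"
      and "Y = (\<Sum>(u, y', s)\<leftarrow>?L. if y' = y then c2 x u * sg s else 0)"
    have "(of_int (eps2 ?L x y) :: complex) / 2 = of_int X / 2 + of_int Y / 2"
      by (simp add: eps2_def X_def Y_def add_divide_distrib)
    thus ?thesis
      unfolding sum_av_left sum_av_right X_def Y_def A B by (rule sym)
  qed
  finally show ?thesis .
qed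

text \<open>A position carries at most one entry +-1 of a, so the exponent a * \<epsilon> is that
  sign times the entry of \<epsilon>.\<close>

lemma entp_a_tilde: "entp (a_tilde (mk t)) x y = (\<Sum>(x', y', s)\<leftarrow>a_list t rv p. if x' = x \<and> y' = y
    then sg s * qpow (sg s * of_int (eps2 (a_list t rv p) x y) / 2) else 0)"
proof -
  have "entp (a_tilde (mk t)) x y =
      fps_const (of_int (av (a_list t rv p) x y)) * qpow (of_int (av (a_list t rv p) x y) * of_int (eps2 (a_list t rv p) x y) / 2)"
    by (simp add: a_tilde_def entp_a_mat entp_eps_mat)
  moreover have "fps_const (sg s) = (sg s :: complex fps)" for s
    by (cases s) (simp_all add: fps_const_neg[symmetric])
  ultimately show ?thesis
    by (cases "\<exists>s. (x, y, s) \<in> set (a_list t rv p)")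
      (auto simp: av_def sum_list_lookup[OF distinct_a_list])
qed

section \<open>Reduction to one integral diagonal part\<close>

context
  fixes d :: int_mat
  assumes d_ok: "twist_ok t rv p d" and parity: "parity_ok (a_list t rv p) d"
    and table: "table_ok (coeff_table (a_list t rv p) d)"
begin

lemma d_anti: "look d i j = - look d j i"
  using d_ok unfolding twist_ok_def all_ix_list by blast

lemma ten_coeffs: "ten (coeffs (a_list t rv p) d) = twist (\<lambda>i k. of_int (look d i k) / 2) (core_tens (mk t))"
proof (intro ext)
  fix i k j l
  let ?L = "a_list t rv p"
  let ?q = "qpow (of_int (look d i k) / 2 + of_int (look d j l) / 2)"
  have dd: "look d i i = 0" for i
    using d_anti[of i i] by simp
  have app: "lent (M @ N) j l = lent M j l + lent N j l" for M N
    by (simp add: lent_def)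
  have 1: "qmonom (if i = k then 1 else look d i k) 0 True = ?q * (if i = k then qpow 1 else 1)" if "i = j" "k = l"
    using that dd[of j] by (auto simp: qmonom_def qpow_add[symmetric])
  have 2: "?q = 1" if "j = k" "l = i"
    using that d_anti[of i k] by simp
  have 3: "lent (concat (map (\<lambda>(x, (j, l), s). if x = (i, k)
      then [(j, l, (sg s * eps2 ?L (i, k) (j, l) + look d i k + look d j l) div 2, 1, s)] else []) M)) j l =
      ?q * (qhat * (\<Sum>(x', y', s)\<leftarrow>M. if x' = (i, k) \<and> y' = (j, l)
        then sg s * qpow (sg s * of_int (eps2 ?L (i, k) (j, l)) / 2) else 0))" if "set M \<subseteq> set ?L" for M
    using that
  proof (induction M)
    case (Cons z M)
    obtain x' j' l' s where z: "z = (x', (j', l'), s)" by (cases z) auto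
    have "qmonom ((sg s * eps2 ?L (i, k) (j, l) + look d i k + look d j l) div 2) 1 s =
      ?q * (qhat * (sg s * qpow (sg s * of_int (eps2 ?L (i, k) (j, l)) / 2)))" if "x' = (i, k)" "j' = j" "l' = l"
    proof -
      let ?e = "sg s * eps2 ?L (i, k) (j, l) + look d i k + look d j l"
      have "even ?e"
        using parity Cons.prems that by (auto simp: parity_ok_def list_all_iff z)
      hence "2 * of_int (?e div 2) = (of_int ?e :: complex)"
        by (metis dvd_mult_div_cancel of_int_mult of_int_numeral)
      hence "of_int (?e div 2) = (of_int ?e :: complex) / 2"
        by (metis nonzero_mult_div_cancel_left zero_neq_numeral)
      hence "of_int (?e div 2) = of_int (look d i k) / 2 + of_int (look d j l) / 2 + sg s * (of_int (eps2 ?L (i, k) (j, l)) :: complex) / 2"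
        by (simp add: add_divide_distrib)
      thus ?thesis
        by (cases s) (simp_all add: qmonom_def qpow_add qpow_diff)
    qed
    thus ?case
      using Cons by (auto simp: z app distrib_left)
  qed simp
  have "lent (coeffs ?L d i k) j l = (if i = j \<and> k = l then qmonom (if i = k then 1 else look d i k) 0 True else 0) +
      ((if j = k \<and> l = i \<and> nat_ix k < nat_ix i then qmonom 0 1 True else 0) +
       ?q * (qhat * entp (a_tilde (mk t)) (i, k) (j, l)))"
    unfolding coeffs_def entp_a_tilde by (simp add: app 3[OF order_refl] set_roots)
  also have "\<dots> = ?q * core_tens (mk t) i k j l"
  proof -
    have A: "(if i = j \<and> k = l then qmonom (if i = k then 1 else look d i k) 0 True else 0) =
        ?q * (if i = j \<and> k = l then (if i = k then qpow 1 else 1) else 0)"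
    proof (cases "i = j \<and> k = l")
      case True
      thus ?thesis using 1 by (simp only: simp_thms if_True)
    next
      case False
      thus ?thesis by (simp only: if_False mult_zero_right)
    qed
    have B: "(if j = k \<and> l = i \<and> nat_ix k < nat_ix i then qmonom 0 1 True else 0) =
        ?q * (qhat * (if j = k \<and> l = i \<and> nat_ix k < nat_ix i then 1 else 0))"
    proof (cases "j = k \<and> l = i \<and> nat_ix k < nat_ix i")
      case True
      thus ?thesis using 2 by (simp only: if_True qmonom_def) simp
    next
      case False
      thus ?thesis by (simp only: if_False mult_zero_right)
    qed
    show ?thesis
      unfolding A B core_tens_def std_tens_def by (simp only: distrib_left add.assoc fst_conv snd_conv)
  qed
  finally show "lent (coeffs ?L d i k) j l = twist (\<lambda>i k. of_int (look d i k) / 2) (core_tens (mk t)) i k j l"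
    by (simp add: twist_def)
qed

text \<open>Let u(i) = g(p i) - g(i), or -g(p i) - g(i) if \<tau> reverses the order. Each simple
  root in the domain says that u agrees at two neighbouring indices, so u is constant along the
  support of any root in the span of the domain.\<close>

lemma root_functional:
  fixes g :: "ix \<Rightarrow> complex"
  assumes simple: "\<And>i j b e. (i, j) \<in> set roots \<Longrightarrow> nat_ix j = Suc (nat_ix i) \<Longrightarrow>
      step t rv p (i, j) = Some (b, e) \<Longrightarrow> g b - g e = g i - g j"
    and root: "(i, j) \<in> set roots" and step: "step t rv p (i, j) = Some (b, e)"
  shows "g b - g e = g i - g j"
proof -
  define u where "u i = (if rv then - g (sel p i) else g (sel p i)) - g i" for i
  have u: "u i = u j" if "(i, j) \<in> set roots" "nat_ix j = Suc (nat_ix i)" "supported t (i, j)" for i j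
    using simple[OF that(1,2)] that(3) by (auto simp: step_def u_def algebra_simps split: if_splits)
  have "t ! 0 \<noteq> 0 \<Longrightarrow> u I1 = u I2" "t ! 1 \<noteq> 0 \<Longrightarrow> u I2 = u I3"
    "t ! 2 \<noteq> 0 \<Longrightarrow> u I3 = u I4" "t ! 3 \<noteq> 0 \<Longrightarrow> u I4 = u I5"
    by (rule u; simp add: set_roots supported_def)+
  moreover have "supported t (i, j)"
    using step by (auto simp: step_def split: if_splits)
  ultimately have "u i = u j"
    using root by (cases i; cases j; simp add: set_roots supported_def)
  thus ?thesis
    using step by (auto simp: u_def step_def algebra_simps split: if_splits)
qed

lemma iter_functional:
  fixes g :: "ix \<Rightarrow> complex"
  assumes simple: "\<And>i j b e. (i, j) \<in> set roots \<Longrightarrow> nat_ix j = Suc (nat_ix i) \<Longrightarrow>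
      step t rv p (i, j) = Some (b, e) \<Longrightarrow> g b - g e = g i - g j"
    and root: "\<alpha> \<in> set roots"
  shows "iter t rv p n \<alpha> = Some (\<beta>, s) \<Longrightarrow> g (fst \<beta>) - g (snd \<beta>) = g (fst \<alpha>) - g (snd \<alpha>)"
proof (induction n arbitrary: \<beta> s)
  case (Suc n)
  then obtain \<gamma> s' where \<gamma>: "iter t rv p n \<alpha> = Some (\<gamma>, s')" "step t rv p \<gamma> = Some \<beta>"
    by (auto split: option.splits)
  have "g (fst \<beta>) - g (snd \<beta>) = g (fst \<gamma>) - g (snd \<gamma>)"
    using root_functional[of g "fst \<gamma>" "snd \<gamma>" "fst \<beta>" "snd \<beta>"] simple iter_root[OF ok root \<gamma>(1)] \<gamma>(2)
    by simp
  thus ?case using Suc.IH[OF \<gamma>(1)] by simp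
qed simp

text \<open>Diagonal and flipped entries conserve any weight. An entry of a comes from a link
  \<alpha>, \<beta>, and there conservation says that g takes the same value on both roots.\<close>

lemma core_weight:
  fixes g :: "ix \<Rightarrow> complex"
  assumes simple: "\<And>i j b e. (i, j) \<in> set roots \<Longrightarrow> nat_ix j = Suc (nat_ix i) \<Longrightarrow>
      step t rv p (i, j) = Some (b, e) \<Longrightarrow> g b - g e = g i - g j"
    and nz: "core_tens (mk t) i k j l \<noteq> 0"
  shows "g i + g k = g j + g l"
proof (cases "i = j \<and> k = l \<or> j = k \<and> l = i")
  case False
  hence "entp (a_tilde (mk t)) (i, k) (j, l) \<noteq> 0"
    using nz by (auto simp: core_tens_def std_tens_def)
  hence "\<exists>s. ((i, k), (j, l), s) \<in> set (a_list t rv p)"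
    unfolding entp_a_tilde by (rule contrapos_np) (rule sum_list_lookup(2)[OF distinct_a_list])
  then obtain \<alpha> \<beta> s where l: "(\<alpha>, \<beta>, s) \<in> set (links t rv p)"
    and e: "(i = snd \<alpha> \<and> k = fst \<beta> \<and> j = fst \<alpha> \<and> l = snd \<beta>) \<or> (i = fst \<beta> \<and> k = snd \<alpha> \<and> j = snd \<beta> \<and> l = fst \<alpha>)"
    unfolding a_list_def by fastforce
  have "g (fst \<beta>) - g (snd \<beta>) = g (fst \<alpha>) - g (snd \<alpha>)"
    using l unfolding set_links[OF ok] using iter_functional[of g \<alpha>] simple by blast
  thus ?thesis
    using e by (auto simp: algebra_simps)
qed auto

text \<open>The diagonal parts c and d/2 solve the same inhomogeneous equations on simple roots.
  Their difference s therefore solves the homogeneous ones, which for each fixed m make x -> s(x, m)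
  a conserved weight in the sense of \<open>core_weight\<close>.\<close>

lemma ggs_sound:
  assumes diag: "is_diag (r_tilde r0) c" and anti: "\<And>i j. c i j = - c j i"
    and adm: "\<And>i j b e m. (i, j) \<in> set roots \<Longrightarrow> nat_ix j = Suc (nat_ix i) \<Longrightarrow>
      step t rv p (i, j) = Some (b, e) \<Longrightarrow>
      2 * (c b m - c e m - c i m + c j m) =
       (if m = e then 1 else 0) + (if m = j then 1 else 0) - (if m = b then 1 else 0) - (if m = i then 1 else 0)"
  shows "QYBE (R_GGS (mk t) r0)" "Hecke (R_GGS (mk t) r0)"
proof -
  let ?R = "ten (coeffs (a_list t rv p) d)"
  define s where "s i k = c i k - of_int (look d i k) / 2" for i k
  have s_anti: "s i k = - s k i" for i k
    using anti[of i k] d_anti[of i k] by (simp add: s_def)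
  have "ent (R_GGS (mk t) r0) = twist c (core_tens (mk t))"
    by (rule ent_R_GGS[OF diag])
  also have "\<dots> = twist s ?R"
    unfolding ten_coeffs by (intro ext) (simp add: twist_def s_def mult.assoc[symmetric] qpow_add[symmetric])
  finally have R: "ent (R_GGS (mk t) r0) = twist s ?R" .
  have look: "look (coeff_table L d) = coeffs L d" for L
    by (intro ext) (simp add: look_def coeff_table_def)
  have R_ok: "ybe ?R" "hecke ?R"
    using table ybe_check_sound hecke_check_sound unfolding table_ok_def look by blast+
  have weight: "s i m + s k m = s j m + s l m" if "?R i k j l \<noteq> 0" for i k j l m
  proof (rule core_weight[where g = "\<lambda>x. s x m"])
    have "?R i k j l = twist (\<lambda>i k. of_int (look d i k) / 2) (core_tens (mk t)) i k j l"
      by (rule fun_cong[OF fun_cong[OF fun_cong[OF fun_cong[OF ten_coeffs]]]])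
    hence zero: "core_tens (mk t) i k j l = 0 \<Longrightarrow> ?R i k j l = 0"
      by (simp only: twist_def mult_zero_right)
    show "core_tens (mk t) i k j l \<noteq> 0"
      using that by (rule contrapos_nn) (rule zero)
  next
    fix i j b e assume r: "(i, j) \<in> set roots" "nat_ix j = Suc (nat_ix i)" "step t rv p (i, j) = Some (b, e)"
    have "twist_eq t rv p d (i, j)"
      using d_ok r(1) by (simp add: twist_ok_def list_all_iff)
    hence "look d b m - look d e m - look d i m + look d j m =
          (if m = e then 1 else 0) + (if m = j then 1 else 0) - (if m = b then 1 else 0) - (if m = i then 1 else 0)"
      using r(2,3) by (simp only: twist_eq_def prod.case option.case all_ix_list simp_thms)
    hence "(of_int (look d b m) - of_int (look d e m) - of_int (look d i m) + of_int (look d j m) :: complex) =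
          of_int ((if m = e then 1 else 0) + (if m = j then 1 else 0) - (if m = b then 1 else 0) - (if m = i then 1 else 0))"
      by (metis of_int_add of_int_diff)
    also have "\<dots> = (if m = e then 1 else 0) + (if m = j then 1 else 0) - (if m = b then 1 else 0) - (if m = i then 1 else 0)"
      by simp
    also have "\<dots> = 2 * (c b m - c e m - c i m + c j m)"
      using adm[OF r] by simp
    finally show "s b m - s e m = s i m - s j m"
      unfolding s_def by (simp add: field_simps) algebra
  qed
  show "QYBE (R_GGS (mk t) r0)"
    unfolding QYBE_ybe R by (rule ybe_twist[OF s_anti weight R_ok(1)])
  show "Hecke (R_GGS (mk t) r0)"
    unfolding Hecke_hecke R by (rule hecke_twist[of s, OF s_anti R_ok(2)])
qed

end

end

section \<open>The Belavin-Drinfeld triples\<close>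

fun skew :: "int list \<Rightarrow> int_mat"
  where
    "skew [a, b, c, d, e, f, g, h, i, j] = Five (Five 0 a b c d) (Five (- a) 0 e f g)
      (Five (- b) (- e) 0 h i) (Five (- c) (- f) (- h) 0 j) (Five (- d) (- g) (- i) (- j) 0)"
  | "skew _ = Five (Five 0 0 0 0 0) (Five 0 0 0 0 0) (Five 0 0 0 0 0) (Five 0 0 0 0 0) (Five 0 0 0 0 0)"

text \<open>
  Each row consists of the values of \<open>\<tau>\<close>, the order reversal flag and the permutation that describe
  \<open>\<tau>\<close> on \<open>\<gg>\<^sub>1\<close>, and the upper triangle of \<open>2 d\<close> for an antisymmetric \<open>d\<close> that satisfies the
  admissibility equations over \<open>\<gg>\<ll>(5)\<close> and makes all entries of \<open>q\<^sup>d (R\<^sub>s + (q - q\<^sup>-\<^sup>1) a) q\<^sup>d\<close> Laurent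
  polynomials in \<open>q\<close>.
\<close>

definition bd_table :: "(nat list \<times> bool \<times> ix five \<times> int list) list"
  where "bd_table = [
    ([0, 0, 0, 0], False, Five I1 I2 I3 I4 I5, [0, 0, 0, 0, 0, 0, 0, 0, 0, 0]),
    ([2, 0, 0, 0], False, Five I2 I3 I1 I4 I5, [1, 1, 0, - 1, 1, 0, 0, 0, 1, 0]),
    ([3, 0, 0, 0], False, Five I3 I4 I1 I2 I5, [0, 1, 0, 1, 0, 1, 1, 0, 0, 0]),
    ([4, 0, 0, 0], False, Five I4 I5 I1 I2 I3, [0, - 1, 1, 0, - 1, 0, 1, 0, 0, 0]),
    ([0, 1, 0, 0], False, Five I3 I1 I2 I4 I5, [- 1, - 1, 0, 1, - 1, 0, 0, 0, - 1, 0]),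
    ([0, 3, 0, 0], False, Five I1 I3 I4 I2 I5, [0, 0, 0, 0, 1, 1, 0, 1, 0, 0]),
    ([0, 4, 0, 0], False, Five I1 I4 I5 I2 I3, [0, 0, 1, 1, 0, 1, 0, 0, 1, 0]),
    ([0, 0, 1, 0], False, Five I3 I4 I1 I2 I5, [0, - 1, 0, - 1, 0, - 1, - 1, 0, 0, 0]),
    ([0, 0, 2, 0], False, Five I1 I4 I2 I3 I5, [0, 0, 0, 0, - 1, - 1, 0, - 1, 0, 0]),
    ([0, 0, 4, 0], False, Five I1 I2 I4 I5 I3, [0, 1, 0, - 1, 0, 0, 0, 1, 1, 1]),
    ([0, 0, 0, 1], False, Five I3 I4 I5 I1 I2, [0, 1, - 1, 0, 1, 0, - 1, 0, 0, 0]),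
    ([0, 0, 0, 2], False, Five I1 I4 I5 I2 I3, [0, 0, - 1, - 1, 0, - 1, 0, 0, - 1, 0]),
    ([0, 0, 0, 3], False, Five I1 I2 I5 I3 I4, [0, - 1, 0, 1, 0, 0, 0, - 1, - 1, - 1]),
    ([2, 3, 0, 0], False, Five I2 I3 I4 I1 I5, [1, 1, 1, 0, 1, 1, 0, 1, 0, 0]),
    ([3, 4, 0, 0], False, Five I3 I4 I5 I1 I2, [0, 1, 0, 1, 0, 1, 0, 0, 1, 0]),
    ([4, 3, 0, 0], True, Five I5 I4 I3 I1 I2, [0, 0, 0, - 1, 0, - 1, 0, 0, 0, 0]),
    ([2, 0, 4, 0], False, Five I2 I3 I4 I5 I1, [0, - 1, 0, 1, 0, 0, 0, 0, - 1, 0]),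
    ([4, 0, 1, 0], False, Five I4 I5 I1 I2 I3, [0, - 1, 0, - 1, 0, - 1, 0, 0, - 1, 0]),
    ([4, 0, 2, 0], False, Five I4 I5 I2 I3 I1, [0, 0, 0, - 1, - 1, - 1, 0, - 1, 0, 0]),
    ([3, 0, 0, 1], False, Five I3 I4 I5 I1 I2, [0, 1, 0, 1, 0, 1, 0, 0, 1, 0]),
    ([4, 0, 0, 2], False, Five I4 I5 I1 I2 I3, [0, - 1, 0, - 1, 0, - 1, 0, 0, - 1, 0]),
    ([0, 1, 2, 0], False, Five I4 I1 I2 I3 I5, [- 1, - 1, - 1, 0, - 1, - 1, 0, - 1, 0, 0]),
    ([0, 3, 4, 0], False, Five I1 I3 I4 I5 I2, [0, 0, 0, 0, 1, 1, 1, 1, 1, 1]),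
    ([0, 1, 0, 3], False, Five I5 I1 I2 I3 I4, [0, 1, 0, - 1, 0, 0, 0, 0, 1, 0]),
    ([0, 3, 0, 1], False, Five I5 I3 I4 I1 I2, [0, 0, 0, 1, 1, 1, 0, 1, 0, 0]),
    ([0, 4, 0, 1], False, Five I3 I4 I5 I1 I2, [0, 1, 0, 1, 0, 1, 0, 0, 1, 0]),
    ([0, 0, 1, 2], False, Five I4 I5 I1 I2 I3, [0, - 1, 0, - 1, 0, - 1, 0, 0, - 1, 0]),
    ([0, 0, 2, 1], True, Five I4 I5 I3 I2 I1, [0, 0, 0, 1, 0, 1, 0, 0, 0, 0]),
    ([0, 0, 2, 3], False, Five I1 I5 I2 I3 I4, [0, 0, 0, 0, - 1, - 1, - 1, - 1, - 1, - 1]),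
    ([2, 3, 4, 0], False, Five I2 I3 I4 I5 I1, [1, 1, 1, 1, 1, 1, 1, 1, 1, 1]),
    ([3, 4, 0, 1], False, Five I3 I4 I5 I1 I2, [0, 1, 0, 1, 0, 1, 0, 0, 1, 0]),
    ([4, 0, 1, 2], False, Five I4 I5 I1 I2 I3, [0, - 1, 0, - 1, 0, - 1, 0, 0, - 1, 0]),
    ([0, 1, 2, 3], False, Five I5 I1 I2 I3 I4, [- 1, - 1, - 1, - 1, - 1, - 1, - 1, - 1, - 1, - 1])]"

definition row_ok :: "nat list \<times> bool \<times> ix five \<times> int list \<Rightarrow> bool"
  where "row_ok = (\<lambda>(t, rv, p, v). triple_ok t rv p \<and> twist_ok t rv p (skew v) \<and>
     parity_ok (a_list t rv p) (skew v) \<and> table_ok (coeff_table (a_list t rv p) (skew v)))"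

text \<open>For each row of the table, the evaluation covers 125 rows of the Yang-Baxter equation
  and 25 rows of the Hecke relation, by rewriting with code equations.\<close>

lemma bd_table_ok_1: "list_all row_ok (take 17 bd_table)"
  by code_simp

lemma bd_table_ok_2: "list_all row_ok (drop 17 bd_table)"
  by code_simp

lemma bd_table_ok: "list_all row_ok bd_table"
  using bd_table_ok_1 bd_table_ok_2 by (metis append_take_drop_id list_all_append)

section \<open>Classification of the triples\<close>

definition bd_lists :: "nat list list"
  where "bd_lists = map fst bd_table"

text \<open>The Cartan matrix of type A_4, an executable stand-in for traces of complex
  matrices.\<close>

definition cform :: "nat \<Rightarrow> nat \<Rightarrow> int"
  where "cform i j = (if i = j then 2 else if Suc i = j \<or> Suc j = i then - 1 else 0)"

lemma trace_E:
  assumes "i \<in> {1..5}" "j \<in> {1..5}"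
  shows "trace (E i j :: complex mat1) = (if i = j then 1 else 0)"
proof -
  have "trace (E i j :: complex mat1) = (\<Sum>r\<in>(UNIV :: 5 set). if r = of_nat i then (if (of_nat i :: 5) = of_nat j then 1 else 0) else 0)"
    unfolding trace_def E_def vec_lambda_beta by (rule sum.cong) auto
  thus ?thesis using of_nat_inj_5[OF assms] by simp
qed

lemma trace_diff: "trace (A - B) = trace A - trace (B :: complex^'n^'n)"
  by (simp add: trace_def sum_subtractf)

lemma matrix_mult_diff:
  fixes A B C :: "complex^'n^'n"
  shows "(A - B) ** C = A ** C - B ** C" "C ** (A - B) = C ** A - C ** B"
  by (simp_all add: matrix_matrix_mult_def vec_eq_iff algebra_simps sum_subtractf)

lemma root_form_cform:
  assumes "i \<in> {1..4}" "j \<in> {1..4}"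
  shows "root_form i j = of_int (cform i j)"
proof -
  have *: "trace (E a a ** E b b :: complex mat1) = (if a = b then 1 else 0)" if "a \<in> {1..5}" "b \<in> {1..5}" for a b
    using that by (simp add: E_mult trace_E del: atLeastAtMost_iff) (simp add: trace_def)
  have "root_form i j = trace (E i i ** E j j) - trace (E i i ** E (Suc j) (Suc j)) -
      (trace (E (Suc i) (Suc i) ** E j j) - trace (E (Suc i) (Suc i) ** E (Suc j) (Suc j)))"
    by (simp add: root_form_def H_def matrix_mult_diff trace_diff)
  thus ?thesis
    using assms by (auto simp: * cform_def)
qed

definition form_ok :: "nat list \<Rightarrow> bool"
  where "form_ok t \<longleftrightarrow> list_all (\<lambda>i. list_all (\<lambda>j.
     t ! (i - 1) \<noteq> 0 \<and> t ! (j - 1) \<noteq> 0 \<longrightarrow> cform (t ! (i - 1)) (t ! (j - 1)) = cform i j) [1, 2, 3, 4]) [1, 2, 3, 4]"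

definition no_short_cycle :: "nat list \<Rightarrow> bool"
  where "no_short_cycle t \<longleftrightarrow> list_all (\<lambda>i. t ! (i - 1) \<noteq> 0 \<longrightarrow>
     t ! (i - 1) \<noteq> i \<and> t ! (t ! (i - 1) - 1) \<noteq> i) [1, 2, 3, 4]"

text \<open>Isometries of subsets of the diagram that have no cycle of length one or two have no cycle at all.\<close>

lemma bd_lists_complete_check:
  "list_all (\<lambda>t. form_ok t \<and> no_short_cycle t \<longrightarrow> t \<in> set bd_lists) (List.n_lists 4 [0, 1, 2, 3, 4])"
  by code_simp

text \<open>A total version of the partial iterate: 0 encodes undefined and is absorbing.\<close>

fun nat_iter :: "nat list \<Rightarrow> nat \<Rightarrow> nat \<Rightarrow> nat"
  where
    "nat_iter t 0 i = i"
  | "nat_iter t (Suc k) i = (if nat_iter t k i = 0 then 0 else t ! (nat_iter t k i - 1))"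

text \<open>On four nodes a chain without repetition has at most three arrows, so \<tau>^(k+1)
  \<alpha> leaves the domain for some k among 0, 1, 2.\<close>

definition leaves :: "nat list \<Rightarrow> bool"
  where "leaves t \<longleftrightarrow> list_all (\<lambda>i. t ! (i - 1) \<noteq> 0 \<longrightarrow>
     list_ex (\<lambda>k. nat_iter t (Suc k) i \<noteq> 0 \<and> t ! (nat_iter t (Suc k) i - 1) = 0) [0, 1, 2]) [1, 2, 3, 4]"

definition inv_list :: "nat list \<Rightarrow> nat list"
  where "inv_list t = map (\<lambda>j. case filter (\<lambda>i. t ! (i - 1) = j) [1, 2, 3, 4] of [] \<Rightarrow> 0 | i # _ \<Rightarrow> i) [1, 2, 3, 4]"

definition sigma_list :: "nat list \<Rightarrow> nat list"
  where "sigma_list t = map (\<lambda>x. if x = 0 then 0 else 5 - x) (rev t)"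

definition inv_ok :: "nat list \<Rightarrow> bool"
  where "inv_ok t \<longleftrightarrow> list_all (\<lambda>i. list_all (\<lambda>j. (inv_list t ! (j - 1) = i) = (t ! (i - 1) = j)) [1, 2, 3, 4]) [1, 2, 3, 4]"

definition orbit_list :: "nat list \<Rightarrow> nat list list"
  where "orbit_list t = [t, inv_list t, sigma_list t, inv_list (sigma_list t)]"

definition rep_lists :: "nat list list"
  where "rep_lists = [[0, 1, 2, 3], [4, 0, 1, 2], [0, 0, 1, 2], [0, 0, 2, 1], [0, 1, 0, 3], [0, 3, 0, 1],
    [4, 0, 1, 0], [0, 1, 2, 0], [2, 0, 0, 0], [3, 0, 0, 0], [4, 0, 0, 0], [0, 3, 0, 0], [0, 0, 0, 0]]"

text \<open>Gathers what is decided by evaluation on the encoded triples. The last two conjuncts say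
  that an orbit contains exactly one representative and that each of its members has the same
  orbit.\<close>

definition list_ok :: "nat list \<Rightarrow> bool"
  where "list_ok t \<longleftrightarrow> length t = 4 \<and> list_all (\<lambda>x. x \<le> 4) t \<and> form_ok t \<and> leaves t \<and> inv_ok t \<and>
     inv_list t \<in> set bd_lists \<and> sigma_list t \<in> set bd_lists \<and>
     inv_list (inv_list t) = t \<and> sigma_list (sigma_list t) = t \<and>
     inv_list (sigma_list t) = sigma_list (inv_list t) \<and>
     length (filter (\<lambda>r. r \<in> set (orbit_list t)) rep_lists) = 1 \<and>
     list_all (\<lambda>r. list_all (\<lambda>x. x \<in> set (orbit_list t)) (orbit_list r) \<and>
        list_all (\<lambda>x. x \<in> set (orbit_list r)) (orbit_list t)) (orbit_list t)"

lemma bd_lists_check: "list_all list_ok bd_lists"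
  by code_simp

lemma rep_lists_check: "list_all (\<lambda>t. t \<in> set bd_lists) rep_lists \<and> distinct rep_lists"
  by code_simp

lemma fold_14: "list_all P [1, 2, 3, 4] \<longleftrightarrow> (\<forall>i\<in>{1..4::nat}. P i)"
proof -
  have "{1..4::nat} = set [1, 2, 3, 4]" by auto
  thus ?thesis by (simp only: list_all_iff)
qed

lemma list_okD:
  assumes "list_ok t"
  shows "length t = 4" "k \<in> {1..4} \<Longrightarrow> t ! (k - 1) \<le> 4"
    "i \<in> {1..4} \<Longrightarrow> j \<in> {1..4} \<Longrightarrow> t ! (i - 1) \<noteq> 0 \<Longrightarrow> t ! (j - 1) \<noteq> 0 \<Longrightarrow>
      cform (t ! (i - 1)) (t ! (j - 1)) = cform i j"
    "i \<in> {1..4} \<Longrightarrow> j \<in> {1..4} \<Longrightarrow> inv_list t ! (j - 1) = i \<longleftrightarrow> t ! (i - 1) = j"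
    "i \<in> {1..4} \<Longrightarrow> t ! (i - 1) \<noteq> 0 \<Longrightarrow> \<exists>k. nat_iter t (Suc k) i \<noteq> 0 \<and> t ! (nat_iter t (Suc k) i - 1) = 0"
proof -
  show l: "length t = 4" using assms by (simp add: list_ok_def)
  show "k \<in> {1..4} \<Longrightarrow> t ! (k - 1) \<le> 4"
  proof -
    have "\<forall>x\<in>set t. x \<le> 4"
      using assms unfolding list_ok_def list_all_iff by blast
    thus "k \<in> {1..4} \<Longrightarrow> t ! (k - 1) \<le> 4" using l by auto
  qed
  show "i \<in> {1..4} \<Longrightarrow> j \<in> {1..4} \<Longrightarrow> t ! (i - 1) \<noteq> 0 \<Longrightarrow> t ! (j - 1) \<noteq> 0 \<Longrightarrow>
      cform (t ! (i - 1)) (t ! (j - 1)) = cform i j"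
    using assms unfolding list_ok_def form_ok_def fold_14 by blast
  show "i \<in> {1..4} \<Longrightarrow> j \<in> {1..4} \<Longrightarrow> inv_list t ! (j - 1) = i \<longleftrightarrow> t ! (i - 1) = j"
    using assms unfolding list_ok_def inv_ok_def fold_14 by blast
  show "i \<in> {1..4} \<Longrightarrow> t ! (i - 1) \<noteq> 0 \<Longrightarrow> \<exists>k. nat_iter t (Suc k) i \<noteq> 0 \<and> t ! (nat_iter t (Suc k) i - 1) = 0"
    using assms unfolding list_ok_def leaves_def fold_14 list_ex_iff by blast
qed

lemma list_ok_closed:
  assumes "list_ok t"
  shows "inv_list t \<in> set bd_lists" "sigma_list t \<in> set bd_lists" "inv_list (inv_list t) = t"
    "sigma_list (sigma_list t) = t" "inv_list (sigma_list t) = sigma_list (inv_list t)"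
    "length (filter (\<lambda>r. r \<in> set (orbit_list t)) rep_lists) = 1"
    "r \<in> set (orbit_list t) \<Longrightarrow> set (orbit_list r) = set (orbit_list t)"
  using assms unfolding list_ok_def list_all_iff by blast+

lemma list_ok_tau_Some:
  "list_ok t \<Longrightarrow> tau t k = Some l \<longleftrightarrow> k \<in> {1..4} \<and> l \<in> {1..4} \<and> t ! (k - 1) = l"
  using list_okD(2)[of t k] by (auto simp: tau_def)

lemma bd_lists_ok: "t \<in> set bd_lists \<Longrightarrow> list_ok t"
  using bd_lists_check by (simp add: list_all_iff)

text \<open>This makes an isometry injective: simple roots with equal images have product 2, hence
  are equal.\<close>

lemma cform_2: "cform i j = 2 \<longleftrightarrow> i = j"
  by (simp add: cform_def)

lemma pmap_pow_tau:
  assumes "list_ok t" "i \<in> {1..4}"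
  shows "pmap_pow (tau t) k i = (if nat_iter t k i = 0 then None else Some (nat_iter t k i)) \<and> nat_iter t k i \<le> 4"
proof (induction k)
  case (Suc k)
  show ?case
    using Suc list_okD(2)[OF assms(1), of "nat_iter t k i"] by (auto simp: map_comp_def tau_def)
qed (use assms in auto)

lemma ran_tau: "ran (tau t) = (\<lambda>i. the (tau t i)) ` dom (tau t)"
  by (force simp: ran_def dom_def image_iff)

lemma bd_triple_mk:
  assumes "list_ok t" shows "bd_triple (mk t)"
proof -
  note S = list_ok_tau_Some[OF assms]
  have the: "the (tau t i) = t ! (i - 1)" "i \<in> {1..4}" "t ! (i - 1) \<noteq> 0" "t ! (i - 1) \<in> {1..4}"
    if dom: "i \<in> dom (tau t)" for i
  proof -
    obtain l where "tau t i = Some l" using domD[OF dom] by blast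
    thus "the (tau t i) = t ! (i - 1)" "i \<in> {1..4}" "t ! (i - 1) \<noteq> 0" "t ! (i - 1) \<in> {1..4}"
      using S[of i l] by auto
  qed
  have "inj_on (\<lambda>i. the (tau t i)) (dom (tau t))"
  proof (rule inj_onI)
    fix i j assume "i \<in> dom (tau t)" "j \<in> dom (tau t)" "the (tau t i) = the (tau t j)"
    thus "i = j"
      using the[of i] the[of j] list_okD(3)[OF assms, of i j] cform_2 by metis
  qed
  moreover have "root_form (the (tau t i)) (the (tau t j)) = root_form i j" if "i \<in> dom (tau t)" "j \<in> dom (tau t)" for i j
    using the[OF that(1)] the[OF that(2)] list_okD(3)[OF assms, of i j] by (simp add: root_form_cform del: atLeastAtMost_iff)
  moreover have "\<exists>k \<beta> \<gamma>. pmap_pow (tau t) k i = Some \<beta> \<and> \<beta> \<in> dom (tau t) \<and>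
      pmap_pow (tau t) (Suc k) i = Some \<gamma> \<and> \<gamma> \<notin> dom (tau t)" if i: "i \<in> dom (tau t)" for i
  proof -
    obtain k where k: "nat_iter t (Suc k) i \<noteq> 0" "t ! (nat_iter t (Suc k) i - 1) = 0"
      using list_okD(5)[OF assms the(2,3)[OF i]] by blast
    have 1: "pmap_pow (tau t) (Suc k) i = Some (nat_iter t (Suc k) i)"
      using pmap_pow_tau[OF assms the(2)[OF i], of "Suc k"] k(1) by (simp only: if_False)
    moreover have "nat_iter t (Suc k) i \<notin> dom (tau t)"
      using k(2) the(3) by blast
    moreover obtain \<beta> where "pmap_pow (tau t) k i = Some \<beta>" "tau t \<beta> = Some (nat_iter t (Suc k) i)"
      using 1 by (auto simp: map_comp_def split: option.splits)
    ultimately show ?thesis by blast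
  qed
  moreover have "dom (tau t) \<subseteq> {1..4}" "ran (tau t) \<subseteq> {1..4}"
    using the(2) apply blast
    unfolding ran_tau image_subset_iff using the(1,4) by metis
  ultimately show ?thesis
    unfolding mk_def by (simp add: bij_betw_def ran_tau)
qed

text \<open>A set mapped into itself is never left; for a cycle inside the domain this contradicts
  the last condition on a triple.\<close>

lemma pmap_pow_invariant:
  assumes "\<And>x. x \<in> C \<Longrightarrow> \<exists>y\<in>C. f x = Some y" "a \<in> C"
  shows "\<exists>y\<in>C. pmap_pow f k a = Some y"
proof (induction k)
  case (Suc k)
  thus ?case using assms(1) by (auto simp: map_comp_def)
qed (use assms in auto)

text \<open>The list of values of \<tau> is one of the 5^4 enumerated lists. The isometry condition
  gives \<open>form_ok\<close>, and a fixed point or a cycle of length two would be an invariant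
  subset of \<Gamma>1, so \<open>no_short_cycle\<close> holds as well.\<close>

lemma bd_triple_cases:
  assumes "bd_triple T"
  obtains t where "t \<in> set bd_lists" "T = mk t"
proof -
  obtain \<tau> \<Gamma>1 \<Gamma>2 where T: "T = (\<tau>, \<Gamma>1, \<Gamma>2)" by (rule prod_cases3)
  have sub: "\<Gamma>1 \<subseteq> {1..4}" "\<Gamma>2 \<subseteq> {1..4}" and dom: "dom \<tau> = \<Gamma>1"
    and bij: "bij_betw (\<lambda>i. the (\<tau> i)) \<Gamma>1 \<Gamma>2"
    and form: "\<And>i j. i \<in> \<Gamma>1 \<Longrightarrow> j \<in> \<Gamma>1 \<Longrightarrow> root_form (the (\<tau> i)) (the (\<tau> j)) = root_form i j"
    and leave: "\<And>i. i \<in> \<Gamma>1 \<Longrightarrow> \<exists>k \<beta> \<gamma>. pmap_pow \<tau> k i = Some \<beta> \<and> \<beta> \<in> \<Gamma>1 \<and>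
                      pmap_pow \<tau> (Suc k) i = Some \<gamma> \<and> \<gamma> \<notin> \<Gamma>1"
    using assms unfolding T bd_triple.simps by blast+
  define t where "t = map (\<lambda>i. case \<tau> i of None \<Rightarrow> 0 | Some j \<Rightarrow> j) [1, 2, 3, 4]"
  have nth: "t ! (i - 1) = (case \<tau> i of None \<Rightarrow> 0 | Some j \<Rightarrow> j)" if "i \<in> {1..4}" for i
  proof -
    have "i = 1 \<or> i = 2 \<or> i = 3 \<or> i = 4" using that by auto
    thus ?thesis by (auto simp: t_def)
  qed
  have ranD: "i \<in> \<Gamma>1" "i \<in> {1..4}" "j \<in> {1..4}" "j \<noteq> 0" if "\<tau> i = Some j" for i j
  proof -
    show 1: "i \<in> \<Gamma>1" using that dom by auto
    thus "i \<in> {1..4}" using sub by auto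
    have "j \<in> \<Gamma>2" using bij_betw_apply[OF bij 1] that by simp
    thus "j \<in> {1..4}" "j \<noteq> 0" using sub by auto
  qed
  have tau: "tau t = \<tau>"
  proof
    fix i show "tau t i = \<tau> i"
      using nth[of i] ranD[of i] by (cases "\<tau> i") (auto simp: tau_def)
  qed
  have "ran \<tau> = \<Gamma>2"
    using bij dom ran_tau[of t] unfolding tau by (simp add: bij_betw_def)
  hence "T = mk t"
    by (simp add: mk_def tau T dom)
  moreover have "t \<in> set bd_lists"
  proof -
    have nz: "i \<in> \<Gamma>1 \<and> the (\<tau> i) = t ! (i - 1) \<and> \<tau> i = Some (t ! (i - 1)) \<and> t ! (i - 1) \<in> {1..4}"
      if "i \<in> {1..4}" "t ! (i - 1) \<noteq> 0" for i
      using nth[OF that(1)] that(2) ranD[of i] by (auto split: option.splits)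
    have "form_ok t"
      unfolding form_ok_def fold_14
    proof (intro ballI impI)
      fix i j :: nat assume ij: "i \<in> {1..4}" "j \<in> {1..4}" "t ! (i - 1) \<noteq> 0 \<and> t ! (j - 1) \<noteq> 0"
      hence "(of_int (cform (t ! (i - 1)) (t ! (j - 1))) :: complex) = of_int (cform i j)"
        using form[of i j] nz[of i] nz[of j] root_form_cform by metis
      thus "cform (t ! (i - 1)) (t ! (j - 1)) = cform i j" by simp
    qed
    moreover have "no_short_cycle t"
      unfolding no_short_cycle_def fold_14
    proof (intro ballI impI)
      fix i :: nat assume i: "i \<in> {1..4}" "t ! (i - 1) \<noteq> 0"
      have False if c: "C \<subseteq> \<Gamma>1" "i \<in> C" "\<And>x. x \<in> C \<Longrightarrow> \<exists>y\<in>C. \<tau> x = Some y" for C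
      proof -
        obtain k \<gamma> where k: "pmap_pow \<tau> (Suc k) i = Some \<gamma>" "\<gamma> \<notin> \<Gamma>1"
          using leave c by blast
        obtain y where "y \<in> C" "pmap_pow \<tau> (Suc k) i = Some y"
          using pmap_pow_invariant[of C \<tau> i "Suc k"] c(2,3) by blast
        thus False using k c(1) by auto
      qed
      from this[of "{i}"] this[of "{i, t ! (i - 1)}"]
      show "t ! (i - 1) \<noteq> i \<and> t ! (t ! (i - 1) - 1) \<noteq> i"
        using nz[OF i] nz[of "t ! (i - 1)"] i by (metis atLeastAtMost_iff empty_subsetI insertE insertI1 insertI2 insert_subset not_one_le_zero singletonD)
    qed
    moreover have "t \<in> set (List.n_lists 4 [0, 1, 2, 3, 4])"
    proof -
      have "t ! (i - 1) \<in> {0, 1, 2, 3, 4}" if "i \<in> {1..4}" for i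
        using nz[OF that] by (cases "t ! (i - 1) = 0") auto
      from this[of 1] this[of 2] this[of 3] this[of 4]
      show ?thesis unfolding set_n_lists by (auto simp: t_def)
    qed
    ultimately show ?thesis
      using bd_lists_complete_check by (auto simp only: list_all_iff)
  qed
  ultimately show ?thesis using that by blast
qed

lemma bd_triple_iff: "{T. bd_triple T} = mk ` set bd_lists"
  using bd_triple_cases bd_triple_mk bd_lists_ok by blast

section \<open>The group action, the representatives and the orbits\<close>

lemma bd_inv_mk:
  assumes "t \<in> set bd_lists" shows "bd_inv (mk t) = mk (inv_list t)"
proof -
  note ok = bd_lists_ok[OF assms]
  note S = list_ok_tau_Some[OF ok] list_ok_tau_Some[OF bd_lists_ok[OF list_ok_closed(1)[OF ok]]]
  have *: "tau (inv_list t) j = Some i \<longleftrightarrow> tau t i = Some j" for i j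
    unfolding S using list_okD(4)[OF ok] by blast
  have "(if j \<in> ran (tau t) then Some (THE i. tau t i = Some j) else None) = tau (inv_list t) j" for j
  proof (cases "tau (inv_list t) j")
    case None
    hence "j \<notin> ran (tau t)" using * by (force simp: ran_def)
    thus ?thesis using None by simp
  next
    case (Some i)
    hence "tau t i = Some j" using * by simp
    moreover from this have "(THE i. tau t i = Some j) = i"
      using * Some by (intro the_equality) (auto simp flip: *)
    ultimately show ?thesis using Some by (auto simp: ran_def)
  qed
  moreover have "dom (tau (inv_list t)) = ran (tau t)" "ran (tau (inv_list t)) = dom (tau t)"
    using * by (auto simp: dom_def ran_def)
  ultimately show ?thesis by (simp add: mk_def)
qed

lemma bd_sigma_mk:
  assumes "t \<in> set bd_lists" shows "bd_sigma (mk t) = mk (sigma_list t)"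
proof -
  note ok = bd_lists_ok[OF assms]
  note ok' = bd_lists_ok[OF list_ok_closed(2)[OF ok]]
  note S = list_ok_tau_Some[OF ok] list_ok_tau_Some[OF ok']
  \<comment> \<open>Position i - 1 of the reversed list is position 4 - i of t, which holds the
    value at the simple root 5 - i.\<close>
  have nth: "sigma_list t ! (i - 1) = (if t ! (4 - i) = 0 then 0 else 5 - t ! (4 - i))" if "i \<in> {1..4}" for i
  proof -
    have "4 - Suc (i - 1) = 4 - i" "i - 1 < 4" using that by auto
    thus ?thesis
      using list_okD(1)[OF ok] by (simp add: sigma_list_def rev_nth)
  qed
  have *: "tau (sigma_list t) i = Some j \<longleftrightarrow> i \<in> {1..4} \<and> j \<in> {1..4} \<and> tau t (5 - i) = Some (5 - j)" for i j
  proof (cases "i \<in> {1..4} \<and> j \<in> {1..4}")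
    case True
    have "t ! (4 - i) \<le> 4"
    proof -
      have "5 - i \<in> {1..4}" "5 - i - 1 = 4 - i" using True by auto
      thus ?thesis using list_okD(2)[OF ok, of "5 - i"] by metis
    qed
    moreover have "5 - i \<in> {1..4}" "5 - j \<in> {1..4}" "5 - i - 1 = 4 - i"
      using True by auto
    ultimately show ?thesis
      unfolding S using nth[of i] True by (simp split: if_split) auto
  qed (auto simp: S)
  have dom: "dom (tau t) \<subseteq> {1..4}" "ran (tau t) \<subseteq> {1..4}"
    using S(1) by (auto simp: dom_def ran_def)
  have mem: "i \<in> sigma ` A \<longleftrightarrow> i \<in> {1..4} \<and> 5 - i \<in> A" if "A \<subseteq> {1..4}" for i A
  proof -
    have "i = sigma (5 - i)" if "i \<in> {1..4}" using that by (auto simp: sigma_def)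
    thus ?thesis using that by (force simp: sigma_def image_iff)
  qed
  have "(if i \<in> sigma ` dom (tau t) then map_option sigma (tau t (sigma i)) else None) = tau (sigma_list t) i" for i
  proof (cases "tau (sigma_list t) i")
    case None
    have False if i: "i \<in> {1..4}" and j: "tau t (5 - i) = Some j" for j
    proof -
      have "j \<in> {1..4}" using j dom by (auto simp: ran_def)
      thus False using *[of i "5 - j"] None i j by auto
    qed
    thus ?thesis using None unfolding mem[OF dom(1)] by (auto simp: sigma_def)
  next
    case (Some j)
    hence "i \<in> {1..4}" "j \<in> {1..4}" "tau t (5 - i) = Some (5 - j)" using * by blast+
    thus ?thesis using Some unfolding mem[OF dom(1)] by (auto simp: sigma_def)
  qed
  moreover have "dom (tau (sigma_list t)) = sigma ` dom (tau t)"
  proof -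
    have "i \<in> dom (tau (sigma_list t)) \<longleftrightarrow> i \<in> {1..4} \<and> 5 - i \<in> dom (tau t)" for i
    proof
      assume "i \<in> {1..4} \<and> 5 - i \<in> dom (tau t)"
      then obtain j where j: "i \<in> {1..4}" "tau t (5 - i) = Some j" by auto
      hence "j \<in> {1..4}" using dom by (auto simp: ran_def)
      thus "i \<in> dom (tau (sigma_list t))" using *[of i "5 - j"] j by auto
    qed (use * in auto)
    thus ?thesis using mem[OF dom(1)] by blast
  qed
  moreover have "ran (tau (sigma_list t)) = sigma ` ran (tau t)"
  proof -
    have "j \<in> ran (tau (sigma_list t)) \<longleftrightarrow> j \<in> {1..4} \<and> 5 - j \<in> ran (tau t)" for j
    proof
      assume "j \<in> {1..4} \<and> 5 - j \<in> ran (tau t)"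
      then obtain i where i: "j \<in> {1..4}" "tau t i = Some (5 - j)" by (auto simp: ran_def)
      hence "i \<in> {1..4}" using dom by (auto simp: dom_def)
      thus "j \<in> ran (tau (sigma_list t))" using *[of "5 - i" j] i by (auto simp: ran_def)
    qed (use * in \<open>auto simp: ran_def\<close>)
    thus ?thesis using mem[OF dom(2)] by blast
  qed
  ultimately show ?thesis by (simp add: mk_def)
qed

lemma mk_inj: "list_ok t \<Longrightarrow> list_ok t' \<Longrightarrow> mk t = mk t' \<longleftrightarrow> t = t'"
proof
  assume ok: "list_ok t" "list_ok t'" and "mk t = mk t'"
  hence tau: "tau t = tau t'" by (simp add: mk_def)
  have "t ! n = t' ! n" if "n < 4" for n
    using fun_cong[OF tau, of "Suc n"] that by (auto simp: tau_def split: if_splits)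
  thus "t = t'"
    using list_okD(1)[OF ok(1)] list_okD(1)[OF ok(2)] by (intro nth_equalityI) auto
qed simp

lemma bd_orbit_mk:
  assumes "t \<in> set bd_lists" shows "bd_orbit (mk t) = mk ` set (orbit_list t)"
proof -
  have "sigma_list t \<in> set bd_lists"
    by (rule list_ok_closed(2)[OF bd_lists_ok[OF assms]])
  have "range (\<lambda>g. bd_act g (mk t)) = {bd_act (False, False) (mk t), bd_act (True, False) (mk t),
      bd_act (False, True) (mk t), bd_act (True, True) (mk t)}"
    by (auto simp: UNIV_bool simp flip: UNIV_Times_UNIV)
  thus ?thesis
    unfolding bd_orbit_def by (simp add: bd_act_def bd_inv_mk bd_sigma_mk assms \<open>sigma_list t \<in> set bd_lists\<close> orbit_list_def)
qed

lemma triple_of_mk: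
  assumes "\<Gamma>1 \<subseteq> {1..4}" "\<Gamma>2 = f ` \<Gamma>1" "list_all (\<lambda>i. t ! (i - 1) = (if i \<in> \<Gamma>1 then f i else 0)) [1, 2, 3, 4]" "0 \<notin> f ` \<Gamma>1"
  shows "triple_of \<Gamma>1 \<Gamma>2 f = mk t"
proof -
  have t: "t ! (i - 1) = (if i \<in> \<Gamma>1 then f i else 0)" if "i \<in> {1..4}" for i
    using assms(3) that unfolding fold_14 by blast
  have tau: "tau t = (Some \<circ> f) |` \<Gamma>1"
  proof
    fix i show "tau t i = ((Some \<circ> f) |` \<Gamma>1) i"
      using t[of i] assms(1,4) by (auto simp: tau_def restrict_map_def)
  qed
  have "dom ((Some \<circ> f) |` \<Gamma>1) = \<Gamma>1" "ran ((Some \<circ> f) |` \<Gamma>1) = \<Gamma>2"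
    using assms(2) by (auto simp: dom_def ran_def restrict_map_def)
  thus ?thesis by (simp add: triple_of_def mk_def tau)
qed

lemma reps_mk:
  "T1a = mk [0, 1, 2, 3]" "T1b = mk [4, 0, 1, 2]" "T2a = mk [0, 0, 1, 2]" "T2b = mk [0, 0, 2, 1]"
  "T2c = mk [0, 1, 0, 3]" "T2d = mk [0, 3, 0, 1]" "T2e = mk [4, 0, 1, 0]" "T2f = mk [0, 1, 2, 0]"
  "T3a = mk [2, 0, 0, 0]" "T3b = mk [3, 0, 0, 0]" "T3c = mk [4, 0, 0, 0]" "T3d = mk [0, 3, 0, 0]"
  "T4 = mk [0, 0, 0, 0]"
  unfolding T1a_def T1b_def T2a_def T2b_def T2c_def T2d_def T2e_def T2f_def T3a_def T3b_def T3c_def T3d_def T4_def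
  by (rule triple_of_mk; auto)+

lemma bd_reps_mk: "bd_reps = mk ` set rep_lists"
  by (simp add: bd_reps_def reps_mk rep_lists_def)

lemma rep_unique:
  assumes "t \<in> set bd_lists" shows "\<exists>!r. r \<in> set rep_lists \<and> r \<in> set (orbit_list t)"
proof -
  obtain r where "filter (\<lambda>r. r \<in> set (orbit_list t)) rep_lists = [r]"
    using list_ok_closed(6)[OF bd_lists_ok[OF assms]] by (auto simp: length_Suc_conv simp del: set_filter)
  from arg_cong[OF this, of set]
  have "{x \<in> set rep_lists. x \<in> set (orbit_list t)} = {r}"
    by (simp only: set_filter list.set)
  hence "\<forall>x. x \<in> set rep_lists \<and> x \<in> set (orbit_list t) \<longleftrightarrow> x = r"
    unfolding set_eq_iff mem_Collect_eq singleton_iff .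
  thus ?thesis by (simp only: ex1_eq simp_thms)
qed

lemma orbit_list_bd:
  assumes t: "t \<in> set bd_lists" and "r \<in> set (orbit_list t)"
  shows "r \<in> set bd_lists"
proof -
  note closed = list_ok_closed(1,2)[OF bd_lists_ok[OF t]]
  have "r = t \<or> r = inv_list t \<or> r = sigma_list t \<or> r = inv_list (sigma_list t)"
    using assms(2) by (simp add: orbit_list_def)
  thus ?thesis
    using t closed list_ok_closed(1)[OF bd_lists_ok[OF closed(2)]] by blast
qed

lemma orbit_list_eq: "t \<in> set bd_lists \<Longrightarrow> r \<in> set (orbit_list t) \<Longrightarrow> set (orbit_list r) = set (orbit_list t)"
  by (rule list_ok_closed(7)[OF bd_lists_ok])

lemma rep_in_bd: "r \<in> set rep_lists \<Longrightarrow> r \<in> set bd_lists"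
  using rep_lists_check by (simp add: list_all_iff)

lemma triple_action:
  assumes "bd_triple T"
  shows "bd_triple (bd_inv T) \<and> bd_triple (bd_sigma T) \<and> bd_inv (bd_inv T) = T \<and>
    bd_sigma (bd_sigma T) = T \<and> bd_inv (bd_sigma T) = bd_sigma (bd_inv T)"
proof -
  obtain t where t: "t \<in> set bd_lists" "T = mk t" using bd_triple_cases[OF assms] .
  note closed = list_ok_closed(1-5)[OF bd_lists_ok[OF t(1)]]
  have "bd_triple (mk (inv_list t))" "bd_triple (mk (sigma_list t))"
    using closed(1,2) bd_triple_mk bd_lists_ok by blast+
  thus ?thesis
    by (simp add: t bd_inv_mk bd_sigma_mk closed)
qed

text \<open>Uniqueness among lists carries over to triples because \<open>mk\<close> is injective on
  the enumerated lists.\<close>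

lemma orbit_rep: "\<forall>Q\<in>bd_orbit ` {T. bd_triple T}. \<exists>!T. T \<in> bd_reps \<and> T \<in> Q"
proof
  fix Q assume "Q \<in> bd_orbit ` {T. bd_triple T}"
  then obtain t where t: "t \<in> set bd_lists" and Q: "Q = mk ` set (orbit_list t)"
    unfolding bd_triple_iff using bd_orbit_mk by auto
  obtain r where r: "r \<in> set rep_lists" "r \<in> set (orbit_list t)"
    and u: "\<And>r'. r' \<in> set rep_lists \<Longrightarrow> r' \<in> set (orbit_list t) \<Longrightarrow> r' = r"
    using rep_unique[OF t] by blast
  show "\<exists>!T. T \<in> bd_reps \<and> T \<in> Q"
  proof (rule ex1I[of _ "mk r"])
    fix T assume "T \<in> bd_reps \<and> T \<in> Q"
    then obtain a b where "T = mk a" "a \<in> set rep_lists" "T = mk b" "b \<in> set (orbit_list t)"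
      unfolding bd_reps_mk Q by blast
    moreover from this have "a = b"
      using mk_inj bd_lists_ok rep_in_bd orbit_list_bd[OF t] by metis
    ultimately show "T = mk r" using u by blast
  qed (use r in \<open>auto simp: bd_reps_mk Q\<close>)
qed

lemma card_reps: "card bd_reps = 13"
proof -
  have "inj_on mk (set rep_lists)"
    using mk_inj bd_lists_ok rep_in_bd by (auto simp: inj_on_def)
  moreover have "card (set rep_lists) = length rep_lists"
    using rep_lists_check distinct_card by blast
  ultimately show ?thesis
    unfolding bd_reps_mk by (simp add: card_image rep_lists_def)
qed

lemma reps_bd: "bd_reps \<subseteq> {T. bd_triple T}"
  unfolding bd_reps_mk bd_triple_iff using rep_in_bd by auto

text \<open>Each orbit contains exactly one representative, so \<open>bd_orbit\<close> is a
  bijection from the 13 representatives onto the orbits.\<close>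

lemma card_orbits: "card (bd_orbit ` {T. bd_triple T}) = 13"
proof -
  have "bd_orbit ` {T. bd_triple T} = bd_orbit ` bd_reps"
  proof
    show "bd_orbit ` {T. bd_triple T} \<subseteq> bd_orbit ` bd_reps"
    proof
      fix Q assume "Q \<in> bd_orbit ` {T. bd_triple T}"
      then obtain t where t: "t \<in> set bd_lists" and Q: "Q = bd_orbit (mk t)"
        unfolding bd_triple_iff by auto
      obtain r where r: "r \<in> set rep_lists" "r \<in> set (orbit_list t)"
        using rep_unique[OF t] by blast
      have "Q = bd_orbit (mk r)"
        using orbit_list_eq[OF t r(2)] t rep_in_bd[OF r(1)] by (simp add: Q bd_orbit_mk)
      thus "Q \<in> bd_orbit ` bd_reps" using r(1) by (auto simp: bd_reps_mk)
    qed
  qed (use reps_bd in auto)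
  moreover have "inj_on bd_orbit bd_reps"
  proof (rule inj_onI)
    fix x y assume xy: "x \<in> bd_reps" "y \<in> bd_reps" "bd_orbit x = bd_orbit y"
    have self: "z \<in> bd_orbit z" if "z \<in> bd_reps" for z
      using that rep_in_bd by (auto simp: bd_reps_mk bd_orbit_mk orbit_list_def)
    have "bd_orbit x \<in> bd_orbit ` {T. bd_triple T}" using xy(1) reps_bd by auto
    thus "x = y"
      using orbit_rep xy self by metis
  qed
  ultimately show ?thesis
    using card_reps by (simp add: card_image)
qed

section \<open>Admissible elements\<close>

lemma flip_entry: "ent (flip r) i k j l = ent r k i l j"
  by (simp add: flip_def)

lemma flip_linear: "flip (x + y) = flip x + flip y" "flip (x - y) = flip x - flip y" "flip (c \<odot> x) = c \<odot> flip x"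
  by (simp_all add: flip_def vec_eq_iff)

lemma flip_tensor: "flip (x \<otimes> y) = y \<otimes> (x :: complex mat1)"
  by (simp add: flip_def tensor_def vec_eq_iff mult.commute)

lemma flip_cartan_wedge: "w \<in> cartan_wedge \<Longrightarrow> flip w = - w"
  unfolding cartan_wedge_def
proof (induction rule: cmat.span_induct_alt)
  case base
  show ?case by (simp add: flip_def vec_eq_iff)
next
  case (step c x y)
  then obtain a b where ab: "x = a \<^bold>\<and> b" by blast
  have "flip x = - x"
    unfolding ab wedge_def flip_linear flip_tensor by (simp add: vec_eq_iff algebra_simps)
  thus ?case using step by (simp add: flip_linear vec_eq_iff)
qed

lemma cartan_tensor_wedge: "r \<in> cartan_tensor \<Longrightarrow> (1/2) \<odot> (r - flip r) \<in> cartan_wedge"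
  unfolding cartan_tensor_def
proof (induction rule: cmat.span_induct_alt)
  case base
  have "(1/2) \<odot> (0 - flip 0) = (0 :: complex mat2)" by (simp add: flip_def vec_eq_iff)
  thus ?case by (simp add: cartan_wedge_def cmat.span_zero)
next
  case (step c x y)
  then obtain a b where ab: "x = a \<otimes> b" "a \<in> cartan" "b \<in> cartan" by blast
  have "(1/2) \<odot> (c \<odot> x + y - flip (c \<odot> x + y)) = c \<odot> (a \<^bold>\<and> b) + (1/2) \<odot> (y - flip y)"
    by (simp add: ab wedge_def flip_linear flip_tensor vec_eq_iff algebra_simps)
  moreover have "a \<^bold>\<and> b \<in> cartan_wedge"
    unfolding cartan_wedge_def using ab by (intro cmat.span_base) auto
  ultimately show ?case
    using step(2) unfolding cartan_wedge_def by (simp add: cmat.span_add cmat.span_scale)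
qed

lemma cartan_wedge_tensor: "w \<in> cartan_wedge \<Longrightarrow> w \<in> cartan_tensor"
proof -
  have "x \<^bold>\<and> y \<in> cartan_tensor" if "x \<in> cartan" "y \<in> cartan" for x y
    unfolding wedge_def cartan_tensor_def
    using that by (intro cmat.span_scale cmat.span_diff cmat.span_base) auto
  hence "cartan_wedge \<subseteq> cartan_tensor"
    unfolding cartan_wedge_def cartan_tensor_def by (intro cmat.span_minimal) auto
  thus "w \<in> cartan_wedge \<Longrightarrow> w \<in> cartan_tensor" by blast
qed

lemma flip_t0: "flip t0 = t0"
  by (rule mat2_eqI) (auto simp: flip_entry ent_t0)

text \<open>With the traceless matrices x_a = e_aa - I/5 one has t^0 = \<Sum> x_a (x) x_a: the cross
  terms give -2/5 and the constant term +1/5 times the identity.\<close>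

lemma t0_cartan: "t0 \<in> cartan_tensor"
proof -
  let ?x = "\<lambda>a. E (nat_ix a) (nat_ix a) - (1/5) \<odot> mat 1 :: complex mat1"
  have x: "?x a $ el r $ el s = (if r = s then (if r = a then 1 else 0) - 1/5 else 0)" for a r s
    by (auto simp: E_entry' mat_def)
  have mem: "?x a \<in> cartan" for a
  proof -
    have "trace (?x a) = (\<Sum>r\<in>UNIV. ?x a $ el r $ el r)"
      unfolding trace_def sum_el ..
    also have "\<dots> = 0"
      unfolding x by (cases a) (simp_all add: sum_subtractf UNIV_ix)
    finally have "trace (?x a) = 0" .
    moreover have "\<forall>i j. i \<noteq> j \<longrightarrow> ?x a $ i $ j = 0"
      unfolding all_el x by simp
    ultimately show ?thesis by (simp add: cartan_def)
  qed
  have eq: "t0 = (\<Sum>a\<in>UNIV. ?x a \<otimes> ?x a)"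
  proof (rule mat2_eqI)
    fix i k j l
    show "ent t0 i k j l = ent (\<Sum>a\<in>UNIV. ?x a \<otimes> ?x a) i k j l"
    proof (cases "i = j \<and> k = l")
      case True
      thus ?thesis
        unfolding sum_component ent_tensor x ent_t0 unfolding sum_ix by (cases j; cases l; simp)
    next
      case False
      thus ?thesis
        unfolding sum_component ent_tensor x ent_t0 unfolding sum_ix by auto
    qed
  qed
  show ?thesis
    unfolding cartan_tensor_def eq by (intro cmat.span_sum cmat.span_base) (use mem in blast)
qed

text \<open>Decomposition under the flip: the condition fixes the symmetric part as t^0/2 and leaves
  the antisymmetric part free.\<close>

lemma cartan_admissible_iff:
  "r0 \<in> cartan_tensor \<and> r0 + flip r0 = t0 \<longleftrightarrow> (\<exists>w\<in>cartan_wedge. r0 = (1/2) \<odot> t0 + w)"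
proof
  assume r: "r0 \<in> cartan_tensor \<and> r0 + flip r0 = t0"
  have "r0 = (1/2) \<odot> (r0 + flip r0) + (1/2) \<odot> (r0 - flip r0)"
    by (simp add: vec_eq_iff field_simps)
  hence "r0 = (1/2) \<odot> t0 + (1/2) \<odot> (r0 - flip r0)"
    using r by simp
  thus "\<exists>w\<in>cartan_wedge. r0 = (1/2) \<odot> t0 + w"
    using r cartan_tensor_wedge by blast
next
  assume "\<exists>w\<in>cartan_wedge. r0 = (1/2) \<odot> t0 + w"
  then obtain w where w: "w \<in> cartan_wedge" "r0 = (1/2) \<odot> t0 + w" by blast
  have "r0 \<in> cartan_tensor"
    using cartan_wedge_tensor[OF w(1)] t0_cartan unfolding w(2) cartan_tensor_def
    by (intro cmat.span_add cmat.span_scale)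
  moreover have "r0 + flip r0 = t0"
    unfolding w(2) flip_linear flip_t0 flip_cartan_wedge[OF w(1)] by (simp add: vec_eq_iff)
  ultimately show "r0 \<in> cartan_tensor \<and> r0 + flip r0 = t0" by blast
qed

section \<open>Coordinates on the exterior square of the Cartan subalgebra\<close>

definition hv :: "nat \<Rightarrow> ix \<Rightarrow> complex"
  where "hv n r = (if nat_ix r = n then 1 else 0) - (if nat_ix r = Suc n then 1 else 0)"

lemma H_entry: "n \<in> {1..4} \<Longrightarrow> H n $ el r $ el s = (if r = s then hv n r else 0)"
  by (cases r; cases s) (auto simp: H_def E_entry hv_def)

definition wedge_diag :: "complex \<Rightarrow> complex \<Rightarrow> complex \<Rightarrow> complex \<Rightarrow> complex \<Rightarrow> complex \<Rightarrow> ix \<Rightarrow> ix \<Rightarrow> complex"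
  where "wedge_diag c12 c13 c14 c23 c24 c34 r s =
    (c12 * (hv 1 r * hv 2 s - hv 2 r * hv 1 s) + c13 * (hv 1 r * hv 3 s - hv 3 r * hv 1 s) +
     c14 * (hv 1 r * hv 4 s - hv 4 r * hv 1 s) + c23 * (hv 2 r * hv 3 s - hv 3 r * hv 2 s) +
     c24 * (hv 2 r * hv 4 s - hv 4 r * hv 2 s) + c34 * (hv 3 r * hv 4 s - hv 4 r * hv 3 s)) / 2"

definition wedge_elem :: "complex \<Rightarrow> complex \<Rightarrow> complex \<Rightarrow> complex \<Rightarrow> complex \<Rightarrow> complex \<Rightarrow> complex mat2"
  where "wedge_elem c12 c13 c14 c23 c24 c34 =
    c12 \<odot> (H 1 \<^bold>\<and> H 2) + c13 \<odot> (H 1 \<^bold>\<and> H 3) + c14 \<odot> (H 1 \<^bold>\<and> H 4) +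
    c23 \<odot> (H 2 \<^bold>\<and> H 3) + c24 \<odot> (H 2 \<^bold>\<and> H 4) + c34 \<odot> (H 3 \<^bold>\<and> H 4)"

lemma wedge_anti: "wedge_diag a b c d e f i j = - wedge_diag a b c d e f j i"
  by (simp add: wedge_diag_def field_simps)

lemma wedge_elem_diag: "is_diag (wedge_elem a b c d e f) (wedge_diag a b c d e f)"
  unfolding is_diag_def
proof (intro allI)
  fix i k j l
  have H: "H (Suc 0) $ el r $ el s = (if r = s then hv (Suc 0) r else 0)" "H 2 $ el r $ el s = (if r = s then hv 2 r else 0)"
    "H 3 $ el r $ el s = (if r = s then hv 3 r else 0)" "H 4 $ el r $ el s = (if r = s then hv 4 r else 0)" for r s
    by (simp_all add: H_entry)
  show "ent (wedge_elem a b c d e f) i k j l = (if i = j \<and> k = l then wedge_diag a b c d e f i k else 0)"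
    unfolding wedge_elem_def wedge_diag_def
    by (cases "i = j"; cases "k = l") (simp_all add: wedge_def ent_tensor H field_simps)
qed

lemma cartan_H:
  assumes "x \<in> cartan"
  obtains a b c d where "\<And>r s. x $ el r $ el s = (if r = s then a * hv 1 r + b * hv 2 r + c * hv 3 r + d * hv 4 r else 0)"
proof -
  let ?x = "\<lambda>i. x $ el i $ el i"
  have "(\<Sum>r\<in>UNIV. x $ el r $ el r) = 0"
    using assms unfolding cartan_def trace_def sum_el by simp
  hence tr: "?x I5 = - (?x I1 + ?x I2 + ?x I3 + ?x I4)"
    by (simp add: sum_ix eq_neg_iff_add_eq_0 algebra_simps)
  have off: "r \<noteq> s \<Longrightarrow> x $ el r $ el s = 0" for r s
    using assms by (auto simp: cartan_def)
  \<comment> \<open>In the basis h_1, ..., h_4 the coefficients are the partial sums of the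
    diagonal; the last diagonal entry fits because the trace is zero.\<close>
  have "x $ el r $ el s = (if r = s then ?x I1 * hv 1 r + (?x I1 + ?x I2) * hv 2 r + (?x I1 + ?x I2 + ?x I3) * hv 3 r +
      (?x I1 + ?x I2 + ?x I3 + ?x I4) * hv 4 r else 0)" for r s
    using off[of r s] tr by (cases r) (auto simp: hv_def)
  thus ?thesis by (rule that)
qed

lemma wedge_elem_cartan: "wedge_elem a b c d e f \<in> cartan_wedge"
proof -
  have "H n \<in> cartan" if "n \<in> {1..4}" for n
  proof -
    have "trace (H n) = (\<Sum>r\<in>UNIV. hv n r)"
      unfolding trace_def sum_el using that by (simp add: H_entry del: atLeastAtMost_iff)
    also have "\<dots> = 0"
    proof -
      have "n = 1 \<or> n = 2 \<or> n = 3 \<or> n = 4" using that by auto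
      thus ?thesis by (auto simp: sum_ix hv_def)
    qed
    finally have "trace (H n) = 0" .
    moreover have "\<forall>i j. i \<noteq> j \<longrightarrow> H n $ i $ j = 0"
      unfolding all_el using that by (simp add: H_entry del: atLeastAtMost_iff)
    ultimately show ?thesis by (simp add: cartan_def)
  qed
  hence "H i \<^bold>\<and> H j \<in> cartan_wedge" if "i \<in> {1..4}" "j \<in> {1..4}" for i j
    unfolding cartan_wedge_def using that by (intro cmat.span_base) blast
  thus ?thesis
    unfolding wedge_elem_def cartan_wedge_def by (intro cmat.span_add cmat.span_scale) auto
qed

lemma wedge_elem_linear:
  "wedge_elem a b c d e f + wedge_elem a' b' c' d' e' f' = wedge_elem (a + a') (b + b') (c + c') (d + d') (e + e') (f + f')"
  "z \<odot> wedge_elem a b c d e f = wedge_elem (z * a) (z * b) (z * c) (z * d) (z * e) (z * f)"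
  by (simp_all add: wedge_elem_def vec_eq_iff algebra_simps)

lemma is_diag_eqI: "is_diag X c \<Longrightarrow> is_diag Y c' \<Longrightarrow> (\<And>i k. c i k = c' i k) \<Longrightarrow> X = Y"
  by (intro mat2_eqI) (simp add: is_diag_def)

lemma cartan_wedge_elem:
  assumes "w \<in> cartan_wedge"
  obtains a b c d e f where "w = wedge_elem a b c d e f"
proof -
  have "\<exists>a b c d e f. w = wedge_elem a b c d e f"
    using assms unfolding cartan_wedge_def
  proof (induction rule: cmat.span_induct_alt)
    case base
    have "0 = wedge_elem 0 0 0 0 0 0" by (simp add: wedge_elem_def vec_eq_iff)
    thus ?case by blast
  next
    case (step z x y)
    then obtain u v where uv: "x = u \<^bold>\<and> v" "u \<in> cartan" "v \<in> cartan" by blast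
    obtain a b c d where u: "\<And>r s. u $ el r $ el s = (if r = s then a * hv 1 r + b * hv 2 r + c * hv 3 r + d * hv 4 r else 0)"
      using cartan_H[OF uv(2)] by blast
    obtain a' b' c' d' where v: "\<And>r s. v $ el r $ el s = (if r = s then a' * hv 1 r + b' * hv 2 r + c' * hv 3 r + d' * hv 4 r else 0)"
      using cartan_H[OF uv(3)] by blast
    \<comment> \<open>The coordinates of a decomposable wedge are the 2 x 2 minors of the
      coordinates of its factors.\<close>
    have "x = wedge_elem (a * b' - b * a') (a * c' - c * a') (a * d' - d * a') (b * c' - c * b') (b * d' - d * b') (c * d' - d * c')"
    proof (rule is_diag_eqI[OF _ wedge_elem_diag])
      show "is_diag x (\<lambda>r s. ((a * hv 1 r + b * hv 2 r + c * hv 3 r + d * hv 4 r) * (a' * hv 1 s + b' * hv 2 s + c' * hv 3 s + d' * hv 4 s) -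
          (a' * hv 1 r + b' * hv 2 r + c' * hv 3 r + d' * hv 4 r) * (a * hv 1 s + b * hv 2 s + c * hv 3 s + d * hv 4 s)) / 2)"
        unfolding is_diag_def uv(1) wedge_def ent_smult vector_minus_component ent_tensor u v by simp
      show "((a * hv 1 r + b * hv 2 r + c * hv 3 r + d * hv 4 r) * (a' * hv 1 s + b' * hv 2 s + c' * hv 3 s + d' * hv 4 s) -
          (a' * hv 1 r + b' * hv 2 r + c' * hv 3 r + d' * hv 4 r) * (a * hv 1 s + b * hv 2 s + c * hv 3 s + d * hv 4 s)) / 2 =
          wedge_diag (a * b' - b * a') (a * c' - c * a') (a * d' - d * a') (b * c' - c * b') (b * d' - d * b') (c * d' - d * c') r s" for r s
        unfolding wedge_diag_def by algebra
    qed
    thus ?case using step(2) wedge_elem_linear by metis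
  qed
  thus ?thesis using that by blast
qed

section \<open>Admissibility as a system of linear equations\<close>

definition ixn :: "nat \<Rightarrow> ix"
  where "ixn n = (if n = 1 then I1 else if n = 2 then I2 else if n = 3 then I3 else if n = 4 then I4 else I5)"

lemma el_ixn: "n \<in> {1..5} \<Longrightarrow> of_nat n = el (ixn n)"
proof -
  assume "n \<in> {1..5}"
  hence "nat_ix (ixn n) = n" by (auto simp: ixn_def)
  thus ?thesis by (simp add: el_def)
qed

text \<open>The m-th diagonal coordinate of the condition at \<alpha> for r^0 = t^0/2 + c, where (i,
  j) are the ends of \<alpha> and (b, e) those of \<tau>\<alpha>. The equation is doubled to clear
  t^0/2, and antisymmetry moves m to the second argument.\<close>

definition adm_eq :: "(ix \<Rightarrow> ix \<Rightarrow> complex) \<Rightarrow> ix \<Rightarrow> ix \<Rightarrow> ix \<Rightarrow> ix \<Rightarrow> bool"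
  where "adm_eq c i j b e \<longleftrightarrow> (\<forall>m. 2 * (c b m - c e m - c i m + c j m) =
     (if m = e then 1 else 0) + (if m = j then 1 else 0) - (if m = b then 1 else 0) - (if m = i then 1 else 0))"

lemma sum_delta_zero_iff:
  "(\<forall>m l. (if m = l then f m else 0) + (if m = l then g m else 0) = (0 :: complex)) \<longleftrightarrow> (\<forall>m. f m + g m = 0)"
  by auto

lemma admissible_iff:
  assumes "\<Gamma>1 \<subseteq> {1..4}" "(\<lambda>i. the (\<tau> i)) ` \<Gamma>1 \<subseteq> {1..4}" and w: "w \<in> cartan_wedge" "is_diag w c"
    and anti: "\<And>i j. c i j = - c j i"
  shows "admissible (\<tau>, \<Gamma>1, \<Gamma>2) ((1/2) \<odot> t0 + w) \<longleftrightarrow>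
    (\<forall>\<alpha>\<in>\<Gamma>1. adm_eq c (ixn \<alpha>) (ixn (Suc \<alpha>)) (ixn (the (\<tau> \<alpha>))) (ixn (Suc (the (\<tau> \<alpha>)))))"
proof -
  let ?r = "(1/2) \<odot> t0 + w"
  have r: "ent ?r i k j l = (if i = j \<and> k = l then ((if i = k then 1 else 0) - 1/5) / 2 + c i k else 0)" for i k j l
    using w(2) by (auto simp: is_diag_def ent_t0)
  have "?r \<in> cartan_tensor \<and> ?r + flip ?r = t0"
    using w(1) cartan_admissible_iff by blast
  hence "admissible (\<tau>, \<Gamma>1, \<Gamma>2) ?r \<longleftrightarrow>
      (\<forall>\<alpha>\<in>\<Gamma>1. apply_left (simple_root (the (\<tau> \<alpha>))) ?r + apply_right (simple_root \<alpha>) ?r = 0)"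
    by simp
  also have "\<dots> \<longleftrightarrow> (\<forall>\<alpha>\<in>\<Gamma>1. adm_eq c (ixn \<alpha>) (ixn (Suc \<alpha>)) (ixn (the (\<tau> \<alpha>))) (ixn (Suc (the (\<tau> \<alpha>)))))"
  proof (rule ball_cong[OF refl])
    fix \<alpha> assume \<alpha>: "\<alpha> \<in> \<Gamma>1"
    let ?\<beta> = "the (\<tau> \<alpha>)"
    let ?i = "ixn \<alpha>" and ?j = "ixn (Suc \<alpha>)" and ?b = "ixn ?\<beta>" and ?e = "ixn (Suc ?\<beta>)"
    have n: "\<alpha> \<in> {1..5}" "Suc \<alpha> \<in> {1..5}" "?\<beta> \<in> {1..5}" "Suc ?\<beta> \<in> {1..5}"
      using assms(1,2) \<alpha> by auto
    have ne: "?i \<noteq> ?j" "?b \<noteq> ?e"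
      using assms(1,2) \<alpha> by (auto simp: ixn_def)
    have L: "apply_left (simple_root ?\<beta>) ?r $ el m $ el l = (if m = l then
        ((if ?b = m then 1 else 0) - 1/5) / 2 + c ?b m - (((if ?e = m then 1 else 0) - 1/5) / 2 + c ?e m) else 0)" for m l
      unfolding apply_left_def simple_root_def vec_lambda_beta el_ixn[OF n(3)] el_ixn[OF n(4)] r by simp
    have R: "apply_right (simple_root \<alpha>) ?r $ el m $ el l = (if m = l then
        ((if m = ?i then 1 else 0) - 1/5) / 2 + c m ?i - (((if m = ?j then 1 else 0) - 1/5) / 2 + c m ?j) else 0)" for m l
      unfolding apply_right_def simple_root_def vec_lambda_beta el_ixn[OF n(1)] el_ixn[OF n(2)] r by simp
    have "apply_left (simple_root ?\<beta>) ?r + apply_right (simple_root \<alpha>) ?r = 0 \<longleftrightarrow>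
      (\<forall>m l. apply_left (simple_root ?\<beta>) ?r $ el m $ el l + apply_right (simple_root \<alpha>) ?r $ el m $ el l = 0)"
      unfolding vec_eq_iff all_el by simp
    also have "\<dots> \<longleftrightarrow> (\<forall>m. ((if ?b = m then 1 else 0) - 1/5) / 2 + c ?b m - (((if ?e = m then 1 else 0) - 1/5) / 2 + c ?e m) +
        (((if m = ?i then 1 else 0) - 1/5) / 2 + c m ?i - (((if m = ?j then 1 else 0) - 1/5) / 2 + c m ?j)) = 0)"
      unfolding L R by (rule sum_delta_zero_iff)
    also have "\<dots> \<longleftrightarrow> adm_eq c ?i ?j ?b ?e"
      unfolding adm_eq_def
    proof (rule iff_allI)
      fix m
      show "((if ?b = m then 1 else 0) - 1/5) / 2 + c ?b m - (((if ?e = m then 1 else 0) - 1/5) / 2 + c ?e m) +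
        (((if m = ?i then 1 else 0) - 1/5) / 2 + c m ?i - (((if m = ?j then 1 else 0) - 1/5) / 2 + c m ?j)) = 0 \<longleftrightarrow>
        2 * (c ?b m - c ?e m - c ?i m + c ?j m) =
     (if m = ?e then 1 else 0) + (if m = ?j then 1 else 0) - (if m = ?b then 1 else 0) - (if m = ?i then 1 else 0)"
      proof -
        \<comment> \<open>Each of the two roots contributes the constant -1/5 once with either sign,
          so it cancels.\<close>
        have *: "(u - 1/5) / 2 + x - ((u' - 1/5) / 2 + y) + ((v - 1/5) / 2 + z - ((v' - 1/5) / 2 + z')) = 0 \<longleftrightarrow>
          2 * (x - y + z - z') = u' + v' - u - v" for u u' v v' x y z z' :: complex
          by algebra
        show ?thesis
          unfolding * anti[of m ?i] anti[of m ?j] by (simp add: eq_commute[of m] algebra_simps)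
      qed
    qed
    finally show "apply_left (simple_root ?\<beta>) ?r + apply_right (simple_root \<alpha>) ?r = 0 \<longleftrightarrow> adm_eq c ?i ?j ?b ?e" .
  qed
  finally show ?thesis .
qed

definition adm_list :: "nat list \<Rightarrow> (ix \<Rightarrow> ix \<Rightarrow> complex) \<Rightarrow> bool"
  where "adm_list t c \<longleftrightarrow> list_all (\<lambda>\<alpha>. t ! (\<alpha> - 1) \<noteq> 0 \<longrightarrow>
     adm_eq c (ixn \<alpha>) (ixn (Suc \<alpha>)) (ixn (t ! (\<alpha> - 1))) (ixn (Suc (t ! (\<alpha> - 1))))) [1, 2, 3, 4]"

lemma r_tilde_half: "r_tilde ((1/2) \<odot> t0 + w) = w"
  by (simp add: r_tilde_def)

lemma admissible_mk_iff:
  assumes "list_ok t" "w \<in> cartan_wedge" "is_diag w c" "\<And>i j. c i j = - c j i"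
  shows "admissible (mk t) ((1/2) \<odot> t0 + w) \<longleftrightarrow> adm_list t c"
proof -
  have dom: "i \<in> dom (tau t) \<longleftrightarrow> i \<in> {1..4} \<and> t ! (i - 1) \<noteq> 0" for i
    by (auto simp: tau_def dom_def)
  have the: "the (tau t i) = t ! (i - 1)" if "i \<in> dom (tau t)" for i
    using that unfolding dom by (simp add: tau_def)
  have "dom (tau t) \<subseteq> {1..4}"
    using dom by blast
  moreover have "(\<lambda>i. the (tau t i)) ` dom (tau t) \<subseteq> {1..4}"
  proof (rule image_subsetI)
    fix i assume i: "i \<in> dom (tau t)"
    show "the (tau t i) \<in> {1..4}"
      unfolding the[OF i] using i list_okD(2)[OF assms(1), of i] unfolding dom by auto
  qed
  ultimately have "admissible (mk t) ((1/2) \<odot> t0 + w) \<longleftrightarrow>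
      (\<forall>\<alpha>\<in>dom (tau t). adm_eq c (ixn \<alpha>) (ixn (Suc \<alpha>)) (ixn (the (tau t \<alpha>))) (ixn (Suc (the (tau t \<alpha>)))))"
    unfolding mk_def using admissible_iff assms(2-4) by blast
  also have "\<dots> \<longleftrightarrow> (\<forall>\<alpha>\<in>dom (tau t). adm_eq c (ixn \<alpha>) (ixn (Suc \<alpha>)) (ixn (t ! (\<alpha> - 1))) (ixn (Suc (t ! (\<alpha> - 1)))))"
    by (rule ball_cong[OF refl]) (simp only: the)
  also have "\<dots> \<longleftrightarrow> adm_list t c"
    unfolding adm_list_def fold_14 Ball_def dom by blast
  finally show ?thesis .
qed

lemma admissible_mk:
  assumes "list_ok t"
  shows "admissible (mk t) r0 \<longleftrightarrow>
    (\<exists>a b c d e f. r0 = (1/2) \<odot> t0 + wedge_elem a b c d e f \<and> adm_list t (wedge_diag a b c d e f))"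
    (is "_ \<longleftrightarrow> ?R")
proof
  assume adm: "admissible (mk t) r0"
  hence "r0 \<in> cartan_tensor \<and> r0 + flip r0 = t0"
    by (simp add: mk_def)
  then obtain w where w: "w \<in> cartan_wedge" "r0 = (1/2) \<odot> t0 + w"
    unfolding cartan_admissible_iff by blast
  obtain a b c d e f where e: "w = wedge_elem a b c d e f"
    using cartan_wedge_elem[OF w(1)] .
  have "adm_list t (wedge_diag a b c d e f)"
    using adm admissible_mk_iff[OF assms wedge_elem_cartan wedge_elem_diag wedge_anti] unfolding w(2) e by blast
  thus ?R using w(2) e by blast
next
  assume ?R
  thus "admissible (mk t) r0"
    using admissible_mk_iff[OF assms wedge_elem_cartan wedge_elem_diag wedge_anti] by blast
qed

text \<open>The table supplies an integral diagonal part for T. The equations that r0 satisfies are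
  those required by \<open>ggs_sound\<close>, since the permutation agrees with \<tau> on simple
  roots.\<close>

lemma ggs_holds:
  assumes "bd_triple T" "admissible T r0"
  shows "QYBE (R_GGS T r0)" "Hecke (R_GGS T r0)"
proof -
  obtain t where t: "t \<in> set bd_lists" "T = mk t"
    using bd_triple_cases[OF assms(1)] .
  note lok = bd_lists_ok[OF t(1)]
  obtain rv p v where "(t, rv, p, v) \<in> set bd_table"
    using t(1) unfolding bd_lists_def by auto
  hence "row_ok (t, rv, p, v)"
    using bd_table_ok by (simp add: list_all_iff)
  hence ok: "triple_ok t rv p" "twist_ok t rv p (skew v)" "parity_ok (a_list t rv p) (skew v)"
    "table_ok (coeff_table (a_list t rv p) (skew v))"
    unfolding row_ok_def by simp_all
  obtain a1 a2 a3 a4 a5 a6 where r0: "r0 = (1/2) \<odot> t0 + wedge_elem a1 a2 a3 a4 a5 a6"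
    and adm: "adm_list t (wedge_diag a1 a2 a3 a4 a5 a6)"
    using assms(2) unfolding t(2) admissible_mk[OF lok] by blast
  define c where "c = wedge_diag a1 a2 a3 a4 a5 a6"
  have diag: "is_diag (r_tilde r0) c"
    unfolding r0 r_tilde_half c_def by (rule wedge_elem_diag)
  have anti: "c i j = - c j i" for i j
    unfolding c_def by (rule wedge_anti)
  have eq: "2 * (c b m - c e m - c i m + c j m) =
       (if m = e then 1 else 0) + (if m = j then 1 else 0) - (if m = b then 1 else 0) - (if m = i then 1 else 0)"
    if r: "(i, j) \<in> set roots" "nat_ix j = Suc (nat_ix i)" "step t rv p (i, j) = Some (b, e)" for i j b e m
  proof -
    have *: "t ! (nat_ix i - 1) = nat_ix b" "nat_ix e = Suc (nat_ix b)"
      using ok_simple[OF ok(1) r(1,2)] unfolding r(3) by simp_all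
    have ixn: "ixn (nat_ix x) = x" for x by (cases x) (simp_all add: ixn_def)
    have "1 \<le> nat_ix i" "nat_ix j \<le> 5" "nat_ix b \<noteq> 0"
      using nat_ix_range[of i] nat_ix_range[of j] nat_ix_range[of b] by auto
    hence "nat_ix i \<in> {1..4}" "t ! (nat_ix i - 1) \<noteq> 0"
      using r(2) * by auto
    hence "adm_eq c (ixn (nat_ix i)) (ixn (Suc (nat_ix i))) (ixn (nat_ix b)) (ixn (Suc (nat_ix b)))"
      using adm unfolding adm_list_def fold_14 c_def[symmetric] *(1)[symmetric] by blast
    hence "adm_eq c i j b e"
      unfolding r(2)[symmetric] *(2)[symmetric] ixn .
    thus ?thesis unfolding adm_eq_def by blast
  qed
  show "QYBE (R_GGS T r0)" "Hecke (R_GGS T r0)"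
    unfolding t(2) using ggs_sound[OF ok diag anti eq] by blast+
qed

section \<open>Explicit form of the matrices\<close>

text \<open>One tuple per wedge term: the indices of e_{-\<alpha>} and of e_\<beta>, the sign of
  \<tau>^k(e_\<alpha>), and twice the corresponding entry of \<epsilon>.\<close>

definition link_data :: "nat list \<Rightarrow> bool \<Rightarrow> ix five \<Rightarrow> (ix \<times> ix \<times> ix \<times> ix \<times> bool \<times> int) list"
  where "link_data t rv p = map (\<lambda>((i, j), (b, e), s). (j, i, b, e, s, eps2 (a_list t rv p) (j, b) (i, e))) (links t rv p)"

text \<open>The two entries of a link have opposite signs in a. Equal entries of \<epsilon> at the
  two flipped positions therefore give opposite exponents, which is the shape of a quantized
  wedge.\<close>

definition links_symmetric :: "nat list \<Rightarrow> bool \<Rightarrow> ix five \<Rightarrow> bool"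
  where "links_symmetric t rv p \<longleftrightarrow> list_all (\<lambda>((i, j), (b, e), s).
     eps2 (a_list t rv p) (b, j) (e, i) = eps2 (a_list t rv p) (j, b) (i, e)) (links t rv p)"

text \<open>The quantized wedge puts q^-s on its first tensor, hence the outer minus sign in the
  exponent. A sign of \<tau>^k(e_\<alpha>) is carried by the second factor, as in the term with
  -e_13 of 2(b).\<close>

definition link_term :: "(ix \<Rightarrow> ix \<Rightarrow> complex) \<Rightarrow> ix \<times> ix \<times> ix \<times> ix \<times> bool \<times> int \<Rightarrow> complex fps mat2"
  where "link_term c = (\<lambda>(j, i, b, e, s, n). E (nat_ix j) (nat_ix i) \<^bold>\<and>[- (sg s * of_int n / 2 + c j b + c i e)]
     (if s then E (nat_ix b) (nat_ix e) else - E (nat_ix b) (nat_ix e)))"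

lemma ent_link_term:
  "ent (link_term c (j', i', b, e, s, n)) i k j l =
    (if (j', b) = (i, k) \<and> (i', e) = (j, l) then sg s * qpow (sg s * of_int n / 2 + c j' b + c i' e) else 0) +
    (if (b, j') = (i, k) \<and> (e, i') = (j, l) then sg (\<not> s) * qpow (- (sg s * of_int n / 2 + c j' b + c i' e)) else 0)"
proof -
  define P where "P \<longleftrightarrow> (j', b) = (i, k) \<and> (i', e) = (j, l)"
  define Q where "Q \<longleftrightarrow> (b, j') = (i, k) \<and> (e, i') = (j, l)"
  have T: "ent (E (nat_ix j') (nat_ix i') \<otimes> E (nat_ix b) (nat_ix e)) i k j l = (if P then 1 else (0 :: complex fps))"
    "ent (E (nat_ix b) (nat_ix e) \<otimes> E (nat_ix j') (nat_ix i')) i k j l = (if Q then 1 else (0 :: complex fps))"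
    by (auto simp: ent_tensor_E P_def Q_def)
  define X where "X = sg s * of_int n / 2 + c j' b + c i' e"
  have N: "ent (u \<otimes> (- v)) i k j l = - ent (u \<otimes> v) i k j l" "ent ((- v) \<otimes> u) i k j l = - ent (v \<otimes> u) i k j l"
    for u v :: "complex fps mat1"
    by (simp_all add: ent_tensor)
  show ?thesis
    unfolding P_def[symmetric] Q_def[symmetric] link_term_def prod.case qwedge_def X_def[symmetric]
    by (cases s) (simp_all add: N T)
qed

text \<open>Conjugation by q to the diagonal part is linear, so the standard part splits off; in the
  rest, the two entries of each link combine into one quantized wedge.\<close>

lemma R_formula:
  assumes ok: "triple_ok t rv p" and sym: "links_symmetric t rv p"
    and diag: "is_diag (r_tilde r0) c" and anti: "\<And>i j. c i j = - c j i"
  shows "R_GGS (mk t) r0 = R_std r0 + qhat \<odot> (\<Sum>x\<leftarrow>link_data t rv p. link_term c x)"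
proof (rule mat2_eqI)
  fix i k j l
  let ?L = "a_list t rv p"
  let ?q = "qpow (c i k + c j l)"
  let ?f = "\<lambda>(x', y', s). if x' = (i, k) \<and> y' = (j, l) then sg s * qpow (sg s * of_int (eps2 ?L (i, k) (j, l)) / 2) else 0"
  let ?d = "\<lambda>((i, j), (b, e), s). (j, i, b, e, s, eps2 ?L (j, b) (i, e))"
  let ?a = "\<lambda>((i, j), (b, e), s). [((j, b), (i, e), s), ((b, j), (e, i), \<not> s)]"
  have *: "?q * (\<Sum>x\<leftarrow>?a z. ?f x) = ent (link_term c (?d z)) i k j l" if z: "z \<in> set (links t rv p)" for z
  proof -
    obtain i' j' b e s where z': "z = ((i', j'), (b, e), s)" by (cases z) auto
    have n: "eps2 ?L (b, j') (e, i') = eps2 ?L (j', b) (i', e)"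
      using sym z unfolding links_symmetric_def list_all_iff z' by fastforce
    define P where "P \<longleftrightarrow> (j', b) = (i, k) \<and> (i', e) = (j, l)"
    define Q where "Q \<longleftrightarrow> (b, j') = (i, k) \<and> (e, i') = (j, l)"
    let ?n = "of_int (eps2 ?L (i, k) (j, l)) :: complex"
    let ?m = "of_int (eps2 ?L (j', b) (i', e)) :: complex"
    have 1: "?q * (sg s * qpow (sg s * ?n / 2)) = sg s * qpow (sg s * ?m / 2 + c j' b + c i' e)" if P
      using that unfolding P_def by (auto simp: qpow_add mult_ac)
    have 2: "?q * (sg (\<not> s) * qpow (sg (\<not> s) * ?n / 2)) = sg (\<not> s) * qpow (- (sg s * ?m / 2 + c j' b + c i' e))" if Q
    proof -
      have "?n = ?m" "c i k + c j l = - (c j' b + c i' e)"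
        using that n anti[of i k] anti[of j l] unfolding Q_def by auto
      hence "c i k + c j l + sg (\<not> s) * ?n / 2 = - (sg s * ?m / 2 + c j' b + c i' e)"
        by (simp add: sg_not)
      thus ?thesis
        unfolding mult.left_commute[of ?q] qpow_add[symmetric] by (simp only:)
    qed
    have "(\<Sum>x\<leftarrow>?a z. ?f x) = (if P then sg s * qpow (sg s * ?n / 2) else 0) +
        (if Q then sg (\<not> s) * qpow (sg (\<not> s) * ?n / 2) else 0)"
      unfolding z' P_def Q_def by (simp only: list.map sum_list.Cons sum_list.Nil prod.case add_0_right)
    hence "?q * (\<Sum>x\<leftarrow>?a z. ?f x) = (if P then ?q * (sg s * qpow (sg s * ?n / 2)) else 0) +
        (if Q then ?q * (sg (\<not> s) * qpow (sg (\<not> s) * ?n / 2)) else 0)"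
      by (simp only: distrib_left if_mult)
    also have "\<dots> = (if P then sg s * qpow (sg s * ?m / 2 + c j' b + c i' e) else 0) +
        (if Q then sg (\<not> s) * qpow (- (sg s * ?m / 2 + c j' b + c i' e)) else 0)"
      by (simp only: 1 2 cong: if_cong)
    finally show ?thesis
      unfolding z' prod.case ent_link_term P_def[symmetric] Q_def[symmetric] .
  qed
  have "?q * entp (a_tilde (mk t)) (i, k) (j, l) = ?q * (\<Sum>z\<leftarrow>links t rv p. \<Sum>x\<leftarrow>?a z. ?f x)"
    unfolding entp_a_tilde[OF ok] by (simp only: a_list_def[of t rv p] sum_list_map_concat map_map o_def)
  also have "\<dots> = (\<Sum>z\<leftarrow>links t rv p. ?q * (\<Sum>x\<leftarrow>?a z. ?f x))"
    by (simp only: sum_list_const_mult)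
  also have "\<dots> = (\<Sum>z\<leftarrow>links t rv p. ent (link_term c (?d z)) i k j l)"
    by (rule sum_list_cong) (rule *)
  also have "\<dots> = ent (\<Sum>x\<leftarrow>link_data t rv p. link_term c x) i k j l"
    unfolding ent_sum_list link_data_def map_map o_def by (rule refl)
  finally have "?q * ent (a_tilde (mk t)) i k j l = ent (\<Sum>x\<leftarrow>link_data t rv p. link_term c x) i k j l"
    by simp
  thus "ent (R_GGS (mk t) r0) i k j l = ent (R_std r0 + qhat \<odot> (\<Sum>x\<leftarrow>link_data t rv p. link_term c x)) i k j l"
    by (simp add: R_GGS_def R_std_def ent_qmat_conj[OF diag] distrib_left mult.left_commute)
qed

text \<open>Lets the wedge terms be summed in the order in which they are displayed.\<close>

definition same_elements :: "'a list \<Rightarrow> 'a list \<Rightarrow> bool"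
  where "same_elements L M \<longleftrightarrow> distinct L \<and> distinct M \<and> list_all (\<lambda>x. x \<in> set M) L \<and> list_all (\<lambda>x. x \<in> set L) M"

lemma same_elements_sum: "same_elements L M \<Longrightarrow> (\<Sum>x\<leftarrow>L. f x) = (\<Sum>x\<leftarrow>M. f x :: 'a::comm_monoid_add)"
  unfolding same_elements_def list_all_iff
  by (metis subsetI subset_antisym sum_list_distinct_conv_sum_set)

definition data_ok :: "nat list \<Rightarrow> bool \<Rightarrow> ix five \<Rightarrow> (ix \<times> ix \<times> ix \<times> ix \<times> bool \<times> int) list \<Rightarrow> bool"
  where "data_ok t rv p L \<longleftrightarrow> t \<in> set bd_lists \<and> triple_ok t rv p \<and> links_symmetric t rv p \<and>
     same_elements (link_data t rv p) L"

text \<open>\<open>sol\<close> solves the linear equations and \<open>adm\<close> verifies the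
  solution, one for each inclusion. The coefficient functions are those of h_i wedge h_j in the
  order 12, 13, 14, 23, 24, 34.\<close>

lemma generic_solutionI:
  assumes data: "data_ok t rv p L"
    and elem: "\<And>u. u \<in> U \<Longrightarrow> \<rho> u = wedge_elem (ga u) (gb u) (gc u) (gd u) (ge u) (gf u)"
    and sol: "\<And>a b c d e f. adm_list t (wedge_diag a b c d e f) \<Longrightarrow>
      \<exists>u\<in>U. a = ga u \<and> b = gb u \<and> c = gc u \<and> d = gd u \<and> e = ge u \<and> f = gf u"
    and adm: "\<And>u. u \<in> U \<Longrightarrow> adm_list t (wedge_diag (ga u) (gb u) (gc u) (gd u) (ge u) (gf u))"
    and W: "\<And>u. u \<in> U \<Longrightarrow> (\<Sum>x\<leftarrow>L. link_term (wedge_diag (ga u) (gb u) (gc u) (gd u) (ge u) (gf u)) x) = W u"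
  shows "generic_solution (mk t) U \<rho> W"
proof -
  have lok: "list_ok t" and ok: "triple_ok t rv p" and sym: "links_symmetric t rv p"
    and L: "(\<Sum>x\<leftarrow>link_data t rv p. f x) = (\<Sum>x\<leftarrow>L. f x)" for f :: "_ \<Rightarrow> complex fps mat2"
    using data bd_lists_ok same_elements_sum unfolding data_ok_def by blast+
  show ?thesis
    unfolding generic_solution_def
  proof (intro conjI ballI)
    show "{r0. admissible (mk t) r0} = (\<lambda>u. (1/2) \<odot> t0 + \<rho> u) ` U"
    proof (intro equalityI subsetI)
      fix r0 assume "r0 \<in> {r0. admissible (mk t) r0}"
      then obtain a b c d e f where r0: "r0 = (1/2) \<odot> t0 + wedge_elem a b c d e f"
        and "adm_list t (wedge_diag a b c d e f)"
        unfolding mem_Collect_eq admissible_mk[OF lok] by blast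
      then obtain u where "u \<in> U" "a = ga u \<and> b = gb u \<and> c = gc u \<and> d = gd u \<and> e = ge u \<and> f = gf u"
        using sol by blast
      thus "r0 \<in> (\<lambda>u. (1/2) \<odot> t0 + \<rho> u) ` U"
        unfolding r0 using elem by (intro image_eqI[of _ _ u]) simp_all
    next
      fix r0 assume "r0 \<in> (\<lambda>u. (1/2) \<odot> t0 + \<rho> u) ` U"
      then obtain u where u: "u \<in> U" "r0 = (1/2) \<odot> t0 + \<rho> u" by blast
      show "r0 \<in> {r0. admissible (mk t) r0}"
        unfolding mem_Collect_eq admissible_mk[OF lok] u(2) elem[OF u(1)] using adm[OF u(1)] by blast
    qed
  next
    fix u assume u: "u \<in> U"
    let ?c = "wedge_diag (ga u) (gb u) (gc u) (gd u) (ge u) (gf u)"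
    have "is_diag (r_tilde ((1/2) \<odot> t0 + \<rho> u)) ?c"
      unfolding r_tilde_half elem[OF u] by (rule wedge_elem_diag)
    from R_formula[OF ok sym this wedge_anti]
    show "R_GGS (mk t) ((1/2) \<odot> t0 + \<rho> u) = R_std ((1/2) \<odot> t0 + \<rho> u) + qhat \<odot> W u"
      unfolding L W[OF u] .
  qed
qed

section \<open>The thirteen families\<close>

lemma wedge_diag_table:
  "wedge_diag a b c d e f I1 I1 = 0"
  "wedge_diag a b c d e f I1 I2 = (a) / 2"
  "wedge_diag a b c d e f I1 I3 = (- a + b) / 2"
  "wedge_diag a b c d e f I1 I4 = (- b + c) / 2"
  "wedge_diag a b c d e f I1 I5 = (- c) / 2"
  "wedge_diag a b c d e f I2 I1 = (- a) / 2"
  "wedge_diag a b c d e f I2 I2 = 0"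
  "wedge_diag a b c d e f I2 I3 = (a - b + d) / 2"
  "wedge_diag a b c d e f I2 I4 = (b - c - d + e) / 2"
  "wedge_diag a b c d e f I2 I5 = (c - e) / 2"
  "wedge_diag a b c d e f I3 I1 = (a - b) / 2"
  "wedge_diag a b c d e f I3 I2 = (- a + b - d) / 2"
  "wedge_diag a b c d e f I3 I3 = 0"
  "wedge_diag a b c d e f I3 I4 = (d - e + f) / 2"
  "wedge_diag a b c d e f I3 I5 = (e - f) / 2"
  "wedge_diag a b c d e f I4 I1 = (b - c) / 2"
  "wedge_diag a b c d e f I4 I2 = (- b + c + d - e) / 2"
  "wedge_diag a b c d e f I4 I3 = (- d + e - f) / 2"
  "wedge_diag a b c d e f I4 I4 = 0"
  "wedge_diag a b c d e f I4 I5 = (f) / 2"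
  "wedge_diag a b c d e f I5 I1 = (c) / 2"
  "wedge_diag a b c d e f I5 I2 = (- c + e) / 2"
  "wedge_diag a b c d e f I5 I3 = (- e + f) / 2"
  "wedge_diag a b c d e f I5 I4 = (- f) / 2"
  "wedge_diag a b c d e f I5 I5 = 0"
  by (simp_all add: wedge_diag_def hv_def field_simps)

lemma adm_eqD: "adm_eq c i j b e \<Longrightarrow> 2 * (c b m - c e m - c i m + c j m) =
     (if m = e then 1 else 0) + (if m = j then 1 else 0) - (if m = b then 1 else 0) - (if m = i then 1 else 0)"
  unfolding adm_eq_def by blast

lemmas adm_eq_simps = adm_eq_def all_ix wedge_diag_table add_divide_distrib diff_divide_distrib

lemmas adm_eq_unfold = wedge_diag_table ix.distinct simp_thms if_True if_False

lemmas link_sum_simps = list.map sum_list.Cons sum_list.Nil link_term_def prod.case nat_ix.simps sg_simps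
  if_True if_False add_0_right add.assoc

lemma qwedge_cong: "z = z' \<Longrightarrow> u \<^bold>\<and>[z] v = u \<^bold>\<and>[z'] v"
  by simp

text \<open>With an empty domain only the condition on the symmetric part remains, and there are no
  links, so a = 0.\<close>

lemma generic_T4: "generic_solution T4 cartan_wedge (\<lambda>r. r) (\<lambda>_. 0)"
  unfolding generic_solution_def
proof (intro conjI ballI)
  have "admissible T4 r0 \<longleftrightarrow> (\<exists>w\<in>cartan_wedge. r0 = (1/2) \<odot> t0 + w)" for r0
    unfolding cartan_admissible_iff[symmetric] by (simp add: T4_def triple_of_def)
  thus "{r0. admissible T4 r0} = (\<lambda>u. (1/2) \<odot> t0 + u) ` cartan_wedge"
    by auto
next
  fix w assume "w \<in> cartan_wedge"
  then obtain a b c d e f where w: "w = wedge_elem a b c d e f"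
    using cartan_wedge_elem by blast
  have ok: "triple_ok [0, 0, 0, 0] False (Five I1 I2 I3 I4 I5)"
    and sym: "links_symmetric [0, 0, 0, 0] False (Five I1 I2 I3 I4 I5)"
    and data: "link_data [0, 0, 0, 0] False (Five I1 I2 I3 I4 I5) = []"
    by code_simp+
  have "is_diag (r_tilde ((1/2) \<odot> t0 + w)) (wedge_diag a b c d e f)"
    unfolding r_tilde_half w by (rule wedge_elem_diag)
  from R_formula[OF ok sym this wedge_anti]
  show "R_GGS T4 ((1/2) \<odot> t0 + w) = R_std ((1/2) \<odot> t0 + w) + qhat \<odot> 0"
    unfolding data reps_mk by simp
qed

theorem proposition2p1:
  shows "
    (\<forall>T r0. bd_triple T \<and> admissible T r0 \<longrightarrow> QYBE (R_GGS T r0) \<and> Hecke (R_GGS T r0)) \<and>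
    (\<forall>T\<in>{T. bd_triple T}.
      bd_triple (bd_inv T) \<and> bd_triple (bd_sigma T) \<and>
      bd_inv (bd_inv T) = T \<and> bd_sigma (bd_sigma T) = T \<and>
      bd_inv (bd_sigma T) = bd_sigma (bd_inv T)) \<and>
    card (bd_orbit ` {T. bd_triple T}) = 13 \<and> card bd_reps = 13 \<and>
      bd_reps \<subseteq> {T. bd_triple T} \<and>
      (\<forall>Q\<in>bd_orbit ` {T. bd_triple T}. \<exists>!T. T \<in> bd_reps \<and> T \<in> Q) \<and>
    generic_solution T1a {()}
      (\<lambda>_. (1/5) \<odot> ((-3) \<odot> (H 1 \<^bold>\<and> H 2) + (-4) \<odot> (H 1 \<^bold>\<and> H 3) + (-3) \<odot> (H 1 \<^bold>\<and> H 4) +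
          (-4) \<odot> (H 2 \<^bold>\<and> H 3) + (-4) \<odot> (H 2 \<^bold>\<and> H 4) + (-3) \<odot> (H 3 \<^bold>\<and> H 4)))
      (\<lambda>_.
        E 5 4 \<^bold>\<and>[2/5] E 3 4 + E 5 4 \<^bold>\<and>[4/5] E 2 3 + E 5 4 \<^bold>\<and>[6/5] E 1 2 +
        E 4 3 \<^bold>\<and>[2/5] E 2 3 + E 4 3 \<^bold>\<and>[4/5] E 1 2 + E 3 2 \<^bold>\<and>[2/5] E 1 2 +
        E 5 3 \<^bold>\<and>[2/5] E 2 4 + E 5 3 \<^bold>\<and>[4/5] E 1 3 + E 4 2 \<^bold>\<and>[2/5] E 1 3 +
        E 5 2 \<^bold>\<and>[2/5] E 1 4) \<and>
    generic_solution T1b {()}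
      (\<lambda>_. (1/5) \<odot> (H 1 \<^bold>\<and> H 2 + (-2) \<odot> (H 1 \<^bold>\<and> H 3) + H 1 \<^bold>\<and> H 4 +
          (-2) \<odot> (H 2 \<^bold>\<and> H 3) + (-2) \<odot> (H 2 \<^bold>\<and> H 4) + H 3 \<^bold>\<and> H 4))
      (\<lambda>_.
        E 5 4 \<^bold>\<and>[2/5] E 2 3 + E 2 1 \<^bold>\<and>[4/5] E 2 3 + E 4 3 \<^bold>\<and>[6/5] E 2 3 +
        E 2 1 \<^bold>\<and>[2/5] E 4 5 + E 4 3 \<^bold>\<and>[4/5] E 4 5 + E 4 3 \<^bold>\<and>[2/5] E 1 2 +
        E 5 3 \<^bold>\<and>[2/5] E 1 3) \<and>
    generic_solution T2a (UNIV :: complex set)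
      (\<lambda>c. c \<odot> (H 1 \<^bold>\<and> H 2) + ((c - 1) / 2) \<odot> (H 1 \<^bold>\<and> H 3) + c \<odot> (H 1 \<^bold>\<and> H 4) +
          (- ((1 + 3 * c) / 4)) \<odot> (H 2 \<^bold>\<and> H 3) + ((c - 1) / 2) \<odot> (H 2 \<^bold>\<and> H 4) + c \<odot> (H 3 \<^bold>\<and> H 4))
      (\<lambda>c.
        E 4 3 \<^bold>\<and>[(3 + c) / 8] E 1 2 + E 5 4 \<^bold>\<and>[(3 + c) / 8] E 2 3 + E 5 3 \<^bold>\<and>[(1 - c) / 2] E 1 3) \<and>
    generic_solution T2b (UNIV :: complex set)
      (\<lambda>c. (1/5) \<odot> ((- c) \<odot> (H 1 \<^bold>\<and> H 2) + (- (1 + c)) \<odot> (H 1 \<^bold>\<and> H 3) + (-3) \<odot> (H 1 \<^bold>\<and> H 4) +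
          (-2) \<odot> (H 2 \<^bold>\<and> H 3) + (c - 1) \<odot> (H 2 \<^bold>\<and> H 4) + c \<odot> (H 3 \<^bold>\<and> H 4)))
      (\<lambda>c.
        E 5 4 \<^bold>\<and>[3/5] E 1 2 + E 4 3 \<^bold>\<and>[4/5] E 2 3 + E 5 3 \<^bold>\<and>[9/5] (- E 1 3)) \<and>
    generic_solution T2c (UNIV :: complex set)
      (\<lambda>c. c \<odot> (H 1 \<^bold>\<and> H 2) + (1 + 3 * c) \<odot> (H 1 \<^bold>\<and> H 3) + (8 * c / 3 + 1) \<odot> (H 1 \<^bold>\<and> H 4) +
          (1 + 3 * c) \<odot> (H 2 \<^bold>\<and> H 3) + (1 + 3 * c) \<odot> (H 2 \<^bold>\<and> H 4) + c \<odot> (H 3 \<^bold>\<and> H 4))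
      (\<lambda>c.
        E 3 2 \<^bold>\<and>[1 + c] E 1 2 + E 5 4 \<^bold>\<and>[1 + c] E 3 4) \<and>
    generic_solution T2d (UNIV :: complex set)
      (\<lambda>c. (1/5) \<odot> ((2 - c) \<odot> (H 1 \<^bold>\<and> H 2) + (1 - c) \<odot> (H 1 \<^bold>\<and> H 3) + (-3) \<odot> (H 1 \<^bold>\<and> H 4) +
          2 \<odot> (H 2 \<^bold>\<and> H 3) + (c - 1) \<odot> (H 2 \<^bold>\<and> H 4) + c \<odot> (H 3 \<^bold>\<and> H 4)))
      (\<lambda>c.
        E 5 4 \<^bold>\<and>[2/5] E 1 2 + E 3 2 \<^bold>\<and>[2/5] E 3 4) \<and>
    generic_solution T2e (UNIV :: complex set)
      (\<lambda>c. ((1 - 3 * c) / 2) \<odot> (H 1 \<^bold>\<and> H 2) + ((c - 1) / 2) \<odot> (H 1 \<^bold>\<and> H 3) + c \<odot> (H 1 \<^bold>\<and> H 4) +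
          (3 * c - 1) \<odot> (H 2 \<^bold>\<and> H 3) + (3 * c - 1) \<odot> (H 2 \<^bold>\<and> H 4) + c \<odot> (H 3 \<^bold>\<and> H 4))
      (\<lambda>c.
        E 4 3 \<^bold>\<and>[(1 + 3 * c) / 4] E 1 2 + E 2 1 \<^bold>\<and>[(1 + 3 * c) / 4] E 4 5 + E 4 3 \<^bold>\<and>[1 - c] E 4 5) \<and>
    generic_solution T2f (UNIV :: complex set)
      (\<lambda>c. ((c - 3) / 6) \<odot> (H 1 \<^bold>\<and> H 2) + ((c - 1) / 2) \<odot> (H 1 \<^bold>\<and> H 3) + c \<odot> (H 1 \<^bold>\<and> H 4) +
          ((c - 1) / 2) \<odot> (H 2 \<^bold>\<and> H 3) + (4 * c / 3) \<odot> (H 2 \<^bold>\<and> H 4) + c \<odot> (H 3 \<^bold>\<and> H 4))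
      (\<lambda>c.
        E 3 2 \<^bold>\<and>[1/2 + c/6] E 1 2 + E 4 3 \<^bold>\<and>[1/2 + c/6] E 2 3 + E 4 3 \<^bold>\<and>[1 + c/3] E 1 2 +
        E 4 2 \<^bold>\<and>[1/2 + c/6] E 1 3) \<and>
    generic_solution T3a (UNIV :: (complex \<times> complex \<times> complex) set)
      (\<lambda>(x, y, z). ((1 + y) / 3) \<odot> (H 1 \<^bold>\<and> H 2) + y \<odot> (H 1 \<^bold>\<and> H 3) + ((3 * z - x) / 3) \<odot> (H 1 \<^bold>\<and> H 4) +
          y \<odot> (H 2 \<^bold>\<and> H 3) + z \<odot> (H 2 \<^bold>\<and> H 4) + x \<odot> (H 3 \<^bold>\<and> H 4))
      (\<lambda>(x, y, z).
        E 2 1 \<^bold>\<and>[(2 - y) / 3] E 2 3) \<and>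
    generic_solution T3b (UNIV :: (complex \<times> complex \<times> complex) set)
      (\<lambda>(x, y, z). ((z - 2 * y) / 2) \<odot> (H 1 \<^bold>\<and> H 2) + ((1 + x) / 2) \<odot> (H 1 \<^bold>\<and> H 3) + x \<odot> (H 1 \<^bold>\<and> H 4) +
          y \<odot> (H 2 \<^bold>\<and> H 3) + z \<odot> (H 2 \<^bold>\<and> H 4) + x \<odot> (H 3 \<^bold>\<and> H 4))
      (\<lambda>(x, y, z).
        E 2 1 \<^bold>\<and>[(2 - z) / 4] E 3 4) \<and>
    generic_solution T3c (UNIV :: (complex \<times> complex \<times> complex) set)
      (\<lambda>(x, y, z). ((y - 2 * z) / 2) \<odot> (H 1 \<^bold>\<and> H 2) + ((y - 2 * x) / 2) \<odot> (H 1 \<^bold>\<and> H 3) + ((1 - x + z) / 2) \<odot> (H 1 \<^bold>\<and> H 4) +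
          y \<odot> (H 2 \<^bold>\<and> H 3) + z \<odot> (H 2 \<^bold>\<and> H 4) + x \<odot> (H 3 \<^bold>\<and> H 4))
      (\<lambda>(x, y, z).
        E 2 1 \<^bold>\<and>[(y + 2) / 4] E 4 5) \<and>
    generic_solution T3d (UNIV :: (complex \<times> complex \<times> complex) set)
      (\<lambda>(x, y, z). (-1 + 3 * y - z) \<odot> (H 1 \<^bold>\<and> H 2) + (-1 - x + 3 * y) \<odot> (H 1 \<^bold>\<and> H 3) + (3 * (z - x)) \<odot> (H 1 \<^bold>\<and> H 4) +
          y \<odot> (H 2 \<^bold>\<and> H 3) + z \<odot> (H 2 \<^bold>\<and> H 4) + x \<odot> (H 3 \<^bold>\<and> H 4))
      (\<lambda>(x, y, z).
        E 3 2 \<^bold>\<and>[1 - x - y + z] E 3 4) \<and>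
    generic_solution T4 cartan_wedge (\<lambda>r. r) (\<lambda>_. 0)"
proof (intro conjI, goal_cases)
  case 1
  show ?case using ggs_holds by blast
next
  case 2
  show ?case using triple_action by blast
next
  case 7
  show ?case
    unfolding reps_mk
  \<comment> \<open>The permutation is the cyclic shift i -> i - 1. The last component of each tuple
    is twice the entry of \<epsilon>: for e_54 and e_34 it is -1 and the diagonal part contributes
    1/10, so the exponent is -(-1/2 + 1/10) = 2/5.\<close>
  proof (rule generic_solutionI[where rv = False and p = "Five I5 I1 I2 I3 I4"
      and L = "[(I5, I4, I3, I4, True, - 1), (I5, I4, I2, I3, True, - 2), (I5, I4, I1, I2, True, - 2),
        (I4, I3, I2, I3, True, - 1), (I4, I3, I1, I2, True, - 2), (I3, I2, I1, I2, True, - 1),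
        (I5, I3, I2, I4, True, 0), (I5, I3, I1, I3, True, - 1), (I4, I2, I1, I3, True, 0),
        (I5, I2, I1, I4, True, 0)]"
      and ga = "\<lambda>_. - 3 / 5" and gb = "\<lambda>_. - 4 / 5" and gc = "\<lambda>_. - 3 / 5"
      and gd = "\<lambda>_. - 4 / 5" and ge = "\<lambda>_. - 4 / 5" and gf = "\<lambda>_. - 3 / 5"], goal_cases)
    case (3 a b c d e f)
    hence adm: "adm_eq (wedge_diag a b c d e f) I2 I3 I1 I2"
      "adm_eq (wedge_diag a b c d e f) I3 I4 I2 I3"
      "adm_eq (wedge_diag a b c d e f) I4 I5 I3 I4"
      by (simp_all add: adm_list_def ixn_def)
    \<comment> \<open>Six of the fifteen equations already determine the six coefficients.\<close>
    have "a = - 3 / 5" "b = - 4 / 5" "c = - 3 / 5" "d = - 4 / 5" "e = - 4 / 5" "f = - 3 / 5"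
      using adm_eqD[OF adm(1), of I1] adm_eqD[OF adm(1), of I2] adm_eqD[OF adm(1), of I4]
        adm_eqD[OF adm(2), of I1] adm_eqD[OF adm(2), of I2] adm_eqD[OF adm(3), of I1]
      by (simp_all only: adm_eq_unfold) algebra+
    thus ?case by (intro bexI[of _ "()"]) simp_all
  qed (code_simp, simp add: wedge_elem_def smult_algebra, simp add: adm_list_def ixn_def, simp add: adm_eq_simps,
      simp only: link_sum_simps, (intro arg_cong2[where f = "(+)"] qwedge_cong; simp add: adm_eq_simps(3-)))
next
  case 8
  show ?case
    unfolding reps_mk
  proof (rule generic_solutionI[where rv = False and p = "Five I4 I5 I1 I2 I3"
      and L = "[(I5, I4, I2, I3, True, 0), (I2, I1, I2, I3, True, - 1), (I4, I3, I2, I3, True, - 3),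
        (I2, I1, I4, I5, True, 0), (I4, I3, I4, I5, True, - 1), (I4, I3, I1, I2, True, 0),
        (I5, I3, I1, I3, True, - 1)]"
      and ga = "\<lambda>_. 1 / 5" and gb = "\<lambda>_. - 2 / 5" and gc = "\<lambda>_. 1 / 5"
      and gd = "\<lambda>_. - 2 / 5" and ge = "\<lambda>_. - 2 / 5" and gf = "\<lambda>_. 1 / 5"], goal_cases)
    case (3 a b c d e f)
    hence adm: "adm_eq (wedge_diag a b c d e f) I1 I2 I4 I5"
      "adm_eq (wedge_diag a b c d e f) I3 I4 I1 I2"
      "adm_eq (wedge_diag a b c d e f) I4 I5 I2 I3"
      by (simp_all add: adm_list_def ixn_def)
    have "a = 1 / 5" "b = - 2 / 5" "c = 1 / 5" "d = - 2 / 5" "e = - 2 / 5" "f = 1 / 5"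
      using adm_eqD[OF adm(1), of I1] adm_eqD[OF adm(1), of I2] adm_eqD[OF adm(1), of I3]
        adm_eqD[OF adm(2), of I1] adm_eqD[OF adm(2), of I2] adm_eqD[OF adm(3), of I1]
      by (simp_all only: adm_eq_unfold) algebra+
    thus ?case by (intro bexI[of _ "()"]) simp_all
  qed (code_simp, simp add: wedge_elem_def smult_algebra, simp add: adm_list_def ixn_def, simp add: adm_eq_simps,
      simp only: link_sum_simps, (intro arg_cong2[where f = "(+)"] qwedge_cong; simp add: adm_eq_simps(3-)))
next
  case 9
  show ?case
    unfolding reps_mk
  proof (rule generic_solutionI[where rv = False and p = "Five I4 I5 I1 I2 I3"
      and L = "[(I4, I3, I1, I2, True, 0), (I5, I4, I2, I3, True, 0), (I5, I3, I1, I3, True, - 1)]"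
      and ga = "\<lambda>c. c" and gb = "\<lambda>c. (c - 1) / 2" and gc = "\<lambda>c. c"
      and gd = "\<lambda>c. - ((1 + 3 * c) / 4)" and ge = "\<lambda>c. (c - 1) / 2" and gf = "\<lambda>c. c"], goal_cases)
    case (3 a b c d e f)
    hence adm: "adm_eq (wedge_diag a b c d e f) I3 I4 I1 I2"
      "adm_eq (wedge_diag a b c d e f) I4 I5 I2 I3"
      by (simp_all add: adm_list_def ixn_def)
    have "a = (f)" "b = ((f) - 1) / 2" "c = (f)" "d = - ((1 + 3 * (f)) / 4)" "e = ((f) - 1) / 2"
      using adm_eqD[OF adm(1), of I1] adm_eqD[OF adm(1), of I2] adm_eqD[OF adm(1), of I3]
        adm_eqD[OF adm(2), of I1] adm_eqD[OF adm(2), of I2]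
      by (simp_all only: adm_eq_unfold) algebra+
    thus ?case by (intro bexI[of _ "f"]) simp_all
  qed (code_simp, simp add: wedge_elem_def smult_algebra, simp add: adm_list_def ixn_def, simp add: adm_eq_simps,
      simp only: link_sum_simps, (intro arg_cong2[where f = "(+)"] qwedge_cong; simp add: adm_eq_simps(3-)))
next
  case 10
  show ?case
    unfolding reps_mk
  \<comment> \<open>Here \<tau> reverses the order of the simple roots; on 3, 4, 5 the permutation
    is i -> 6 - i. The root \<alpha>_3 + \<alpha>_4 has even height, and its sign is the entry
    \<open>False\<close>, the source of -e_13.\<close>
  proof (rule generic_solutionI[where rv = True and p = "Five I4 I5 I3 I2 I1"
      and L = "[(I5, I4, I1, I2, True, 0), (I4, I3, I2, I3, True, - 1), (I5, I3, I1, I3, False, 3)]"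
      and ga = "\<lambda>c. - c / 5" and gb = "\<lambda>c. - (1 + c) / 5" and gc = "\<lambda>c. - 3 / 5"
      and gd = "\<lambda>c. - 2 / 5" and ge = "\<lambda>c. (c - 1) / 5" and gf = "\<lambda>c. c / 5"], goal_cases)
    case (3 a b c d e f)
    hence adm: "adm_eq (wedge_diag a b c d e f) I3 I4 I2 I3"
      "adm_eq (wedge_diag a b c d e f) I4 I5 I1 I2"
      by (simp_all add: adm_list_def ixn_def)
    have "a = - (5 * f) / 5" "b = - (1 + (5 * f)) / 5" "c = - 3 / 5" "d = - 2 / 5" "e = ((5 * f) - 1) / 5"
      using adm_eqD[OF adm(1), of I1] adm_eqD[OF adm(1), of I2] adm_eqD[OF adm(1), of I3]
        adm_eqD[OF adm(2), of I1] adm_eqD[OF adm(2), of I2]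
      by (simp_all only: adm_eq_unfold) algebra+
    \<comment> \<open>The displayed coefficient of h_3 wedge h_4 is c/5, so the parameter is 5 times
      the coordinate f.\<close>
    thus ?case by (intro bexI[of _ "5 * f"]) simp_all
  qed (code_simp, simp add: wedge_elem_def smult_algebra, simp add: adm_list_def ixn_def, simp add: adm_eq_simps,
      simp only: link_sum_simps, (intro arg_cong2[where f = "(+)"] qwedge_cong; simp add: adm_eq_simps(3-)))
next
  case 11
  show ?case
    unfolding reps_mk
  proof (rule generic_solutionI[where rv = False and p = "Five I5 I1 I2 I3 I4"
      and L = "[(I3, I2, I1, I2, True, - 1), (I5, I4, I3, I4, True, - 1)]"
      and ga = "\<lambda>c. c" and gb = "\<lambda>c. 1 + 3 * c" and gc = "\<lambda>c. 8 * c / 3 + 1"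
      and gd = "\<lambda>c. 1 + 3 * c" and ge = "\<lambda>c. 1 + 3 * c" and gf = "\<lambda>c. c"], goal_cases)
    case (3 a b c d e f)
    hence adm: "adm_eq (wedge_diag a b c d e f) I2 I3 I1 I2"
      "adm_eq (wedge_diag a b c d e f) I4 I5 I3 I4"
      by (simp_all add: adm_list_def ixn_def)
    have "a = (f)" "b = 1 + 3 * (f)" "c = 8 * (f) / 3 + 1" "d = 1 + 3 * (f)" "e = 1 + 3 * (f)"
      using adm_eqD[OF adm(1), of I1] adm_eqD[OF adm(1), of I2] adm_eqD[OF adm(1), of I4]
        adm_eqD[OF adm(2), of I1] adm_eqD[OF adm(2), of I2]
      by (simp_all only: adm_eq_unfold) algebra+
    thus ?case by (intro bexI[of _ "f"]) simp_all
  qed (code_simp, simp add: wedge_elem_def smult_algebra, simp add: adm_list_def ixn_def, simp add: adm_eq_simps,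
      simp only: link_sum_simps, (intro arg_cong2[where f = "(+)"] qwedge_cong; simp add: adm_eq_simps(3-)))
next
  case 12
  show ?case
    unfolding reps_mk
  proof (rule generic_solutionI[where rv = False and p = "Five I5 I3 I4 I1 I2"
      and L = "[(I5, I4, I1, I2, True, 0), (I3, I2, I3, I4, True, - 1)]"
      and ga = "\<lambda>c. (2 - c) / 5" and gb = "\<lambda>c. (1 - c) / 5" and gc = "\<lambda>c. - 3 / 5"
      and gd = "\<lambda>c. 2 / 5" and ge = "\<lambda>c. (c - 1) / 5" and gf = "\<lambda>c. c / 5"], goal_cases)
    case (3 a b c d e f)
    hence adm: "adm_eq (wedge_diag a b c d e f) I2 I3 I3 I4"
      "adm_eq (wedge_diag a b c d e f) I4 I5 I1 I2"
      by (simp_all add: adm_list_def ixn_def)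
    have "a = (2 - (5 * f)) / 5" "b = (1 - (5 * f)) / 5" "c = - 3 / 5" "d = 2 / 5" "e = ((5 * f) - 1) / 5"
      using adm_eqD[OF adm(1), of I1] adm_eqD[OF adm(1), of I2] adm_eqD[OF adm(1), of I3]
        adm_eqD[OF adm(2), of I1] adm_eqD[OF adm(2), of I2]
      by (simp_all only: adm_eq_unfold) algebra+
    thus ?case by (intro bexI[of _ "5 * f"]) simp_all
  qed (code_simp, simp add: wedge_elem_def smult_algebra, simp add: adm_list_def ixn_def, simp add: adm_eq_simps,
      simp only: link_sum_simps, (intro arg_cong2[where f = "(+)"] qwedge_cong; simp add: adm_eq_simps(3-)))
next
  case 13
  show ?case
    unfolding reps_mk
  proof (rule generic_solutionI[where rv = False and p = "Five I4 I5 I1 I2 I3"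
      and L = "[(I4, I3, I1, I2, True, 0), (I2, I1, I4, I5, True, 0), (I4, I3, I4, I5, True, - 1)]"
      and ga = "\<lambda>c. (1 - 3 * c) / 2" and gb = "\<lambda>c. (c - 1) / 2" and gc = "\<lambda>c. c"
      and gd = "\<lambda>c. 3 * c - 1" and ge = "\<lambda>c. 3 * c - 1" and gf = "\<lambda>c. c"], goal_cases)
    case (3 a b c d e f)
    hence adm: "adm_eq (wedge_diag a b c d e f) I1 I2 I4 I5"
      "adm_eq (wedge_diag a b c d e f) I3 I4 I1 I2"
      by (simp_all add: adm_list_def ixn_def)
    have "a = (1 - 3 * (f)) / 2" "b = ((f) - 1) / 2" "c = (f)" "d = 3 * (f) - 1" "e = 3 * (f) - 1"
      using adm_eqD[OF adm(1), of I1] adm_eqD[OF adm(1), of I2] adm_eqD[OF adm(1), of I3]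
        adm_eqD[OF adm(2), of I1] adm_eqD[OF adm(2), of I2]
      by (simp_all only: adm_eq_unfold) algebra+
    thus ?case by (intro bexI[of _ "f"]) simp_all
  qed (code_simp, simp add: wedge_elem_def smult_algebra, simp add: adm_list_def ixn_def, simp add: adm_eq_simps,
      simp only: link_sum_simps, (intro arg_cong2[where f = "(+)"] qwedge_cong; simp add: adm_eq_simps(3-)))
next
  case 14
  show ?case
    unfolding reps_mk
  proof (rule generic_solutionI[where rv = False and p = "Five I4 I1 I2 I3 I5"
      and L = "[(I3, I2, I1, I2, True, - 1), (I4, I3, I2, I3, True, - 1), (I4, I3, I1, I2, True, - 2),
        (I4, I2, I1, I3, True, 0)]"
      and ga = "\<lambda>c. (c - 3) / 6" and gb = "\<lambda>c. (c - 1) / 2" and gc = "\<lambda>c. c"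
      and gd = "\<lambda>c. (c - 1) / 2" and ge = "\<lambda>c. 4 * c / 3" and gf = "\<lambda>c. c"], goal_cases)
    case (3 a b c d e f)
    hence adm: "adm_eq (wedge_diag a b c d e f) I2 I3 I1 I2"
      "adm_eq (wedge_diag a b c d e f) I3 I4 I2 I3"
      by (simp_all add: adm_list_def ixn_def)
    have "a = ((f) - 3) / 6" "b = ((f) - 1) / 2" "c = (f)" "d = ((f) - 1) / 2" "e = 4 * (f) / 3"
      using adm_eqD[OF adm(1), of I1] adm_eqD[OF adm(1), of I2] adm_eqD[OF adm(1), of I4]
        adm_eqD[OF adm(2), of I1] adm_eqD[OF adm(2), of I2]
      by (simp_all only: adm_eq_unfold) algebra+
    thus ?case by (intro bexI[of _ "f"]) simp_all
  qed (code_simp, simp add: wedge_elem_def smult_algebra, simp add: adm_list_def ixn_def, simp add: adm_eq_simps,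
      simp only: link_sum_simps, (intro arg_cong2[where f = "(+)"] qwedge_cong; simp add: adm_eq_simps(3-)))
next
  case 15
  show ?case
    unfolding reps_mk
  proof (rule generic_solutionI[where rv = False and p = "Five I2 I3 I1 I4 I5"
      and L = "[(I2, I1, I2, I3, True, - 1)]"
      and ga = "\<lambda>(x, y, z). (1 + y) / 3" and gb = "\<lambda>(x, y, z). y" and gc = "\<lambda>(x, y, z). (3 * z - x) / 3"
      and gd = "\<lambda>(x, y, z). y" and ge = "\<lambda>(x, y, z). z" and gf = "\<lambda>(x, y, z). x"], goal_cases)
    case (3 a b c d e f)
    hence adm: "adm_eq (wedge_diag a b c d e f) I1 I2 I2 I3"
      by (simp_all add: adm_list_def ixn_def)
    have "a = (1 + d) / 3" "b = d" "c = (3 * e - f) / 3"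
      using adm_eqD[OF adm, of I1] adm_eqD[OF adm, of I2] adm_eqD[OF adm, of I4]
      by (simp_all only: adm_eq_unfold) algebra+
    \<comment> \<open>The parameters x, y, z are the coefficients of h_3 wedge h_4, h_2 wedge h_3
      and h_2 wedge h_4, in this order.\<close>
    thus ?case by (intro bexI[of _ "(f, d, e)"]) simp_all
  next
    case (4 u)
    show ?case by (cases u rule: prod_cases3) (simp add: adm_list_def ixn_def, simp add: adm_eq_simps)
  qed (code_simp, auto simp: wedge_elem_def smult_algebra link_sum_simps adm_eq_simps(3-) intro!: qwedge_cong)
next
  case 16
  show ?case
    unfolding reps_mk
  proof (rule generic_solutionI[where rv = False and p = "Five I3 I4 I1 I2 I5"
      and L = "[(I2, I1, I3, I4, True, 0)]"
      and ga = "\<lambda>(x, y, z). (z - 2 * y) / 2" and gb = "\<lambda>(x, y, z). (1 + x) / 2" and gc = "\<lambda>(x, y, z). x"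
      and gd = "\<lambda>(x, y, z). y" and ge = "\<lambda>(x, y, z). z" and gf = "\<lambda>(x, y, z). x"], goal_cases)
    case (3 a b c d e f)
    hence adm: "adm_eq (wedge_diag a b c d e f) I1 I2 I3 I4"
      by (simp_all add: adm_list_def ixn_def)
    have "a = (e - 2 * d) / 2" "b = (1 + f) / 2" "c = f"
      using adm_eqD[OF adm, of I1] adm_eqD[OF adm, of I2] adm_eqD[OF adm, of I3]
      by (simp_all only: adm_eq_unfold) algebra+
    thus ?case by (intro bexI[of _ "(f, d, e)"]) simp_all
  next
    case (4 u)
    show ?case by (cases u rule: prod_cases3) (simp add: adm_list_def ixn_def, simp add: adm_eq_simps)
  qed (code_simp, auto simp: wedge_elem_def smult_algebra link_sum_simps adm_eq_simps(3-) intro!: qwedge_cong)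
next
  case 17
  show ?case
    unfolding reps_mk
  proof (rule generic_solutionI[where rv = False and p = "Five I4 I5 I1 I2 I3"
      and L = "[(I2, I1, I4, I5, True, 0)]"
      and ga = "\<lambda>(x, y, z). (y - 2 * z) / 2" and gb = "\<lambda>(x, y, z). (y - 2 * x) / 2" and gc = "\<lambda>(x, y, z). (1 - x + z) / 2"
      and gd = "\<lambda>(x, y, z). y" and ge = "\<lambda>(x, y, z). z" and gf = "\<lambda>(x, y, z). x"], goal_cases)
    case (3 a b c d e f)
    hence adm: "adm_eq (wedge_diag a b c d e f) I1 I2 I4 I5"
      by (simp_all add: adm_list_def ixn_def)
    have "a = (d - 2 * e) / 2" "b = (d - 2 * f) / 2" "c = (1 - f + e) / 2"
      using adm_eqD[OF adm, of I1] adm_eqD[OF adm, of I2] adm_eqD[OF adm, of I3]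
      by (simp_all only: adm_eq_unfold) algebra+
    thus ?case by (intro bexI[of _ "(f, d, e)"]) simp_all
  next
    case (4 u)
    show ?case by (cases u rule: prod_cases3) (simp add: adm_list_def ixn_def, simp add: adm_eq_simps)
  qed (code_simp, auto simp: wedge_elem_def smult_algebra link_sum_simps adm_eq_simps(3-) intro!: qwedge_cong)
next
  case 18
  show ?case
    unfolding reps_mk
  proof (rule generic_solutionI[where rv = False and p = "Five I1 I3 I4 I2 I5"
      and L = "[(I3, I2, I3, I4, True, - 1)]"
      and ga = "\<lambda>(x, y, z). -1 + 3 * y - z" and gb = "\<lambda>(x, y, z). -1 - x + 3 * y" and gc = "\<lambda>(x, y, z). 3 * (z - x)"
      and gd = "\<lambda>(x, y, z). y" and ge = "\<lambda>(x, y, z). z" and gf = "\<lambda>(x, y, z). x"], goal_cases)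
    case (3 a b c d e f)
    hence adm: "adm_eq (wedge_diag a b c d e f) I2 I3 I3 I4"
      by (simp_all add: adm_list_def ixn_def)
    have "a = -1 + 3 * d - e" "b = -1 - f + 3 * d" "c = 3 * (e - f)"
      using adm_eqD[OF adm, of I1] adm_eqD[OF adm, of I2] adm_eqD[OF adm, of I3]
      by (simp_all only: adm_eq_unfold) algebra+
    thus ?case by (intro bexI[of _ "(f, d, e)"]) simp_all
  next
    case (4 u)
    show ?case by (cases u rule: prod_cases3) (simp add: adm_list_def ixn_def, simp add: adm_eq_simps)
  qed (code_simp, auto simp: wedge_elem_def smult_algebra link_sum_simps adm_eq_simps(3-) intro!: qwedge_cong)
qed (fact card_orbits card_reps reps_bd orbit_rep generic_T4)+

end
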